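(* Let $V$ be a rational vertex operator algebra with $V=\bigoplus_{n\ge 0}V_n$ and central charge $c$, and let $U$ be an irreducible $V$-module which is spanned by elements of the form $L(-n_1)\cdots L(-n_t)u$ ($n_1,\dots,n_t>0$) with $u\in U$ satisfying $L(n)u=0$ for all $n>0$. Assume that the weights of $U$ are real and let $t+2m$, with $-1<t\le 1$ and $m\in\mathbb Z$, be the lowest weight of $U$. For $S(\ast,\tau)\in C_1(U)$ and $\gamma=\begin{pmatrix}0&-1\\1&0\end{pmatrix}\in SL(2,\mathbb Z)$ define $$S|\gamma(u,\tau)=(-\sqrt{-1}\,\tau)^{-t}\,\tau^{t-k}\,S\Big(u,\frac{-1}{\tau}\Big)\qquad\text{for }u\in U_{[k]}$$ (extended to $U(\Gamma(1))$ $M(\Gamma(1))$-linearly), where the principal branch is used for $(-\sqrt{-1}\,\tau)^{-t}$ and $\tau^{t-k}$ is an integral power. Then $S|\gamma(\ast,\tau)\in C_1(U)$.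
   Context: Vertex operators: $Y(v,z)=\sum_{n\in\mathbb Z}v(n)z^{-n-1}$, $Y(\omega,z)=\sum_n L(n)z^{-n-2}$. "Rational" means that $V$ has only finitely many irreducible modules and all $V$-modules are completely reducible. A $V$-module $M=\bigoplus_{n\ge0}M(n)$ is graded with finite-dimensional $M(n)$ on each of which $L(0)$ acts as a scalar, and satisfies the usual module axioms; an irreducible module has the form $\bigoplus_{n\ge 0}M_{r+n}$, with $L(0)=r+n$ on $M_{r+n}$ ($r$ the lowest weight). Square-bracket modes: for homogeneous $a\in V$ put $Y^U[a,z]=Y^U(a,e^z-1)e^{z\,\mathrm{wt}(a)}=\sum_n a[n]z^{-n-1}$, extended linearly in $a$; $\tilde\omega=\omega-\frac{c}{24}\mathbf 1$, $L[n]=\tilde\omega[n+1]$, $U_{[k]}=\{u\in U: L[0]u=ku\}$. One has $U=\bigoplus_k U_{[k]}$ with $k\in t+\mathbb Z$ for the nonzero $U_{[k]}$. Eisenstein series: $E_{2k}(\tau)=(2\pi i)^{-2k}G_{2k}(\tau)$, with $G_{2k}(\tau)=\sum_{(m,n)\ne(0,0)}(m\tau+n)^{-2k}$ for $k\ge2$ and $G_2(\tau)=\frac{\pi^2}{3}+\sum_{m\ne0}\sum_{n\in\mathbb Z}(m\tau+n)^{-2}$. $M(\Gamma(1))=\bigoplus_k M_k(\Gamma(1))$ is the ring of holomorphic modular forms on $SL_2(\mathbb Z)$; $U(\Gamma(1))=M(\Gamma(1))\otimes_{\mathbb C}U$. $O_q(U)\subseteq U(\Gamma(1))$ is the $M(\Gamma(1))$-submodule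 generated by $v[0]u$ and $v[-2]u+\sum_{k\ge2}(2k-1)E_{2k}(\tau)\otimes v[2k-2]u$ for $v\in V,u\in U$. Let $\mathcal H$ be the upper half-plane. $C_1(U)$ (the space of one point functions on $U$) is the $\mathbb C$-vector space of functions $S:U(\Gamma(1))\times\mathcal H\to\mathbb C$ with: (C1) $S(u,\tau)$ is holomorphic in $\tau$ for each $u\in U(\Gamma(1))$; (C2) $S$ is $\mathbb C$-linear in $u$ and $S(f\otimes u,\tau)=f(\tau)S(u,\tau)$ for $f\in M(\Gamma(1))$, $u\in U$; (C3) $S(u,\tau)=0$ for $u\in O_q(U)$; (C4) for $u\in U$, $S(L[-2]u,\tau)=\partial S(u,\tau)+\sum_{k\ge2}E_{2k}(\tau)S(L[2k-2]u,\tau)$, where $\partial$ is linear in $u$ with $\partial S(u,\tau)=\frac1{2\pi i}\frac{d}{d\tau}S(u,\tau)+kE_2(\tau)S(u,\tau)$ for $u\in U_{[k]}$. *)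

theory Defs
  imports
    "HOL-Complex_Analysis.Complex_Analysis"
    "HOL-Library.Groups_Big_Fun"
begin

text \<open>The underlying space of a vertex operator algebra is a whole type;
  \<open>vmode V v n\<close> is the mode \<open>v(n)\<close>.  A module structure lives on a type \<open>'m\<close>, and the
  predicates below take the carrier of the module, a subspace of that type, as a separate
  argument.\<close>

record 'v voa =
  vscale :: "complex \<Rightarrow> 'v \<Rightarrow> 'v"
  vmode :: "'v \<Rightarrow> int \<Rightarrow> 'v \<Rightarrow> 'v"
  vac :: 'v
  conf :: 'v
  charge :: complex

record ('v, 'm) vmod =
  mscale :: "complex \<Rightarrow> 'm \<Rightarrow> 'm"
  mmode :: "'v \<Rightarrow> int \<Rightarrow> 'm \<Rightarrow> 'm"

definition adjoint_mod :: "'v voa \<Rightarrow> ('v, 'v) vmod" where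
  "adjoint_mod V = \<lparr> mscale = vscale V, mmode = vmode V \<rparr>"

definition Lmode :: "'v voa \<Rightarrow> ('v, 'm) vmod \<Rightarrow> int \<Rightarrow> 'm \<Rightarrow> 'm" where
  "Lmode V M n = mmode M (conf V) (n + 1)"

definition weight_space :: "'v voa \<Rightarrow> ('v, 'm) vmod \<Rightarrow> complex \<Rightarrow> 'm set" where
  "weight_space V M r = {x. Lmode V M 0 x = mscale M r x}"

abbreviation voa_piece :: "'v voa \<Rightarrow> nat \<Rightarrow> 'v set" where
  "voa_piece V n \<equiv> weight_space V (adjoint_mod V) (of_nat n)"

definition direct_sum ::
  "(complex \<Rightarrow> 'm::ab_group_add \<Rightarrow> 'm) \<Rightarrow> 'i set \<Rightarrow> ('i \<Rightarrow> 'm set) \<Rightarrow> 'm set \<Rightarrow> bool" where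
  "direct_sum s I N W \<longleftrightarrow>
     (\<forall>i\<in>I. module.subspace s (N i)) \<and>
     W = module.span s (\<Union>i\<in>I. N i) \<and>
     (\<forall>J x. finite J \<and> J \<subseteq> I \<and> (\<forall>i\<in>J. x i \<in> N i) \<and> (\<Sum>i\<in>J. x i) = 0 \<longrightarrow> (\<forall>i\<in>J. x i = 0))"

definition finite_dim :: "(complex \<Rightarrow> 'm::ab_group_add \<Rightarrow> 'm) \<Rightarrow> 'm set \<Rightarrow> bool" where
  "finite_dim s W \<longleftrightarrow> (\<exists>B. finite B \<and> W = module.span s B)"

text \<open>The Jacobi identity in component form (Borcherds identity).  Every sum has finite
  support once the truncation condition holds; \<open>Sum_any\<close> sums a finitely supported family.\<close>

definition borcherds :: "'v voa \<Rightarrow> ('v, 'm::ab_group_add) vmod \<Rightarrow> 'm set \<Rightarrow> bool" where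
  "borcherds V M W \<longleftrightarrow> (\<forall>a b. \<forall>x\<in>W. \<forall>l m n.
     Sum_any (\<lambda>i::nat. mscale M (of_int m gchoose i)
       (mmode M (vmode V a (l + int i) b) (m + n - int i) x)) =
     Sum_any (\<lambda>i::nat. mscale M ((-1) ^ i * (of_int l gchoose i))
       (mmode M a (l + m - int i) (mmode M b (n + int i) x) -
        mscale M ((-1) powi l) (mmode M b (l + n - int i) (mmode M a (m + int i) x)))))"

definition weak_module :: "'v::ab_group_add voa \<Rightarrow> ('v, 'm::ab_group_add) vmod \<Rightarrow> 'm set \<Rightarrow> bool" where
  "weak_module V M W \<longleftrightarrow>
     vector_space (vscale V) \<and> vector_space (mscale M) \<and> module.subspace (mscale M) W \<and>
     (\<forall>v n. \<forall>x\<in>W. mmode M v n x \<in> W) \<and>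
     (\<forall>v n. \<forall>x\<in>W. \<forall>y\<in>W. mmode M v n (x + y) = mmode M v n x + mmode M v n y) \<and>
     (\<forall>v n a. \<forall>x\<in>W. mmode M v n (mscale M a x) = mscale M a (mmode M v n x)) \<and>
     (\<forall>v w n. \<forall>x\<in>W. mmode M (v + w) n x = mmode M v n x + mmode M w n x) \<and>
     (\<forall>v n a. \<forall>x\<in>W. mmode M (vscale V a v) n x = mscale M a (mmode M v n x)) \<and>
     (\<forall>v. \<forall>x\<in>W. \<exists>N. \<forall>n\<ge>N. mmode M v n x = 0) \<and>
     (\<forall>n. \<forall>x\<in>W. mmode M (vac V) n x = (if n = -1 then x else 0)) \<and>
     borcherds V M W"

definition vertex_operator_algebra :: "'v::ab_group_add voa \<Rightarrow> bool" where
  "vertex_operator_algebra V \<longleftrightarrow>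
     weak_module V (adjoint_mod V) UNIV \<and>
     (\<forall>v. vmode V v (-1) (vac V) = v \<and> (\<forall>n\<ge>0. vmode V v n (vac V) = 0)) \<and>
     (\<forall>m n x. let L = Lmode V (adjoint_mod V) in
        L m (L n x) - L n (L m x) =
        vscale V (of_int (m - n)) (L (m + n) x) +
        (if m + n = 0 then vscale V (of_int (m ^ 3 - m) / 12 * charge V) x else 0)) \<and>
     (\<forall>v n x. vmode V (Lmode V (adjoint_mod V) (-1) v) n x =
        vscale V (- of_int n) (vmode V v (n - 1) x)) \<and>
     direct_sum (vscale V) UNIV (voa_piece V) UNIV \<and>
     (\<forall>n. finite_dim (vscale V) (voa_piece V n)) \<and>
     vac V \<in> voa_piece V 0 \<and> conf V \<in> voa_piece V 2"

text \<open>The pieces of the grading need not be full eigenspaces of \<open>L(0)\<close>; homogeneous modes respect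
  the grading, as usual for modules graded by the natural numbers.  The Virasoro relations and
  the \<open>L(-1)\<close>-derivative property on a module follow from the Borcherds identity.\<close>

definition voa_module :: "'v::ab_group_add voa \<Rightarrow> ('v, 'm::ab_group_add) vmod \<Rightarrow> 'm set \<Rightarrow> bool" where
  "voa_module V M W \<longleftrightarrow> weak_module V M W \<and>
     (\<exists>G :: nat \<Rightarrow> 'm set.
        direct_sum (mscale M) UNIV G W \<and>
        (\<forall>n. finite_dim (mscale M) (G n)) \<and>
        (\<forall>n. \<exists>r. G n \<subseteq> weight_space V M r) \<and>
        (\<forall>k j n. \<forall>v\<in>voa_piece V k. \<forall>x\<in>G j.
           let d = int j + int k - n - 1 in
           mmode M v n x \<in> (if d < 0 then {0} else G (nat d))))"

definition submodule :: "('v, 'm::ab_group_add) vmod \<Rightarrow> 'm set \<Rightarrow> 'm set \<Rightarrow> bool" where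
  "submodule M N W \<longleftrightarrow> N \<subseteq> W \<and> module.subspace (mscale M) N \<and> (\<forall>v n. \<forall>x\<in>N. mmode M v n x \<in> N)"

definition irreducible_module :: "'v::ab_group_add voa \<Rightarrow> ('v, 'm::ab_group_add) vmod \<Rightarrow> 'm set \<Rightarrow> bool" where
  "irreducible_module V M W \<longleftrightarrow>
     voa_module V M W \<and> W \<noteq> {0} \<and> (\<forall>N. submodule M N W \<longrightarrow> N = {0} \<or> N = W)"

definition completely_reducible :: "'v::ab_group_add voa \<Rightarrow> ('v, 'm::ab_group_add) vmod \<Rightarrow> 'm set \<Rightarrow> bool" where
  "completely_reducible V M W \<longleftrightarrow>
     (\<exists>\<N>. (\<forall>N\<in>\<N>. submodule M N W \<and> irreducible_module V M N) \<and>
          direct_sum (mscale M) \<N> (\<lambda>N. N) W)"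

text \<open>Isomorphisms ignore the grading: shifting it does not give a new irreducible module.\<close>

definition module_iso ::
  "('v, 'm::ab_group_add) vmod \<Rightarrow> 'm set \<Rightarrow> ('v, 'n::ab_group_add) vmod \<Rightarrow> 'n set \<Rightarrow> bool" where
  "module_iso M W M' W' \<longleftrightarrow> (\<exists>\<phi>. bij_betw \<phi> W W' \<and>
     (\<forall>x\<in>W. \<forall>y\<in>W. \<phi> (x + y) = \<phi> x + \<phi> y) \<and>
     (\<forall>a. \<forall>x\<in>W. \<phi> (mscale M a x) = mscale M' a (\<phi> x)) \<and>
     (\<forall>v n. \<forall>x\<in>W. \<phi> (mmode M v n x) = mmode M' v n (\<phi> x)))"

text \<open>A module has countable dimension, so it is isomorphic to one whose carrier is a
  subspace of the space \<open>complex poly\<close> of countably infinite dimension.  Quantifying over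
  these modules is therefore quantifying over all modules.\<close>

definition rational_voa :: "'v::ab_group_add voa \<Rightarrow> bool" where
  "rational_voa V \<longleftrightarrow>
     (\<exists>R :: (('v, complex poly) vmod \<times> complex poly set) set. finite R \<and>
        (\<forall>(M, W)\<in>R. mscale M = smult \<and> irreducible_module V M W) \<and>
        (\<forall>M W. mscale M = smult \<and> irreducible_module V M W \<longrightarrow>
           (\<exists>(M', W')\<in>R. module_iso M W M' W'))) \<and>
     (\<forall>(M :: ('v, complex poly) vmod) W. mscale M = smult \<and> voa_module V M W \<longrightarrow>
        completely_reducible V M W)"

definition is_weight :: "'v voa \<Rightarrow> ('v, 'm::zero) vmod \<Rightarrow> complex \<Rightarrow> bool" where
  "is_weight V M r \<longleftrightarrow> (\<exists>x. x \<noteq> 0 \<and> x \<in> weight_space V M r)"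

definition primary_vector :: "'v voa \<Rightarrow> ('v, 'm::zero) vmod \<Rightarrow> 'm \<Rightarrow> bool" where
  "primary_vector V M u \<longleftrightarrow> (\<forall>n>0. Lmode V M n u = 0)"

definition spanned_by_primaries :: "'v voa \<Rightarrow> ('v, 'm::ab_group_add) vmod \<Rightarrow> bool" where
  "spanned_by_primaries V M \<longleftrightarrow>
     module.span (mscale M)
       {foldr (\<lambda>n. Lmode V M (- int n)) ns u | ns u. (\<forall>n\<in>set ns. 0 < n) \<and> primary_vector V M u} = UNIV"

definition voa_component :: "'v::ab_group_add voa \<Rightarrow> nat \<Rightarrow> 'v \<Rightarrow> 'v" where
  "voa_component V n v = (THE f. (\<forall>i. f i \<in> voa_piece V i) \<and> finite {i. f i \<noteq> 0} \<and> v = Sum_any f) n"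

text \<open>The coefficient of \<open>z\<^sup>-\<^sup>n\<^sup>-\<^sup>1\<close> in the Laurent series \<open>(e\<^sup>z - 1)\<^sup>-\<^sup>m\<^sup>-\<^sup>1 e\<^sup>w\<^sup>z\<close>, i.e. the
  coefficient of \<open>a(m)\<close> in \<open>a[n]\<close> for \<open>a\<close> of weight \<open>w\<close>.  It vanishes for \<open>m < n\<close>.\<close>

definition square_coeff :: "nat \<Rightarrow> int \<Rightarrow> int \<Rightarrow> complex" where
  "square_coeff w m n = fls_nth
     (fps_to_fls (fps_exp 1 - 1) powi (- m - 1) * fps_to_fls (fps_exp (of_nat w))) (- n - 1)"

definition square_mode :: "'v::ab_group_add voa \<Rightarrow> ('v, 'm::ab_group_add) vmod \<Rightarrow> 'v \<Rightarrow> int \<Rightarrow> 'm \<Rightarrow> 'm" where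
  "square_mode V M a n u = Sum_any (\<lambda>w::nat. Sum_any (\<lambda>m::int.
     mscale M (square_coeff w m n) (mmode M (voa_component V w a) m u)))"

definition square_L :: "'v::ab_group_add voa \<Rightarrow> ('v, 'm::ab_group_add) vmod \<Rightarrow> int \<Rightarrow> 'm \<Rightarrow> 'm" where
  "square_L V M n = square_mode V M (conf V - vscale V (charge V / 24) (vac V)) (n + 1)"

definition square_weight_space ::
  "'v::ab_group_add voa \<Rightarrow> ('v, 'm::ab_group_add) vmod \<Rightarrow> complex \<Rightarrow> 'm set" where
  "square_weight_space V M k = {u. square_L V M 0 u = mscale M k u}"

definition uhp :: "complex set" where
  "uhp = {\<tau>. 0 < Im \<tau>}"

text \<open>Functions on the upper half-plane are represented by functions on all complex numbers
  that vanish off it.\<close>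

definition modular_forms :: "int \<Rightarrow> (complex \<Rightarrow> complex) set" where
  "modular_forms k = {f. f holomorphic_on uhp \<and>
     (\<forall>a b c d :: int. a * d - b * c = 1 \<longrightarrow> (\<forall>\<tau>\<in>uhp.
        f ((of_int a * \<tau> + of_int b) / (of_int c * \<tau> + of_int d)) =
        (of_int c * \<tau> + of_int d) powi k * f \<tau>)) \<and>
     (\<exists>B C. \<forall>\<tau>. C < Im \<tau> \<and> 0 < Im \<tau> \<longrightarrow> norm (f \<tau>) \<le> B) \<and>
     (\<forall>\<tau>. \<tau> \<notin> uhp \<longrightarrow> f \<tau> = 0)}"

text \<open>Nonzero forms of different weights are linearly independent functions, so the graded
  ring is a sum inside the space of functions.\<close>

definition modular_ring :: "(complex \<Rightarrow> complex) set" where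
  "modular_ring = {f. \<exists>K F. finite K \<and> (\<forall>k\<in>K. F k \<in> modular_forms k) \<and> f = (\<lambda>\<tau>. \<Sum>k\<in>K. F k \<tau>)}"

definition one_form :: "complex \<Rightarrow> complex" where
  "one_form \<tau> = (if \<tau> \<in> uhp then 1 else 0)"

definition eisenstein_G :: "nat \<Rightarrow> complex \<Rightarrow> complex" where
  "eisenstein_G w \<tau> =
     (if w = 2 then
        of_real (pi ^ 2 / 3) +
        (\<Sum>\<^sub>\<infinity>m\<in>UNIV - {0::int}. \<Sum>\<^sub>\<infinity>n\<in>(UNIV::int set). 1 / (of_int m * \<tau> + of_int n) ^ 2)
      else
        (\<Sum>\<^sub>\<infinity>(m, n)\<in>UNIV - {(0::int, 0::int)}. 1 / (of_int m * \<tau> + of_int n) ^ w))"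

definition eisenstein_E :: "nat \<Rightarrow> complex \<Rightarrow> complex" where
  "eisenstein_E w \<tau> =
     (if \<tau> \<in> uhp then eisenstein_G w \<tau> / (2 * of_real pi * \<i>) ^ w else 0)"

text \<open>The tensor product of the ring of modular forms with a module \<open>U\<close> is realised as the space of
  \<open>U\<close>-valued functions \<open>\<tau> \<mapsto> \<Sum>\<^sub>i f\<^sub>i(\<tau>) u\<^sub>i\<close>; lemma \<open>pure_tensor_independent\<close> below shows that no
  relations are added.\<close>

definition pure_tensor :: "('v, 'u) vmod \<Rightarrow> (complex \<Rightarrow> complex) \<Rightarrow> 'u \<Rightarrow> complex \<Rightarrow> 'u" where
  "pure_tensor U f u = (\<lambda>\<tau>. mscale U (f \<tau>) u)"

definition tensor_space :: "('v, 'u::ab_group_add) vmod \<Rightarrow> (complex \<Rightarrow> 'u) set" where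
  "tensor_space U = {x. \<exists>(n::nat) f u. (\<forall>i<n. f i \<in> modular_ring) \<and>
     x = (\<lambda>\<tau>. \<Sum>i<n. pure_tensor U (f i) (u i) \<tau>)}"

lemma pure_tensor_independent:
  assumes "vector_space (mscale U)" and "finite B" and "\<not> module.dependent (mscale U) B"
    and "(\<lambda>\<tau>. \<Sum>u\<in>B. pure_tensor U (f u) u \<tau>) = (\<lambda>\<tau>. 0)" and "u \<in> B"
  shows "f u = (\<lambda>\<tau>. 0)"
proof
  fix \<tau>
  interpret vector_space "mscale U" by fact
  have "(\<Sum>u\<in>B. mscale U (f u \<tau>) u) = 0"
    using fun_cong[OF assms(4), of \<tau>] by (simp add: pure_tensor_def)
  then show "f u \<tau> = 0"
    using assms(2,3,5) independentD[of B B "\<lambda>u. f u \<tau>" u] by blast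
qed

abbreviation tensor_one :: "('v, 'u) vmod \<Rightarrow> 'u \<Rightarrow> complex \<Rightarrow> 'u" where
  "tensor_one U u \<equiv> pure_tensor U one_form u"

definition modular_submodule :: "('v, 'u::ab_group_add) vmod \<Rightarrow> (complex \<Rightarrow> 'u) set \<Rightarrow> bool" where
  "modular_submodule U N \<longleftrightarrow> (\<lambda>\<tau>. 0) \<in> N \<and>
     (\<forall>x\<in>N. \<forall>y\<in>N. (\<lambda>\<tau>. x \<tau> + y \<tau>) \<in> N) \<and>
     (\<forall>f\<in>modular_ring. \<forall>x\<in>N. (\<lambda>\<tau>. mscale U (f \<tau>) (x \<tau>)) \<in> N)"

definition Oq_generators ::
  "'v::ab_group_add voa \<Rightarrow> ('v, 'u::ab_group_add) vmod \<Rightarrow> (complex \<Rightarrow> 'u) set" where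
  "Oq_generators V U =
     {tensor_one U (square_mode V U v 0 u) | v u. True} \<union>
     {(\<lambda>\<tau>. tensor_one U (square_mode V U v (-2) u) \<tau> +
        Sum_any (\<lambda>k::nat. if 2 \<le> k then
          mscale U (of_nat (2 * k - 1))
            (pure_tensor U (eisenstein_E (2 * k)) (square_mode V U v (2 * int k - 2) u) \<tau>)
          else 0)) | v u. True}"

definition Oq :: "'v::ab_group_add voa \<Rightarrow> ('v, 'u::ab_group_add) vmod \<Rightarrow> (complex \<Rightarrow> 'u) set" where
  "Oq V U = modular_submodule U hull Oq_generators V U"

text \<open>Condition (C2), for functions on \<open>tensor_space U\<close> times the upper half-plane.  As above,
  such a function is extended by 0 outside its domain.\<close>

definition modular_linear :: "('v, 'u::ab_group_add) vmod \<Rightarrow> ((complex \<Rightarrow> 'u) \<Rightarrow> complex \<Rightarrow> complex) \<Rightarrow> bool" where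
  "modular_linear U S \<longleftrightarrow>
     (\<forall>x \<tau>. x \<notin> tensor_space U \<or> \<tau> \<notin> uhp \<longrightarrow> S x \<tau> = 0) \<and>
     (\<forall>x\<in>tensor_space U. \<forall>y\<in>tensor_space U. \<forall>\<tau>\<in>uhp. S (\<lambda>\<sigma>. x \<sigma> + y \<sigma>) \<tau> = S x \<tau> + S y \<tau>) \<and>
     (\<forall>a. \<forall>x\<in>tensor_space U. \<forall>\<tau>\<in>uhp. S (\<lambda>\<sigma>. mscale U a (x \<sigma>)) \<tau> = a * S x \<tau>) \<and>
     (\<forall>f\<in>modular_ring. \<forall>u. \<forall>\<tau>\<in>uhp. S (pure_tensor U f u) \<tau> = f \<tau> * S (tensor_one U u) \<tau>)"

text \<open>In (C4), \<open>D u \<tau>\<close> is \<open>\<partial>S(u,\<tau>)\<close>.\<close>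

definition one_point_functions ::
  "'v::ab_group_add voa \<Rightarrow> ('v, 'u::ab_group_add) vmod \<Rightarrow> ((complex \<Rightarrow> 'u) \<Rightarrow> complex \<Rightarrow> complex) set" where
  "one_point_functions V U = {S.
     (\<forall>x\<in>tensor_space U. S x holomorphic_on uhp) \<and>
     modular_linear U S \<and>
     (\<forall>x\<in>Oq V U. \<forall>\<tau>\<in>uhp. S x \<tau> = 0) \<and>
     (\<exists>D :: 'u \<Rightarrow> complex \<Rightarrow> complex.
        (\<forall>u u'. \<forall>\<tau>\<in>uhp. D (u + u') \<tau> = D u \<tau> + D u' \<tau>) \<and>
        (\<forall>a u. \<forall>\<tau>\<in>uhp. D (mscale U a u) \<tau> = a * D u \<tau>) \<and>
        (\<forall>k. \<forall>u\<in>square_weight_space V U k. \<forall>\<tau>\<in>uhp.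
           D u \<tau> = 1 / (2 * of_real pi * \<i>) * deriv (S (tensor_one U u)) \<tau> +
             k * eisenstein_E 2 \<tau> * S (tensor_one U u) \<tau>) \<and>
        (\<forall>u. \<forall>\<tau>\<in>uhp. S (tensor_one U (square_L V U (-2) u)) \<tau> = D u \<tau> +
           Sum_any (\<lambda>k::nat. if 2 \<le> k then
             eisenstein_E (2 * k) \<tau> * S (tensor_one U (square_L V U (2 * int k - 2) u)) \<tau>
             else 0)))}"

text \<open>The transform of \<open>S\<close> under \<open>\<tau> \<mapsto> -1/\<tau>\<close>: the linear extension over the ring of modular forms
  of the given formula on the square-bracket weight spaces of weight \<open>k = t + n\<close> with \<open>n\<close> an integer
  (the other ones are zero), so that \<open>\<tau>\<^sup>t\<^sup>-\<^sup>k\<close> is the integral power \<open>\<tau>\<^sup>-\<^sup>n\<close>.\<close>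

definition slash_gamma ::
  "'v::ab_group_add voa \<Rightarrow> ('v, 'u::ab_group_add) vmod \<Rightarrow> real \<Rightarrow>
   ((complex \<Rightarrow> 'u) \<Rightarrow> complex \<Rightarrow> complex) \<Rightarrow> (complex \<Rightarrow> 'u) \<Rightarrow> complex \<Rightarrow> complex" where
  "slash_gamma V U t S = (THE S'. modular_linear U S' \<and>
     (\<forall>n::int. \<forall>u\<in>square_weight_space V U (of_real t + of_int n). \<forall>\<tau>\<in>uhp.
        S' (tensor_one U u) \<tau> =
          (- \<i> * \<tau>) powr (- of_real t) * \<tau> powi (- n) * S (tensor_one U u) (- 1 / \<tau>)))"

end

theory Submission
  imports Defs
begin

text \<open>In square bracket modes the Virasoro operator \<open>L[0]\<close> is \<open>\<Sum>\<^sub>j c\<^sub>j L(j)\<close>, where \<open>c\<^sub>j\<close> is the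
  coefficient of \<open>w\<^sup>j\<^sup>+\<^sup>1\<close> in \<open>(1 + w) ln (1 + w)\<close>.  It is therefore triangular with respect to the
  \<open>L(0)\<close>-grading, so \<open>V\<close> and \<open>U\<close> are spanned by its eigenvectors, and two convolution identities
  for the coefficients of \<open>(e\<^sup>z - 1)\<^sup>-\<^sup>m\<^sup>-\<^sup>1 e\<^sup>w\<^sup>z\<close> turn the Borcherds identity into
  \<open>[L[0], v[n]] = (L[0]v)[n] - (n + 1) v[n]\<close>, so that square modes are homogeneous.  Hence all
  terms of each relation defining a one point function have the same total weight once \<open>E\<^sub>2\<^sub>k\<close> is
  given weight \<open>2k\<close>, and each relation at \<open>-1/\<tau>\<close> is a multiple of the transformed relation at \<open>\<tau>\<close>.  The
  only defects, the derivative of the automorphy factor in \<open>\<partial>\<close> and the anomaly of \<open>E\<^sub>2\<close>, cancel.\<close>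

section \<open>Coefficients of square bracket modes\<close>

text \<open>Square bracket modes are modes in the coordinate \<open>z\<close> with
  \<open>w = e^z - 1\<close>. The Euler field \<open>z d/dz\<close>, to which \<open>L[0]\<close>
  belongs, becomes \<open>(1 + w) ln (1 + w) d/dw\<close>, while \<open>w^(j+1) d/dw\<close> belongs
  to \<open>L(j)\<close>; this is the origin of the coefficients of \<open>L[0]\<close>. The grading
  by \<open>L[0]\<close> is also what makes the transform well defined, since it is prescribed only
  on the spaces \<open>U_[k]\<close>. Irreducibility and the lowest weight confine \<open>k\<close>
  to \<open>t + Z\<close>. On this coset \<open>(- \<i> \<tau>)^(-t) \<tau>^(t-k)\<close> is a
  branch of \<open>\<tau>^(-k)\<close> up to a constant that does not depend on \<open>k\<close>,
  and such a constant is harmless because all conditions are linear in \<open>S\<close>. The final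
  cancellation is the equality of two terms
  \<open>- k \<tau>^(-k-1) S(u, -1/\<tau>) / (2 pi \<i>)\<close>, one from differentiating the
  automorphy factor, the other from the anomaly of \<open>E_2\<close>. So the exact constant of that
  anomaly matters; extracting it from a conditionally convergent double series is the analytic
  obstacle.\<close>

definition exp_shift :: "complex fps" where
  "exp_shift = fps_exp 1 - 1"

abbreviation exp_shift_fls :: "complex fls" where
  "exp_shift_fls \<equiv> fps_to_fls exp_shift"

lemma exp_shift_nth_0 [simp]: "exp_shift $ 0 = 0"
  by (simp add: exp_shift_def)

lemma subdegree_exp_shift [simp]: "subdegree exp_shift = 1"
  by (rule subdegreeI) (auto simp: exp_shift_def)

lemma exp_shift_nonzero [simp]: "exp_shift \<noteq> 0"
  by (metis subdegree_0 subdegree_exp_shift zero_neq_one)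

lemma fls_subdegree_exp_shift [simp]: "fls_subdegree exp_shift_fls = 1"
  by (simp add: fls_subdegree_fls_to_fps subdegree_exp_shift)

lemma fls_exp_eq: "fps_to_fls (fps_exp (1::complex)) = 1 + exp_shift_fls"
  by (simp add: exp_shift_def)

lemma one_plus_exp_shift: "1 + exp_shift = fps_exp 1"
  by (simp add: exp_shift_def)

lemma fls_exp_mult:
  "fps_to_fls (fps_exp (a::complex)) * fps_to_fls (fps_exp b) = fps_to_fls (fps_exp (a + b))"
  by (simp add: fls_times_fps_to_fls fps_exp_add_mult)

lemma fls_deriv_exp: "fls_deriv (fps_to_fls (fps_exp (a::complex))) = fls_const a * fps_to_fls (fps_exp a)"
  by (simp add: fls_deriv_fps_to_fls fls_times_fps_to_fls)

lemma fls_deriv_exp_shift: "fls_deriv exp_shift_fls = fps_to_fls (fps_exp 1)"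
  by (simp add: fls_deriv_fps_to_fls exp_shift_def)

lemma fls_deriv_power_int:
  fixes f :: "complex fls"
  assumes "f \<noteq> 0"
  shows "fls_deriv (f powi k) = of_int k * f powi (k - 1) * fls_deriv f"
proof (cases "k \<ge> 0")
  case True
  then obtain n where k: "k = int n" using nonneg_int_cases by blast
  show ?thesis
  proof (cases n)
    case 0
    then show ?thesis using k by simp
  next
    case (Suc j)
    have "k - 1 = int j" using k Suc by simp
    then have "f powi (k - 1) = f ^ j" by simp
    then show ?thesis by (simp add: k Suc fls_deriv_power del: power_Suc of_nat_Suc)
  qed
next
  case False
  define n where "n = nat (- k)"
  have k: "k = - int n" and n0: "n > 0" using False by (auto simp: n_def)
  \<comment> \<open>For a negative exponent the rule is read off from the derivative of this
    product, after cancelling the nonzero factor \<open>f ^ n\<close>.\<close>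
  have one: "f powi k * f ^ n = 1"
    using assms by (simp add: k power_int_minus)
  have "0 = fls_deriv (f powi k * f ^ n)" by (simp add: one)
  also have "\<dots> = fls_deriv (f powi k) * f ^ n + f powi k * (of_nat n * f ^ (n - 1) * fls_deriv f)"
    by (simp add: fls_deriv_power algebra_simps)
  finally have "fls_deriv (f powi k) * f ^ n = - (f powi k) * (of_nat n * f ^ (n - 1) * fls_deriv f)"
    by (simp add: eq_neg_iff_add_eq_0)
  also have "\<dots> = (of_int k * f powi (k - 1) * fls_deriv f) * f ^ n"
  proof -
    have "f powi (k - 1) * f ^ n = f powi k * f ^ (n - 1)"
      using assms n0 by (simp add: power_int_diff field_simps flip: power_Suc)
    then show ?thesis by (simp add: k algebra_simps)
  qed
  finally show ?thesis using assms by simp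
qed

section \<open>Recursions for the square coefficients\<close>

abbreviation square_series :: "nat \<Rightarrow> int \<Rightarrow> complex fls" where
  "square_series w m \<equiv> exp_shift_fls powi (- m - 1) * fps_to_fls (fps_exp (of_nat w))"

lemma fls_subdegree_square_series [simp]: "fls_subdegree (square_series w m) = - m - 1"
proof -
  have "fps_exp (of_nat w :: complex) \<noteq> 0"
    by (metis fps_exp_neq_0)
  then show ?thesis
    by (subst fls_subdegree_mult) (simp_all add: fls_subdegree_fls_to_fps power_int_eq_0_iff)
qed

lemma square_coeff_eq: "square_coeff w m n = fls_nth (square_series w m) (- n - 1)"
  by (simp add: square_coeff_def exp_shift_def)

lemma square_coeff_eq_0: "m < n \<Longrightarrow> square_coeff w m n = 0"
  unfolding square_coeff_eq by (rule fls_eq0_below_subdegree) simp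

text \<open>Raising the weight multiplies the series by \<open>e^z = (e^z - 1) + 1\<close>, and the
  factor \<open>e^z - 1\<close> lowers the mode index by one.\<close>

lemma square_coeff_Suc: "square_coeff (Suc w) m n = square_coeff w (m - 1) n + square_coeff w m n"
proof -
  have "square_series (Suc w) m = square_series w m * fps_to_fls (fps_exp 1)"
    by (simp add: mult.assoc fls_exp_mult add.commute)
  also have "\<dots> = exp_shift_fls powi (- m - 1) * exp_shift_fls * fps_to_fls (fps_exp (of_nat w)) + square_series w m"
    unfolding fls_exp_eq by (simp add: algebra_simps)
  also have "exp_shift_fls powi (- m - 1) * exp_shift_fls = exp_shift_fls powi (- (m - 1) - 1)"
    using power_int_add_1[of exp_shift_fls "- m - 1"] by simp
  finally show ?thesis by (simp add: square_coeff_eq)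
qed

text \<open>Differentiating \<open>(e^z - 1)^(-m)\<close> produces a factor \<open>e^z\<close>, that
  is, the series of weight 1; compare coefficients.\<close>

lemma square_coeff_1: "of_int m * square_coeff 1 m n = of_int n * square_coeff 0 (m - 1) (n - 1)"
proof -
  have "fls_deriv (exp_shift_fls powi (- m)) = - of_int m * square_series 1 m"
    by (subst fls_deriv_power_int) (simp_all add: fls_deriv_exp_shift)
  from arg_cong[OF this, of "\<lambda>f. fls_nth f (- n - 1)"] show ?thesis
    by (simp add: square_coeff_eq flip: fls_of_int)
qed

text \<open>These are the residues of \<open>(e^z - 1)^(-k-1)\<close>. For \<open>k > 0\<close> the
  series of weight 1 is a multiple of a derivative and has residue 0, so the recursion in the weight
  forces consecutive residues to be opposite.\<close>

lemma square_coeff_0_0: "square_coeff 0 (int k) 0 = (- 1) ^ k"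
proof (induction k)
  case 0
  have "fls_nth (inverse exp_shift_fls) (fls_subdegree (inverse exp_shift_fls)) = 1"
    by (subst fls_inverse_subdegree_base) (simp, simp add: exp_shift_def)
  then show ?case by (simp add: square_coeff_eq power_int_minus)
next
  case (Suc k)
  have "square_coeff 1 (int (Suc k)) 0 = 0"
    using square_coeff_1[of "int (Suc k)" 0] by (auto simp del: of_nat_Suc)
  then show ?case using square_coeff_Suc[of 0 "int (Suc k)" 0] Suc by (simp add: eq_neg_iff_add_eq_0 add.commute)
qed

text \<open>In weight 1 the residues, divided by the index, are the coefficients of
  \<open>ln (1 + w)\<close>. Passing to weight 2 adds a shifted copy, which is multiplication by
  \<open>1 + w\<close>.\<close>

lemma square_coeff_2_1:
  "square_coeff 2 (int j + 1) 1 = fps_ln 1 $ j + fps_ln 1 $ (j + 1)"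
proof -
  have *: "square_coeff 1 (int k) 1 = fps_ln 1 $ k" for k
  proof (cases k)
    case 0
    show ?thesis by (simp add: 0 square_coeff_eq_0)
  next
    case (Suc i)
    have "of_nat (Suc i) * square_coeff 1 (int (Suc i)) 1 = (- 1) ^ i"
      using square_coeff_1[of "int (Suc i)" 1] by (simp add: square_coeff_0_0)
    then show ?thesis by (simp add: Suc fps_ln_nth field_simps del: of_nat_Suc)
  qed
  show ?thesis using square_coeff_Suc[of 1 "int j + 1" 1] *[of j] *[of "j + 1"]
    by (simp add: numeral_2_eq_2 add.commute)
qed

text \<open>Entry \<open>j\<close> is the coefficient of \<open>L(j)\<close> in \<open>L[0]\<close>:
  the conformal vector has weight 2, \<open>L(j)\<close> is its mode \<open>j + 1\<close>, and
  \<open>L[0]\<close> its square mode 1. As a series in \<open>w\<close> this is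
  \<open>(1 + w) ln (1 + w) / w\<close>.\<close>

definition log_coeffs :: "complex fps" where
  "log_coeffs = Abs_fps (\<lambda>j. square_coeff 2 (int j + 1) 1)"

lemma X_times_log_coeffs: "fps_X * log_coeffs = (1 + fps_X) * fps_ln 1"
proof (rule fps_ext)
  fix n show "(fps_X * log_coeffs) $ n = ((1 + fps_X) * fps_ln 1 :: complex fps) $ n"
    by (cases n) (simp_all add: log_coeffs_def square_coeff_2_1 distrib_right)
qed

lemma log_coeffs_nth: "0 < j \<Longrightarrow> log_coeffs $ j = (- 1) ^ (j - 1) / (of_nat j * (of_nat j + 1))"
proof -
  assume "0 < j"
  then obtain k where k: "j = Suc k" by (cases j) auto
  have nz: "of_nat k + 2 \<noteq> (0 :: complex)" "of_nat k + 1 \<noteq> (0 :: complex)"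
    using of_nat_neq_0[of "k + 1", where 'a = complex] of_nat_neq_0[of "k", where 'a = complex]
    by (simp_all add: add_ac)
  have "(- 1) ^ k / (of_nat k + 1) - (- 1) ^ k / (of_nat k + 2) = (- 1) ^ k / ((of_nat k + 1) * (of_nat k + 2 :: complex))"
    using nz by (simp add: field_simps)
  then show ?thesis
    using square_coeff_2_1[of j] by (simp add: k log_coeffs_def fps_ln_nth add_ac)
qed

section \<open>Substitution of \<open>e^z - 1\<close> into power series\<close>

lemma fps_ln_compose_exp_shift: "fps_ln 1 oo exp_shift = (fps_X :: complex fps)"
  unfolding fps_ln_fps_exp_inv[OF one_neq_zero] exp_shift_def by (rule fps_inv) auto

lemma fps_to_fls_sum: "fps_to_fls (\<Sum>i\<in>I. f i) = (\<Sum>i\<in>I. fps_to_fls (f i))"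
  by (induction I rule: infinite_finite_induct) simp_all

lemma fls_nth_times_compose:
  fixes F :: "complex fps"
  assumes "N - fls_subdegree A \<le> int K"
  shows "fls_nth (A * fps_to_fls (F oo exp_shift)) N = (\<Sum>j\<le>K. F $ j * fls_nth (A * exp_shift_fls ^ j) N)"
proof (cases "A = 0")
  case False
  let ?E = exp_shift
  \<comment> \<open>A polynomial of degree at most \<open>K\<close> plus a multiple of
    \<open>X^(K+1)\<close>; after substitution the latter starts beyond degree
    \<open>N\<close>.\<close>
  have F: "F = (\<Sum>j\<le>K. fps_const (F $ j) * fps_X ^ j) + fps_shift (Suc K) F * fps_X ^ Suc K"
  proof -
    have "fps_cutoff (Suc K) F = (\<Sum>j\<le>K. fps_const (F $ j) * fps_X ^ j)"
    proof (rule fps_ext)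
      fix n
      have "(\<Sum>j\<le>K. F $ j * (if n = j then 1 else 0)) = (\<Sum>j\<le>K. if n = j then F $ j else 0)"
        by (rule sum.cong) auto
      then show "fps_cutoff (Suc K) F $ n = (\<Sum>j\<le>K. fps_const (F $ j) * fps_X ^ j) $ n"
        by (simp add: fps_sum_nth fps_X_power_nth)
    qed
    then show ?thesis
      using fps_shift_cutoff[of "Suc K" F] by (simp only: add.commute)
  qed
  have "F oo ?E = (\<Sum>j\<le>K. fps_const (F $ j) * ?E ^ j) + (fps_shift (Suc K) F oo ?E) * ?E ^ Suc K"
    by (subst F) (simp add: fps_compose_add_distrib fps_compose_sum_distrib fps_compose_mult_distrib
      fps_X_power_compose del: power_Suc)
  then have "fps_to_fls (F oo ?E) = (\<Sum>j\<le>K. fls_const (F $ j) * exp_shift_fls ^ j)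
      + fps_to_fls (fps_shift (Suc K) F oo ?E) * exp_shift_fls ^ Suc K"
    by (simp add: fps_to_fls_power fps_to_fls_sum fls_times_fps_to_fls del: power_Suc)
  then have "A * fps_to_fls (F oo ?E) = (\<Sum>j\<le>K. fls_const (F $ j) * (A * exp_shift_fls ^ j))
      + A * (fps_to_fls (fps_shift (Suc K) F oo ?E) * exp_shift_fls ^ Suc K)"
    by (simp add: sum_distrib_left algebra_simps del: power_Suc)
  moreover have "fls_nth (A * (fps_to_fls (fps_shift (Suc K) F oo ?E) * exp_shift_fls ^ Suc K)) N = 0"
  proof (cases "fps_to_fls (fps_shift (Suc K) F oo ?E) = 0")
    case nz: False
    have "fls_subdegree (A * (fps_to_fls (fps_shift (Suc K) F oo ?E) * exp_shift_fls ^ Suc K))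
      = fls_subdegree A + fls_subdegree (fps_to_fls (fps_shift (Suc K) F oo ?E)) + int (Suc K)"
      using False nz by (simp add: fls_subdegree_pow del: power_Suc)
    moreover have "fls_subdegree (fps_to_fls (fps_shift (Suc K) F oo ?E)) \<ge> 0"
      by (rule fls_subdegree_fls_to_fps_gt0)
    ultimately show ?thesis using assms by (intro fls_eq0_below_subdegree) linarith
  qed simp
  ultimately show ?thesis by (simp add: fls_nth_sum)
qed simp

lemma square_series_times_power: "square_series w m * exp_shift_fls ^ j = square_series w (m - int j)"
proof -
  have "exp_shift_fls powi (- m - 1) * exp_shift_fls ^ j = exp_shift_fls powi (- (m - int j) - 1)"
    using power_int_add[of exp_shift_fls "- m - 1" "int j"] by (simp add: algebra_simps)
  then show ?thesis by (simp only: mult_ac)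
qed

text \<open>Multiplying the square series by a power of \<open>e^z - 1\<close> only shifts its mode
  index, so a convolution in that index is multiplication by \<open>F(e^z - 1)\<close>.\<close>

lemma square_coeff_compose:
  fixes F :: "complex fps"
  assumes "p - n \<le> int K"
  shows "(\<Sum>j\<le>K. F $ j * square_coeff w (p - int j) n)
       = fls_nth (square_series w p * fps_to_fls (F oo exp_shift)) (- n - 1)"
  using fls_nth_times_compose[of "- n - 1" "square_series w p" K F] assms
  by (simp add: square_coeff_eq square_series_times_power)

lemma log_coeffs_compose:
  "exp_shift_fls * fps_to_fls (log_coeffs oo exp_shift) = fps_to_fls (fps_exp 1) * fls_X"
proof -
  have "(fps_X * log_coeffs) oo exp_shift = fps_exp 1 * fps_X"
    unfolding X_times_log_coeffs
    by (simp add: fps_compose_mult_distrib fps_compose_add_distrib fps_ln_compose_exp_shift one_plus_exp_shift)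
  then have "exp_shift * (log_coeffs oo exp_shift) = fps_exp 1 * fps_X"
    by (simp add: fps_compose_mult_distrib)
  from arg_cong[OF this, of fps_to_fls] show ?thesis by (simp add: fls_times_fps_to_fls)
qed

lemma log_coeffs_deriv_compose:
  "fps_deriv (fps_X * log_coeffs) oo exp_shift = fps_X + 1"
proof -
  have "(1 + fps_X) * inverse (1 + fps_X) = (1 :: complex fps)"
    by (rule inverse_mult_eq_1') simp
  then have "fps_deriv ((1 + fps_X) * fps_ln (1 :: complex)) = fps_ln 1 + 1"
    by (simp add: fps_ln_deriv)
  then show ?thesis
    unfolding X_times_log_coeffs
    by (simp only: fps_compose_add_distrib fps_ln_compose_exp_shift fps_compose_1)
qed

text \<open>The Euler field \<open>z d/dz\<close> acts on coefficients by their degree. At degree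
  \<open>- n - 1\<close> this gives the factor \<open>h - n - 1\<close> in the commutator of
  \<open>L[0]\<close> with a mode of weight \<open>h\<close>.\<close>

lemma fls_nth_const_times_add_X_times_deriv:
  "fls_nth (fls_const (a :: complex) * A + fls_X * fls_deriv A) n = (a + of_int n) * fls_nth A n"
  by (simp add: fls_X_times_conv_shift algebra_simps)

text \<open>The two convolution identities express that \<open>f(w) = (1 + w) ln (1 + w)\<close> satisfies
  \<open>f(e\<^sup>z - 1) = z e\<^sup>z\<close> and \<open>f'(e\<^sup>z - 1) = 1 + z\<close>, respectively that the Taylor coefficients of order
  \<open>q + 1 \<ge> 2\<close> of \<open>f\<close> at \<open>e\<^sup>z - 1\<close> and at 0 differ by the factor \<open>e\<^sup>-\<^sup>q\<^sup>z\<close>.\<close>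

lemma square_coeff_convolution_deriv:
  assumes "p - n \<le> int K"
  shows "(\<Sum>j\<le>K. log_coeffs $ j * square_coeff w (p - int j) n * ((of_nat j + 1) * of_nat w - (of_int p + 1)))
       = (of_nat w - of_int n - 1) * square_coeff w p n"
proof -
  let ?A = "square_series w p"
  \<comment> \<open>The factor \<open>j + 1\<close> is absorbed by a derivative: the terms carrying
    it assemble to \<open>f'(e^z - 1)\<close>, the others to
    \<open>f(e^z - 1) / (e^z - 1)\<close>.\<close>
  have dX: "fps_deriv (fps_X * log_coeffs) $ j = (of_nat j + 1) * log_coeffs $ j" for j
    by (cases j) (simp_all add: algebra_simps)
  have "(\<Sum>j\<le>K. log_coeffs $ j * square_coeff w (p - int j) n * ((of_nat j + 1) * of_nat w - (of_int p + 1)))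
     = of_nat w * (\<Sum>j\<le>K. fps_deriv (fps_X * log_coeffs) $ j * square_coeff w (p - int j) n)
       - (of_int p + 1) * (\<Sum>j\<le>K. log_coeffs $ j * square_coeff w (p - int j) n)"
    unfolding dX by (simp add: sum_distrib_left flip: sum_subtractf) (simp add: algebra_simps)
  also have "\<dots> = of_nat w * fls_nth (?A * (fls_X + 1)) (- n - 1)
     - (of_int p + 1) * fls_nth (?A * fps_to_fls (log_coeffs oo exp_shift)) (- n - 1)"
    unfolding square_coeff_compose[OF assms] log_coeffs_deriv_compose by simp
  also have "\<dots> = fls_nth (fls_const (of_nat w) * (?A * (fls_X + 1))
       - fls_const (of_int p + 1) * (?A * fps_to_fls (log_coeffs oo exp_shift))) (- n - 1)"
    by simp
  \<comment> \<open>In \<open>z\<close> times the derivative of \<open>?A\<close>, the exponential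
    factor contributes the weight times \<open>z ?A\<close>. The negative power contributes
    \<open>- (p + 1)\<close> times a series containing \<open>z e^z\<close>, which is the composed
    logarithmic series up to the factor \<open>e^z - 1\<close>.\<close>
  also have "fls_const (of_nat w) * (?A * (fls_X + 1))
       - fls_const (of_int p + 1) * (?A * fps_to_fls (log_coeffs oo exp_shift))
     = fls_const (of_nat w) * ?A + fls_X * fls_deriv ?A"
  proof -
    let ?W = "fps_to_fls (fps_exp (of_nat w :: complex))"
    let ?Q = "exp_shift_fls powi (- p - 1 - 1)"
    have d0: "fls_deriv ?A = of_int (- p - 1) * ?Q * fps_to_fls (fps_exp 1) * ?W + fls_const (of_nat w) * ?A"
      by (simp add: fls_deriv_power_int fls_deriv_exp_shift fls_deriv_exp algebra_simps)
    have d: "fls_deriv ?A = fls_const (of_nat w) * ?A - fls_const (of_int p + 1) * (?Q * fps_to_fls (fps_exp 1) * ?W)"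
    proof -
      have e: "(of_int (- p - 1) :: complex fls) = - fls_const (of_int p + 1)"
        unfolding fls_of_int by (simp add: fls_eq_iff)
      show ?thesis using d0 unfolding e by (simp add: mult_ac)
    qed
    have "exp_shift_fls powi (- p - 1) = ?Q * exp_shift_fls"
      by (metis diff_add_cancel exp_shift_nonzero fps_to_fls_eq_0_iff power_int_add_1)
    then have "?A * fps_to_fls (log_coeffs oo exp_shift) = ?Q * ?W * (exp_shift_fls * fps_to_fls (log_coeffs oo exp_shift))"
      by (simp only: mult_ac)
    then have c: "?A * fps_to_fls (log_coeffs oo exp_shift) = ?Q * ?W * (fps_to_fls (fps_exp 1) * fls_X)"
      unfolding log_coeffs_compose .
    show ?thesis unfolding c d by (simp only: algebra_simps) simp
  qed
  also have "fls_nth (fls_const (of_nat w) * ?A + fls_X * fls_deriv ?A) (- n - 1)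
     = (of_nat w - of_int n - 1) * square_coeff w p n"
    unfolding square_coeff_eq fls_nth_const_times_add_X_times_deriv by simp
  finally show ?thesis .
qed

lemma square_coeff_convolution_binomial:
  assumes q: "1 \<le> q" "q \<le> w" and "p - n + int q \<le> int K"
  shows "(\<Sum>j\<le>K. log_coeffs $ j * (of_nat (Suc j) gchoose Suc q) * square_coeff w (p - int j + int q) n)
       = log_coeffs $ q * square_coeff (w - q) p n"
proof -
  \<comment> \<open>The derivative of order \<open>q + 1\<close> of
    \<open>(1 + w) ln (1 + w)\<close>, divided by \<open>(q + 1)!\<close>: for
    \<open>q \<ge> 1\<close> it is a multiple of \<open>(1 + w)^(-q)\<close>. Substitution makes
    this \<open>e^(-qz)\<close>, which lowers the weight by \<open>q\<close>.\<close>
  define F :: "complex fps" where "F = fps_const (log_coeffs $ q) * fps_binomial (- of_nat q)"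
  have qK: "q \<le> K \<or> p < n" using assms by linarith
  have nz: "(of_nat j :: complex) \<noteq> 0" if "0 < j" for j using that by simp
  \<comment> \<open>Two applications of the absorption identity for binomial coefficients cancel the
    denominator \<open>j (j + 1)\<close> of \<open>log_coeffs\<close> at
    \<open>j = i + q\<close>.\<close>
  have Fi: "log_coeffs $ (i + q) * (of_nat (Suc (i + q)) gchoose Suc q) = F $ i" for i
  proof -
    obtain r where r: "q = Suc r" using q by (cases q) auto
    have "(r + 2) * ((r + 1) * (i + r + 2 choose (r + 2))) = (i + r + 2) * ((i + r + 1) * (i + r choose r))"
    proof -
      have "(r + 2) * (i + r + 2 choose (r + 2)) = (i + r + 2) * (i + r + 1 choose (r + 1))"
        using Suc_times_binomial[of "r + 1" "i + r + 1"] by (simp del: binomial_Suc_Suc)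
      moreover have "(r + 1) * (i + r + 1 choose (r + 1)) = (i + r + 1) * (i + r choose r)"
        using Suc_times_binomial[of r "i + r"] by (simp del: binomial_Suc_Suc)
      ultimately show ?thesis by (metis mult.left_commute)
    qed
    then have "of_nat ((r + 2) * ((r + 1) * (i + r + 2 choose (r + 2)))) =
      (of_nat ((i + r + 2) * ((i + r + 1) * (i + r choose r))) :: complex)" by (rule arg_cong)
    then have *: "(of_nat r + 2) * ((of_nat r + 1) * of_nat (i + r + 2 choose (r + 2))) =
      (of_nat i + of_nat r + 2) * ((of_nat i + of_nat r + 1) * (of_nat (i + r choose r) :: complex))"
      by (simp only: of_nat_mult of_nat_add of_nat_numeral of_nat_1)
    have neg: "(- of_nat q :: complex) gchoose i = (- 1) ^ i * of_nat (i + r choose r)"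
      using gbinomial_negated_upper[of "- of_nat q :: complex" i] binomial_symmetric[of r "i + r"]
      by (simp add: r binomial_gbinomial add.commute)
    have nz: "of_nat r + 2 \<noteq> (0 :: complex)" "of_nat r + 1 \<noteq> (0 :: complex)"
      "of_nat i + of_nat r + 2 \<noteq> (0 :: complex)" "of_nat i + of_nat r + 1 \<noteq> (0 :: complex)"
      using of_nat_neq_0[of "r + 1", where 'a = complex] of_nat_neq_0[of "r", where 'a = complex]
        of_nat_neq_0[of "i + r + 1", where 'a = complex] of_nat_neq_0[of "i + r", where 'a = complex]
      by (simp_all add: add_ac)
    have C: "(of_nat (Suc (i + q)) gchoose Suc q :: complex) = of_nat (i + r + 2 choose (r + 2))"
    proof -
      have "Suc (i + q) = i + r + 2" "Suc q = r + 2" by (simp_all add: r)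
      then show ?thesis by (simp only: binomial_gbinomial)
    qed
    have D: "(of_nat (i + r + 2 choose (r + 2)) :: complex) = (of_nat i + of_nat r + 2) *
       ((of_nat i + of_nat r + 1) * of_nat (i + r choose r)) / ((of_nat r + 2) * (of_nat r + 1))"
    proof (rule nonzero_eq_divide_eq[THEN iffD2])
      show "of_nat (i + r + 2 choose (r + 2)) * ((of_nat r + 2) * (of_nat r + 1)) =
        (of_nat i + of_nat r + 2) * ((of_nat i + of_nat r + 1) * (of_nat (i + r choose r) :: complex))"
        using * by (simp only: mult_ac)
    qed (use nz in simp)
    have c1: "log_coeffs $ (i + q) = (- 1) ^ (i + r) / ((of_nat i + of_nat r + 1) * (of_nat i + of_nat r + 2))"
      by (simp add: log_coeffs_nth r add_ac)
    have c2: "log_coeffs $ q = (- 1) ^ r / ((of_nat r + 1) * (of_nat r + 2))"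
      by (simp add: log_coeffs_nth r add_ac)
    show ?thesis
      unfolding F_def C D c1 c2 fps_mult_left_const_nth fps_binomial_nth neg
      using nz by (simp add: power_add mult_ac)
  qed
  have comp: "F oo exp_shift = fps_const (log_coeffs $ q) * fps_exp (- of_nat q)"
  proof -
    have "fps_binomial (- of_nat q :: complex) oo exp_shift = inverse (fps_exp 1 ^ q)"
      unfolding fps_binomial_minus_of_nat
      by (simp add: fps_inverse_compose fps_compose_add_distrib one_plus_exp_shift flip: fps_compose_power)
    then show ?thesis
      unfolding F_def by (simp add: fps_compose_mult_distrib fps_exp_power_mult fps_exp_neg)
  qed
  show ?thesis
  proof (cases "q \<le> K")
    case True
    have "(\<Sum>j\<le>K. log_coeffs $ j * (of_nat (Suc j) gchoose Suc q) * square_coeff w (p - int j + int q) n)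
      = (\<Sum>j\<in>{q..K}. log_coeffs $ j * (of_nat (Suc j) gchoose Suc q) * square_coeff w (p - int j + int q) n)"
      by (rule sum.mono_neutral_right) (auto simp: binomial_gbinomial[symmetric] simp del: of_nat_Suc binomial_Suc_Suc)
    also have "\<dots> = (\<Sum>i\<le>K - q. F $ i * square_coeff w (p - int i) n)"
      using True by (intro sum.reindex_bij_witness[of _ "\<lambda>i. i + q" "\<lambda>j. j - q"]) (auto simp: algebra_simps simp flip: Fi simp del: of_nat_Suc of_nat_add)
    also have "\<dots> = fls_nth (square_series w p * fps_to_fls (F oo exp_shift)) (- n - 1)"
      using True assms by (intro square_coeff_compose) auto
    also have "square_series w p * fps_to_fls (F oo exp_shift) = fls_const (log_coeffs $ q) * square_series (w - q) p"
    proof -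
      have "fps_to_fls (F oo exp_shift) = fls_const (log_coeffs $ q) * fps_to_fls (fps_exp (- of_nat q))"
        unfolding comp by (simp add: fls_times_fps_to_fls)
      moreover have "fps_to_fls (fps_exp (of_nat (w - q) :: complex)) = fps_to_fls (fps_exp (of_nat w)) * fps_to_fls (fps_exp (- of_nat q))"
        using q by (simp add: fls_exp_mult of_nat_diff)
      ultimately show ?thesis by (simp only: mult_ac)
    qed
    finally show ?thesis by (simp add: square_coeff_eq)
  next
    \<comment> \<open>Now \<open>K < q\<close> forces \<open>p < n\<close>: the left side vanishes
      through its binomial coefficients, the right side by triangularity.\<close>
    case False
    then show ?thesis
      using qK by (auto intro!: sum.neutral simp: square_coeff_eq_0 binomial_gbinomial[symmetric] simp del: of_nat_Suc binomial_Suc_Suc)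
  qed
qed

section \<open>Eisenstein series\<close>

lemma has_sum_diff:
  fixes f g :: "'a \<Rightarrow> 'b::real_normed_vector"
  assumes "(f has_sum a) A" "(g has_sum b) A"
  shows "((\<lambda>x. f x - g x) has_sum (a - b)) A"
  using has_sum_add[OF assms(1), of "\<lambda>x. - g x" "- b"] assms(2) by (simp add: has_sum_uminus)

lemma summable_on_diff:
  fixes f g :: "'a \<Rightarrow> 'b::real_normed_vector"
  assumes "f summable_on A" "g summable_on A"
  shows "(\<lambda>x. f x - g x) summable_on A"
  using assms has_sum_diff unfolding summable_on_def by blast

lemma infsum_diff:
  fixes f g :: "'a \<Rightarrow> 'b::real_normed_vector"
  assumes "f summable_on A" "g summable_on A"
  shows "(\<Sum>\<^sub>\<infinity>x\<in>A. f x - g x) = infsum f A - infsum g A"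
  using assms by (intro infsumI has_sum_diff has_sum_infsum)

lemma has_sum_sum:
  fixes f :: "'i \<Rightarrow> 'a \<Rightarrow> 'b::real_normed_vector"
  assumes "\<And>i. i \<in> I \<Longrightarrow> (f i has_sum s i) A"
  shows "((\<lambda>x. \<Sum>i\<in>I. f i x) has_sum (\<Sum>i\<in>I. s i)) A"
  using assms by (induction I rule: infinite_finite_induct) (auto intro!: has_sum_add)

lemma sums_of_has_sum_nonzero_int:
  fixes h :: "int \<Rightarrow> 'a::banach"
  assumes "(h has_sum s) (UNIV - {0})"
  shows "(\<lambda>k. h (int k + 1) + h (- int k - 1)) sums s"
proof -
  have sm: "h summable_on (UNIV - {0})" using assms by (rule has_sum_imp_summable)
  have p: "(h has_sum infsum h {1..}) {1..}" and n: "(h has_sum infsum h {..-1}) {..-1}"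
    by (rule has_sum_infsum, rule summable_on_subset_banach[OF sm], force)+
  have "(h has_sum (infsum h {1..} + infsum h {..-1})) ({1..} \<union> {..-1})"
    by (rule has_sum_Un_disjoint[OF p n]) auto
  moreover have "{1..} \<union> {..-1} = UNIV - {0::int}" by auto
  ultimately have s: "s = infsum h {1..} + infsum h {..-1}"
    using assms by (simp add: has_sum_unique)
  have "((\<lambda>k::nat. h (int k + 1)) has_sum infsum h {1..}) UNIV \<longleftrightarrow> (h has_sum infsum h {1..}) {1..}"
    by (rule has_sum_reindex_bij_witness[of _ "\<lambda>i. nat (i - 1)" "\<lambda>k. int k + 1"]) auto
  moreover have "((\<lambda>k::nat. h (- int k - 1)) has_sum infsum h {..-1}) UNIV \<longleftrightarrow> (h has_sum infsum h {..-1}) {..-1}"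
    by (rule has_sum_reindex_bij_witness[of _ "\<lambda>i. nat (- i - 1)" "\<lambda>k. - int k - 1"]) auto
  ultimately show ?thesis unfolding s using p n by (intro sums_add has_sum_imp_sums) simp_all
qed

lemma has_sum_nonzero_int_of_even:
  fixes h :: "int \<Rightarrow> 'a::banach"
  assumes "(h has_sum s) (UNIV - {0})" and "\<And>i. h (- i) = h i"
  shows "(\<lambda>k. 2 *\<^sub>R h (int k + 1)) sums s"
proof -
  have "h (- int k - 1) = h (int k + 1)" for k
    using assms(2)[of "int k + 1"] by simp
  then show ?thesis
    using sums_of_has_sum_nonzero_int[OF assms(1)] by (simp add: scaleR_2)
qed

text \<open>The half-open interval is chosen so that a telescoping sum over it leaves the values at
  the opposite points \<open>- N\<close> and \<open>N\<close>.\<close>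

lemma has_sum_int_symmetric_limit:
  fixes f :: "int \<Rightarrow> 'a::{comm_monoid_add,topological_space}"
  assumes "(f has_sum s) UNIV"
  shows "(\<lambda>N. \<Sum>n\<in>{- int N..<int N}. f n) \<longlonglongrightarrow> s"
proof -
  have "filterlim (\<lambda>N. {- int N..<int N}) (finite_subsets_at_top UNIV) sequentially"
    unfolding filterlim_finite_subsets_at_top
  proof (intro allI impI)
    fix X :: "int set" assume "finite X \<and> X \<subseteq> UNIV"
    then obtain B where B: "\<And>x. x \<in> X \<Longrightarrow> \<bar>x\<bar> \<le> B"
      by (meson finite_imageI finite_int_iff_bounded_le abs_le_iff atMost_iff imageI subsetD)
    show "\<forall>\<^sub>F N in sequentially. finite {- int N..<int N} \<and> X \<subseteq> {- int N..<int N} \<and> {- int N..<int N} \<subseteq> UNIV"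
      using eventually_gt_at_top[of "nat B"]
    proof eventually_elim
      case (elim N)
      then show ?case using B by force
    qed
  qed
  with assms show ?thesis unfolding has_sum_def by (rule filterlim_compose)
qed

lemma sum_int_telescope:
  fixes g :: "int \<Rightarrow> 'a::ab_group_add"
  shows "(\<Sum>n\<in>{- int N..<int N}. g n - g (n + 1)) = g (- int N) - g (int N)"
proof (induction N)
  case (Suc N)
  have "{- int (Suc N)..<int (Suc N)} = insert (- 1 - int N) (insert (int N) {- int N..<int N})"
    by auto
  then show ?case using Suc by (simp add: add.commute)
qed simp

text \<open>A summable weight on \<open>\<int>\<close> such that the cubic decay of lattice sums is dominated by a product.\<close>

definition lattice_weight :: "int \<Rightarrow> real" where
  "lattice_weight n = (max 1 (real_of_int \<bar>n\<bar>)) powr (- 3 / 2)"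

lemma lattice_weight_nonneg: "0 \<le> lattice_weight n"
  by (simp add: lattice_weight_def)

lemma summable_on_lattice_weight: "lattice_weight summable_on UNIV"
proof -
  have s: "summable (\<lambda>n. real (Suc n) powr (- 3 / 2))"
    by (subst summable_Suc_iff) (simp add: summable_real_powr_iff)
  have "(\<lambda>n::nat. lattice_weight (int n + 1)) summable_on UNIV"
    by (subst summable_on_UNIV_nonneg_real_iff) (use s in \<open>auto simp: lattice_weight_def add_ac max_def\<close>)
  also have "?this \<longleftrightarrow> lattice_weight summable_on {1..}"
    by (rule summable_on_reindex_bij_witness[of _ "\<lambda>i. nat (i - 1)" "\<lambda>k. int k + 1"]) auto
  finally have p: "lattice_weight summable_on {1..}" .
  also have "?this \<longleftrightarrow> lattice_weight summable_on {..-1}"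
    by (rule summable_on_reindex_bij_witness[of _ uminus uminus]) (auto simp: lattice_weight_def)
  finally have n: "lattice_weight summable_on {..-1}" .
  have "lattice_weight summable_on ({1..} \<union> {..-1} \<union> {0})"
    using p n by (intro summable_on_union) auto
  also have "{1..} \<union> {..-1} \<union> {0} = (UNIV :: int set)" by auto
  finally show ?thesis .
qed

lemma summable_on_lattice_weight_product:
  "(\<lambda>(m, n). lattice_weight m * lattice_weight n) summable_on UNIV"
proof -
  have "(\<lambda>(m, n). lattice_weight m * lattice_weight n) summable_on (UNIV \<times> UNIV)"
  proof (rule summable_on_SigmaI[where g = "\<lambda>m. lattice_weight m * infsum lattice_weight UNIV"])
    show "((\<lambda>n. case (m, n) of (m, n) \<Rightarrow> lattice_weight m * lattice_weight n) has_sum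
      lattice_weight m * infsum lattice_weight UNIV) UNIV" for m
      by (simp add: has_sum_cmult_right summable_on_lattice_weight)
  qed (auto intro: summable_on_cmult_left summable_on_lattice_weight mult_nonneg_nonneg lattice_weight_nonneg)
  then show ?thesis by simp
qed

text \<open>The exponent 3 is split evenly as 3/2 + 3/2. Each half exceeds 1, so the product of the
  two weights is summable over the lattice.\<close>

lemma inverse_cube_le_lattice_weight:
  assumes "(m, n) \<noteq> (0, 0)" and "3 \<le> w"
  shows "1 / real_of_int (\<bar>m\<bar> + \<bar>n\<bar>) ^ w \<le> lattice_weight m * lattice_weight n"
proof -
  let ?s = "real_of_int (\<bar>m\<bar> + \<bar>n\<bar>)"
  have "\<bar>m\<bar> + \<bar>n\<bar> \<ge> 1" using assms(1) by auto
  then have s: "?s \<ge> 1" by linarith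
  have "1 / ?s ^ w \<le> 1 / ?s ^ 3"
    using s assms(2) by (intro divide_left_mono power_increasing) auto
  also have "\<dots> = ?s powr (- 3 / 2) * ?s powr (- 3 / 2)"
  proof -
    have "?s powr (- 3 / 2) * ?s powr (- 3 / 2) = ?s powr (- 3)"
      unfolding powr_add[symmetric] by simp
    also have "\<dots> = 1 / ?s ^ 3" using s unfolding powr_minus_divide by simp
    finally show ?thesis by simp
  qed
  also have "\<dots> \<le> lattice_weight m * lattice_weight n"
    unfolding lattice_weight_def using s by (intro mult_mono powr_mono2') auto
  finally show ?thesis .
qed

text \<open>Quadratic decay pays for one of the two weights only: enough to sum a single row or a
  single column, but not the whole lattice.\<close>

lemma inverse_square_le_lattice_weight:
  assumes "m \<noteq> 0"
  shows "1 / real_of_int (\<bar>m\<bar> + \<bar>n\<bar>) ^ 2 \<le> lattice_weight m"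
    and "1 / real_of_int (\<bar>m\<bar> + \<bar>n\<bar>) ^ 2 \<le> lattice_weight n"
proof -
  let ?s = "real_of_int (\<bar>m\<bar> + \<bar>n\<bar>)"
  have "\<bar>m\<bar> + \<bar>n\<bar> \<ge> 1" using assms(1) by auto
  then have s: "?s \<ge> 1" by linarith
  have "1 / ?s ^ 2 = ?s powr (- 2)"
    using s unfolding powr_minus_divide by simp
  also have "\<dots> \<le> ?s powr (- 3 / 2)"
    using s by (intro powr_mono) auto
  finally have *: "1 / ?s ^ 2 \<le> ?s powr (- 3 / 2)" .
  have "?s powr (- 3 / 2) \<le> lattice_weight m" "?s powr (- 3 / 2) \<le> lattice_weight n"
    unfolding lattice_weight_def using s by (auto intro!: powr_mono2')
  with * show "1 / ?s ^ 2 \<le> lattice_weight m" "1 / ?s ^ 2 \<le> lattice_weight n" by auto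
qed

text \<open>The imaginary part bounds \<open>m\<close>, and then the real part bounds
  \<open>n\<close>. The constant depends only on \<open>y\<close> and \<open>R\<close>, so the same
  estimate gives uniform convergence on discs and boundedness near the cusp.\<close>

lemma lattice_norm_lower:
  assumes "y > 0" "y \<le> Im \<tau>" "\<bar>Re \<tau>\<bar> \<le> R"
  shows "real_of_int (\<bar>m\<bar> + \<bar>n\<bar>) \<le> (1 + y + R) / y * norm (of_int m * \<tau> + of_int n)"
proof -
  let ?z = "of_int m * \<tau> + of_int n"
  have "\<bar>real_of_int m\<bar> * y \<le> \<bar>real_of_int m\<bar> * Im \<tau>"
    using assms by (intro mult_left_mono) auto
  also have "\<dots> = \<bar>Im ?z\<bar>" using assms by (simp add: abs_mult)
  also have "\<dots> \<le> norm ?z" by (rule abs_Im_le_cmod)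
  finally have 1: "\<bar>real_of_int m\<bar> \<le> norm ?z / y" using assms by (simp add: field_simps)
  have "\<bar>real_of_int n\<bar> \<le> \<bar>Re ?z\<bar> + \<bar>real_of_int m * Re \<tau>\<bar>" by simp
  also have "\<dots> \<le> norm ?z + \<bar>real_of_int m\<bar> * R"
    using assms abs_Re_le_cmod[of ?z] by (intro add_mono) (auto simp: abs_mult intro!: mult_left_mono)
  also have "\<dots> \<le> norm ?z + norm ?z / y * R"
    using 1 assms by (intro add_left_mono mult_right_mono) auto
  finally have "\<bar>real_of_int m\<bar> + \<bar>real_of_int n\<bar> \<le> norm ?z / y + (norm ?z + norm ?z / y * R)"
    using 1 by linarith
  also have "\<dots> = (1 + y + R) / y * norm ?z" using assms by (simp add: field_simps)
  finally show ?thesis by simp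
qed

lemma lattice_point_nonzero:
  assumes "Im \<tau> > 0" "(m, n) \<noteq> (0, 0)"
  shows "of_int m * \<tau> + of_int n \<noteq> 0"
proof
  assume z: "of_int m * \<tau> + of_int n = 0"
  have "real_of_int (\<bar>m\<bar> + \<bar>n\<bar>) \<le> 0"
    using lattice_norm_lower[of "Im \<tau>" \<tau> "\<bar>Re \<tau>\<bar>" m n] assms z by simp
  then have "\<bar>m\<bar> + \<bar>n\<bar> \<le> 0" by linarith
  then show False using assms by auto
qed

lemma inverse_lattice_power_le:
  assumes "y > 0" "y \<le> Im \<tau>" "\<bar>Re \<tau>\<bar> \<le> R" "(m, n) \<noteq> (0, 0)"
  shows "norm (1 / (of_int m * \<tau> + of_int n) ^ w) \<le> ((1 + y + R) / y) ^ w * (1 / real_of_int (\<bar>m\<bar> + \<bar>n\<bar>) ^ w)"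
proof -
  let ?z = "of_int m * \<tau> + of_int n" and ?s = "real_of_int (\<bar>m\<bar> + \<bar>n\<bar>)" and ?C = "(1 + y + R) / y"
  have z: "?z \<noteq> 0" using lattice_point_nonzero[of \<tau> m n] assms by auto
  have "\<bar>m\<bar> + \<bar>n\<bar> \<ge> 1" using assms(4) by auto
  then have s: "?s \<ge> 1" by linarith
  have "?s ^ w \<le> (?C * norm ?z) ^ w"
    using s by (intro power_mono lattice_norm_lower assms) auto
  then have "?s ^ w \<le> ?C ^ w * norm ?z ^ w" by (simp only: power_mult_distrib)
  moreover have "1 / Z \<le> K * (1 / S)" if "S \<le> K * Z" "S > 0" "Z > 0" for S K Z :: real
    using that by (simp add: field_simps)
  ultimately have "1 / norm ?z ^ w \<le> ?C ^ w * (1 / ?s ^ w)"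
    using z s by simp
  then show ?thesis by (simp only: norm_divide norm_power norm_one)
qed

lemma lattice_power_bound:
  assumes "y > 0" "y \<le> Im \<tau>" "\<bar>Re \<tau>\<bar> \<le> R" "x \<in> UNIV - {(0, 0)}" "3 \<le> w"
  shows "norm (case x of (m, n) \<Rightarrow> 1 / (of_int m * \<tau> + of_int n) ^ w)
    \<le> ((1 + y + R) / y) ^ w * (case x of (m, n) \<Rightarrow> lattice_weight m * lattice_weight n)"
proof -
  obtain m n where x: "x = (m, n)" by (cases x)
  have "((1 + y + R) / y) ^ w * (1 / real_of_int (\<bar>m\<bar> + \<bar>n\<bar>) ^ w) \<le> ((1 + y + R) / y) ^ w * (lattice_weight m * lattice_weight n)"
    using assms x inverse_cube_le_lattice_weight[of m n w] by (intro mult_left_mono) auto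
  with inverse_lattice_power_le[of y \<tau> R m n w] assms x show ?thesis by auto
qed

lemma summable_on_lattice_bound:
  "(\<lambda>x. (C::real) * (case x of (m, n) \<Rightarrow> lattice_weight m * lattice_weight n)) summable_on A"
  by (rule summable_on_cmult_right) (rule summable_on_subset_banach[OF summable_on_lattice_weight_product], simp)

section \<open>Eisenstein series of weight at least 3 as modular forms\<close>

lemma eisenstein_G_ge_3:
  "3 \<le> w \<Longrightarrow> eisenstein_G w \<tau> = (\<Sum>\<^sub>\<infinity>x\<in>UNIV - {(0, 0)}. case x of (m, n) \<Rightarrow> 1 / (of_int m * \<tau> + of_int n) ^ w)"
  by (simp add: eisenstein_G_def)

text \<open>A closed disc in the half-plane has positive minimal height and bounded real part, so
  one summable majorant serves the Weierstrass test on all of it.\<close>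

lemma eisenstein_G_holomorphic:
  assumes "3 \<le> w"
  shows "eisenstein_G w holomorphic_on uhp"
proof -
  let ?f = "\<lambda>x \<tau>. case x of (m, n) \<Rightarrow> 1 / (of_int m * \<tau> + of_int n :: complex) ^ w"
  have op: "open uhp" unfolding uhp_def by (rule open_halfspace_Im_gt)
  show ?thesis
    unfolding holomorphic_on_open[OF op] 
  proof
    fix z assume "z \<in> uhp"
    then obtain r where r: "r > 0" "cball z r \<subseteq> uhp" using op open_contains_cball by blast
    obtain y where y: "y > 0" "\<And>\<tau>. \<tau> \<in> cball z r \<Longrightarrow> y \<le> Im \<tau>"
    proof -
      have "\<exists>w\<in>cball z r. \<forall>\<tau>\<in>cball z r. Im w \<le> Im \<tau>"
        using r by (intro continuous_attains_inf) (auto intro!: continuous_intros)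
      then obtain w where "w \<in> cball z r" "\<forall>\<tau>\<in>cball z r. Im w \<le> Im \<tau>" by blast
      with r show ?thesis by (intro that[of "Im w"]) (auto simp: uhp_def)
    qed
    define R where "R = norm z + r"
    have R: "\<bar>Re \<tau>\<bar> \<le> R" if "\<tau> \<in> cball z r" for \<tau>
    proof -
      have "\<bar>Re \<tau>\<bar> \<le> norm (z + (\<tau> - z))" using abs_Re_le_cmod[of \<tau>] by simp
      also have "\<dots> \<le> norm z + norm (\<tau> - z)" by (rule norm_triangle_ineq)
      also have "\<dots> \<le> R" using that by (simp add: R_def dist_norm norm_minus_commute)
      finally show ?thesis .
    qed
    have ul: "uniform_limit (cball z r) (\<lambda>X \<tau>. \<Sum>x\<in>X. ?f x \<tau>) (\<lambda>\<tau>. \<Sum>\<^sub>\<infinity>x\<in>UNIV - {(0,0)}. ?f x \<tau>)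
        (finite_subsets_at_top (UNIV - {(0,0)}))"
      by (rule Weierstrass_m_test_general[OF _ summable_on_lattice_bound])
        (rule lattice_power_bound[OF y(1) y(2) R _ assms])
    have nz: "of_int m * \<tau> + of_int n \<noteq> 0" if "\<tau> \<in> cball z r" "(m, n) \<noteq> (0, 0)" for m n \<tau>
      using lattice_point_nonzero[of \<tau> m n] that r by (auto simp: uhp_def)
    have "\<forall>\<^sub>F X in finite_subsets_at_top (UNIV - {(0,0)}). continuous_on (cball z r) (\<lambda>\<tau>. \<Sum>x\<in>X. ?f x \<tau>)
       \<and> (\<lambda>\<tau>. \<Sum>x\<in>X. ?f x \<tau>) holomorphic_on ball z r"
    proof (rule eventually_finite_subsets_at_top_weakI)
      fix X :: "(int \<times> int) set" assume X: "finite X" "X \<subseteq> UNIV - {(0,0)}"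
      have "(\<lambda>\<tau>. \<Sum>x\<in>X. ?f x \<tau>) holomorphic_on cball z r"
      proof (rule holomorphic_on_sum)
        fix x assume "x \<in> X"
        moreover obtain m n where x: "x = (m, n)" by (cases x)
        ultimately have "(m, n) \<noteq> (0, 0)" using X by auto
        then show "?f x holomorphic_on cball z r"
          using nz[of _ m n] by (auto simp: x intro!: holomorphic_intros)
      qed
      then show "continuous_on (cball z r) (\<lambda>\<tau>. \<Sum>x\<in>X. ?f x \<tau>) \<and> (\<lambda>\<tau>. \<Sum>x\<in>X. ?f x \<tau>) holomorphic_on ball z r"
        using holomorphic_on_imp_continuous_on holomorphic_on_subset ball_subset_cball by blast
    qed
    from holomorphic_uniform_limit[OF this ul] have "eisenstein_G w holomorphic_on ball z r"
      unfolding eisenstein_G_ge_3[OF assms, abs_def] by (simp add: finite_subsets_at_top_neq_bot)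
    then show "\<exists>f'. (eisenstein_G w has_field_derivative f') (at z)"
      using r by (auto simp: holomorphic_on_open)
  qed
qed

lemma uhp_moebius_denominator:
  fixes a b c d :: int
  assumes "\<tau> \<in> uhp" "a * d - b * c = 1"
  shows "of_int c * \<tau> + of_int d \<noteq> 0"
proof -
  have "(c, d) \<noteq> (0, 0)" using assms(2) by auto
  then show ?thesis using lattice_point_nonzero[of \<tau> c d] assms(1) by (simp add: uhp_def)
qed

lemma uhp_moebius:
  fixes a b c d :: int
  assumes "\<tau> \<in> uhp" "a * d - b * c = 1"
  shows "(of_int a * \<tau> + of_int b) / (of_int c * \<tau> + of_int d) \<in> uhp"
proof -
  let ?D = "of_int c * \<tau> + of_int d"
  have D: "?D \<noteq> 0" by (rule uhp_moebius_denominator[OF assms])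
  have "Im ((of_int a * \<tau> + of_int b) * cnj ?D) = real_of_int (a * d - b * c) * Im \<tau>"
    by (simp add: algebra_simps)
  then have "Im ((of_int a * \<tau> + of_int b) / ?D) = Im \<tau> / (norm ?D)\<^sup>2"
    using assms by (simp add: Im_complex_div_eq_0 complex_div_cnj[of _ ?D] cmod_power2[symmetric])
  then show ?thesis using assms D by (simp add: uhp_def)
qed

text \<open>The integral matrix of determinant 1 permutes the nonzero pairs \<open>(m, n)\<close>,
  and each term acquires the same power of the denominator.\<close>

lemma eisenstein_G_transformation:
  fixes a b c d :: int
  assumes "3 \<le> w" "\<tau> \<in> uhp" "a * d - b * c = 1"
  shows "eisenstein_G w ((of_int a * \<tau> + of_int b) / (of_int c * \<tau> + of_int d)) = (of_int c * \<tau> + of_int d) ^ w * eisenstein_G w \<tau>"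
proof -
  let ?D = "of_int c * \<tau> + of_int d" and ?g = "(of_int a * \<tau> + of_int b) / (of_int c * \<tau> + of_int d)"
  have D: "?D \<noteq> 0" by (rule uhp_moebius_denominator[OF assms(2,3)])
  have inv: "d * (m * a + n * c) - c * (m * b + n * d) = m" "a * (m * b + n * d) - b * (m * a + n * c) = n"
    "(d * m - c * n) * a + (a * n - b * m) * c = m" "(d * m - c * n) * b + (a * n - b * m) * d = n" for m n
    using assms(3) by algebra+
  have "eisenstein_G w ?g = (\<Sum>\<^sub>\<infinity>x\<in>UNIV - {(0, 0)}. ?D ^ w * (case x of (m, n) \<Rightarrow> 1 / (of_int m * \<tau> + of_int n) ^ w))"
    unfolding eisenstein_G_ge_3[OF assms(1)]
  proof (rule infsum_reindex_bij_witness[where j = "\<lambda>(m, n). (m * a + n * c, m * b + n * d)"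
      and i = "\<lambda>(m, n). (d * m - c * n, a * n - b * m)"], goal_cases)
    case (1 x) then show ?case by (cases x) (simp add: inv)
  next
    case (2 x) 
    obtain m n where x: "x = (m, n)" by (cases x)
    show ?case using 2 inv(1,2)[of m n] by (auto simp: x)
  next
    case (3 x) then show ?case by (cases x) (simp add: inv)
  next
    case (4 x)
    obtain m n where x: "x = (m, n)" by (cases x)
    show ?case using 4 inv(3,4)[of m n] by (auto simp: x)
  next
    case (5 x)
    obtain m n where x: "x = (m, n)" by (cases x)
    have "of_int m * ?g + of_int n = (of_int (m * a + n * c) * \<tau> + of_int (m * b + n * d)) / ?D"
      using D by (simp add: field_simps)
    then show ?case using D by (simp add: x power_divide)
  qed
  then show ?thesis unfolding eisenstein_G_ge_3[OF assms(1)] by (simp add: infsum_cmult_right')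
qed

lemma eisenstein_G_add_int:
  assumes "3 \<le> w" "\<tau> \<in> uhp"
  shows "eisenstein_G w (\<tau> + of_int b) = eisenstein_G w \<tau>"
  using eisenstein_G_transformation[OF assms, of 1 1 b 0] by simp

text \<open>An integral translation moves the real part into the unit interval, where a single
  majorant works for all heights above 1.\<close>

lemma eisenstein_G_bounded:
  assumes "3 \<le> w"
  shows "\<exists>B. \<forall>\<tau>. 1 < Im \<tau> \<longrightarrow> norm (eisenstein_G w \<tau>) \<le> B"
proof -
  let ?M = "\<lambda>x. ((1 + 1 + 1) / 1 :: real) ^ w * (case x of (m, n) \<Rightarrow> lattice_weight m * lattice_weight n)"
  let ?B = "infsum ?M (UNIV - {(0, 0)})"
  have B: "norm (eisenstein_G w \<tau>) \<le> ?B" if "1 < Im \<tau>" "\<bar>Re \<tau>\<bar> \<le> 1" for \<tau>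
  proof -
    let ?f = "\<lambda>x. case x of (m, n) \<Rightarrow> 1 / (of_int m * \<tau> + of_int n) ^ w"
    have le: "norm (?f x) \<le> ?M x" if "x \<in> UNIV - {(0, 0)}" for x
      using \<open>1 < Im \<tau>\<close> \<open>\<bar>Re \<tau>\<bar> \<le> 1\<close> that assms by (intro lattice_power_bound) auto
    have "(\<lambda>x. norm (?f x)) summable_on (UNIV - {(0, 0)})"
      by (rule Infinite_Sum.abs_summable_on_comparison_test'[OF summable_on_lattice_bound le])
    then have "?f summable_on (UNIV - {(0, 0)})" by (rule abs_summable_summable)
    then show ?thesis unfolding eisenstein_G_ge_3[OF assms]
      by (intro norm_infsum_le[OF has_sum_infsum has_sum_infsum le] summable_on_lattice_bound)
  qed
  show ?thesis
  proof (intro exI[of _ ?B] allI impI)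
    fix \<tau> assume \<tau>: "1 < Im \<tau>"
    let ?s = "\<tau> + of_int (- \<lfloor>Re \<tau>\<rfloor>)"
    have "norm (eisenstein_G w ?s) \<le> ?B"
      by (rule B) (use \<tau> in \<open>simp_all, linarith\<close>)
    then show "norm (eisenstein_G w \<tau>) \<le> ?B"
      using eisenstein_G_add_int[OF assms, of \<tau> "- \<lfloor>Re \<tau>\<rfloor>"] \<tau> by (simp add: uhp_def)
  qed
qed

lemma eisenstein_E_modular_form:
  assumes "3 \<le> w"
  shows "eisenstein_E w \<in> modular_forms (int w)"
proof -
  obtain B where B: "\<And>\<tau>. 1 < Im \<tau> \<Longrightarrow> norm (eisenstein_G w \<tau>) \<le> B"
    using eisenstein_G_bounded[OF assms] by blast
  have "(\<lambda>\<tau>. eisenstein_G w \<tau> / (2 * of_real pi * \<i>) ^ w) holomorphic_on uhp"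
    by (intro holomorphic_intros eisenstein_G_holomorphic assms) auto
  then have "eisenstein_E w holomorphic_on uhp"
    by (rule holomorphic_transform) (simp add: eisenstein_E_def)
  moreover have "norm (eisenstein_E w \<tau>) \<le> B / (2 * pi) ^ w" if "1 < Im \<tau>" for \<tau>
    using B[OF that] that by (auto simp: eisenstein_E_def uhp_def norm_divide norm_power norm_mult intro!: divide_right_mono)
  moreover have "eisenstein_E w ((of_int a * \<tau> + of_int b) / (of_int c * \<tau> + of_int d)) =
        (of_int c * \<tau> + of_int d) powi int w * eisenstein_E w \<tau>"
    if "a * d - b * c = 1" "\<tau> \<in> uhp" for a b c d :: int and \<tau>
    using that uhp_moebius[OF that(2,1)] by (simp add: eisenstein_E_def eisenstein_G_transformation[OF assms])
  moreover have "eisenstein_E w \<tau> = 0" if "\<tau> \<notin> uhp" for \<tau>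
    using that by (simp add: eisenstein_E_def)
  ultimately show ?thesis
    unfolding modular_forms_def by blast
qed

lemma uhp_inversion: "\<tau> \<in> uhp \<Longrightarrow> - 1 / \<tau> \<in> uhp"
  using uhp_moebius[of \<tau> 0 0 "-1" 1] by simp

lemma uhp_nonzero: "\<tau> \<in> uhp \<Longrightarrow> \<tau> \<noteq> 0"
  by (auto simp: uhp_def)

lemma eisenstein_E_inversion:
  assumes "3 \<le> w" "\<tau> \<in> uhp"
  shows "eisenstein_E w (- 1 / \<tau>) = \<tau> ^ w * eisenstein_E w \<tau>"
  using eisenstein_G_transformation[OF assms, of 0 0 "-1" 1] uhp_inversion[OF assms(2)] assms(2)
  by (simp add: eisenstein_E_def)

section \<open>The cotangent: partial fractions and limit in the lower half-plane\<close>

lemma cot_digamma_reflection: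
  fixes z :: complex
  assumes "z \<notin> \<int>"
  shows "Digamma (1 - z) - Digamma z = of_real pi * cot (of_real pi * z)"
proof -
  have z1: "z \<notin> \<int>\<^sub>\<le>\<^sub>0" "1 - z \<notin> \<int>\<^sub>\<le>\<^sub>0"
    using assms by (auto dest: nonpos_Ints_Int)
  have sin0: "sin (of_real pi * w) \<noteq> 0" if "w \<notin> \<int>" for w :: complex
  proof
    assume "sin (of_real pi * w) = 0"
    then obtain n :: int where "of_real pi * w = of_real (of_int n * pi)"
      by (auto simp: sin_eq_0)
    then have "w = of_int n" by (simp add: field_simps)
    then show False using that by simp
  qed
  have refl: "Gamma w * Gamma (1 - w) * sin (of_real pi * w) = of_real pi" if "w \<in> - \<int>" for w :: complex
    using Gamma_reflection_complex[of w] sin0[of w] that by (simp add: field_simps)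
  have op: "open (- \<int> :: complex set)" using closed_Ints by (simp add: open_Compl)
  \<comment> \<open>By the reflection formula \<open>?F\<close> is constant off the integers. The
    claim is its vanishing derivative, divided by the nonzero Gamma factors and the sine.\<close>
  let ?F = "\<lambda>w. Gamma w * Gamma (1 - w) * sin (of_real pi * w)"
  have G: "((\<lambda>w. Gamma (1 - w)) has_field_derivative - (Gamma (1 - z) * Digamma (1 - z))) (at z)"
  proof -
    have "((\<lambda>w. 1 - w) has_field_derivative - 1) (at z)"
      by (auto intro!: derivative_eq_intros)
    from DERIV_chain2[where f = Gamma and g = "\<lambda>w. 1 - w" and x = z and Db = "-1",
        OF has_field_derivative_Gamma[OF z1(2)] this]
    show ?thesis by simp
  qed
  have "(?F has_field_derivative (Gamma z * Digamma z * Gamma (1 - z) - Gamma z * (Gamma (1 - z) * Digamma (1 - z))) * sin (of_real pi * z)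
      + Gamma z * Gamma (1 - z) * (cos (of_real pi * z) * of_real pi)) (at z)"
  proof -
    have S: "((\<lambda>w. sin (of_real pi * w)) has_field_derivative cos (of_real pi * z) * of_real pi) (at z)"
      by (auto intro!: derivative_eq_intros)
    show ?thesis
      by (rule DERIV_cong[OF DERIV_mult[OF DERIV_mult[OF has_field_derivative_Gamma[OF z1(1)] G] S]])
        (simp add: algebra_simps)
  qed
  moreover have "(?F has_field_derivative 0) (at z)"
    by (rule has_field_derivative_transform_within_open[OF _ op, of "\<lambda>_. of_real pi"]) (use assms refl in auto)
  ultimately have "(Gamma z * Digamma z * Gamma (1 - z) - Gamma z * (Gamma (1 - z) * Digamma (1 - z))) * sin (of_real pi * z)
      + Gamma z * Gamma (1 - z) * (cos (of_real pi * z) * of_real pi) = 0"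
    by (rule DERIV_unique)
  then have "Gamma z * Gamma (1 - z) * ((Digamma z - Digamma (1 - z)) * sin (of_real pi * z) + cos (of_real pi * z) * of_real pi) = 0"
    by (simp add: algebra_simps)
  moreover have "Gamma z \<noteq> 0" "Gamma (1 - z) \<noteq> 0" using z1 by (simp_all add: Gamma_eq_zero_iff)
  ultimately have "(Digamma z - Digamma (1 - z)) * sin (of_real pi * z) + cos (of_real pi * z) * of_real pi = 0"
    by simp
  then have "(Digamma (1 - z) - Digamma z) * sin (of_real pi * z) = of_real pi * cos (of_real pi * z)"
    by algebra
  then show ?thesis using sin0[OF assms] by (simp add: cot_def nonzero_eq_divide_eq)
qed

text \<open>Subtracting the Digamma series at \<open>1 - x\<close> from the one at
  \<open>1 + x\<close> cancels the harmonic terms and Euler's constant; the term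
  \<open>1 / x\<close> comes from shifting \<open>1 + x\<close> back to \<open>x\<close>.\<close>

lemma cot_partial_fractions:
  fixes x :: complex
  assumes "x \<notin> \<int>"
  shows "(\<lambda>k. 1 / (of_nat (Suc k) - x) - 1 / (of_nat (Suc k) + x)) sums (1 / x - of_real pi * cot (of_real pi * x))"
proof -
  have x0: "x \<noteq> 0" using assms by auto
  have D: "(\<lambda>k. inverse (of_nat (Suc k)) - inverse (z + of_nat k)) sums (Digamma z + euler_mascheroni)" if "z \<noteq> 0" for z :: complex
    using summable_Digamma[OF that] unfolding Digamma_def by (simp add: summable_sums)
  have "1 - x \<noteq> 0" "1 + x \<noteq> 0" using assms by (auto simp: add_eq_0_iff)
  from sums_diff[OF D[OF this(2)] D[OF this(1)]]
  have "(\<lambda>k. 1 / (of_nat (Suc k) - x) - 1 / (of_nat (Suc k) + x)) sums (Digamma (1 + x) - Digamma (1 - x))"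
    by (simp add: divide_inverse algebra_simps)
  also have "Digamma (1 + x) - Digamma (1 - x) = 1 / x - of_real pi * cot (of_real pi * x)"
    using Digamma_plus1[OF x0] cot_digamma_reflection[OF assms] by (simp add: algebra_simps)
  finally show ?thesis .
qed

text \<open>With \<open>q = e^(-2 pi \<i> x)\<close> the cotangent at \<open>pi N x\<close> is
  \<open>\<i> (1 + q^N) / (1 - q^N)\<close>, and \<open>norm q < 1\<close> exactly because
  \<open>x\<close> lies below the real axis.\<close>

lemma tendsto_cot_lower_half_plane:
  fixes x :: complex
  assumes "Im x < 0"
  shows "(\<lambda>N. cot (of_real pi * (of_nat N * x))) \<longlonglongrightarrow> \<i>"
proof -
  define q where "q = exp (- (2 * \<i> * of_real pi * x))"
  have "norm q < 1" using assms by (simp add: q_def mult_pos_neg)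
  then have q: "(\<lambda>N. q ^ N) \<longlonglongrightarrow> 0" by (rule LIMSEQ_power_zero)
  have "(\<lambda>N. \<i> * ((1 + q ^ N) / (1 - q ^ N))) \<longlonglongrightarrow> \<i> * ((1 + 0) / (1 - 0))"
    by (intro tendsto_intros q) auto
  moreover have "cot (of_real pi * (of_nat N * x)) = \<i> * ((1 + q ^ N) / (1 - q ^ N))" for N
  proof -
    let ?e = "exp (\<i> * (of_real pi * (of_nat N * x)))"
    have "q ^ N = exp (of_nat N * - (2 * \<i> * of_real pi * x))"
      unfolding q_def by (rule exp_of_nat_mult[symmetric])
    also have "\<dots> = inverse ?e * inverse ?e"
      by (simp add: mult_exp_exp algebra_simps flip: exp_minus)
    finally have qN: "q ^ N = inverse ?e * inverse ?e" .
    have e: "exp (- (\<i> * (of_real pi * (of_nat N * x)))) = inverse ?e" by (rule exp_minus)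
    have "1 + q ^ N = inverse ?e * (?e + inverse ?e)" "1 - q ^ N = inverse ?e * (?e - inverse ?e)"
      by (simp_all add: qN algebra_simps)
    moreover have "((e + i) / 2) / ((e - i) / (2 * \<i>)) = \<i> * ((i * (e + i)) / (i * (e - i)))" if "i \<noteq> 0" for e i :: complex
      using that by (cases "e = i") (simp_all add: field_simps)
    ultimately show ?thesis
      by (simp only: cot_def sin_exp_eq cos_exp_eq e) simp
  qed
  ultimately show ?thesis by simp
qed

section \<open>The conditionally convergent lattice sum of weight 2\<close>

context
  fixes \<tau> :: complex
  assumes \<tau>: "\<tau> \<in> uhp"
begin

abbreviation (input) lattice_pt :: "int \<Rightarrow> int \<Rightarrow> complex" where
  "lattice_pt m n \<equiv> of_int m * \<tau> + of_int n"

lemma inverse_lattice_square_le: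
  assumes "m \<noteq> 0"
  shows "norm (1 / lattice_pt m n ^ 2) \<le> ((1 + Im \<tau> + \<bar>Re \<tau>\<bar>) / Im \<tau>)\<^sup>2 * lattice_weight m" (is ?t1)
    and "norm (1 / lattice_pt m n ^ 2) \<le> ((1 + Im \<tau> + \<bar>Re \<tau>\<bar>) / Im \<tau>)\<^sup>2 * lattice_weight n" (is ?t2)
proof -
  have Im: "Im \<tau> > 0" using \<tau> by (simp add: uhp_def)
  have mn: "(m, n) \<noteq> (0, 0)" using assms by simp
  note 1 = inverse_lattice_power_le[OF Im order_refl order_refl mn, of 2]
  show ?t1 by (rule order_trans[OF 1]) (intro mult_left_mono inverse_square_le_lattice_weight assms zero_le_power2)
  show ?t2 by (rule order_trans[OF 1]) (intro mult_left_mono inverse_square_le_lattice_weight assms zero_le_power2)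
qed

lemma summable_on_lattice_row:
  assumes "m \<noteq> 0"
  shows "(\<lambda>n. 1 / lattice_pt m n ^ 2) summable_on UNIV"
  by (rule abs_summable_summable, rule Infinite_Sum.abs_summable_on_comparison_test'[OF
      summable_on_cmult_right[OF summable_on_lattice_weight] inverse_lattice_square_le(2)[OF assms]])

lemma summable_on_lattice_column:
  "(\<lambda>m. 1 / lattice_pt m n ^ 2) summable_on (UNIV - {0})"
  by (rule abs_summable_summable, rule Infinite_Sum.abs_summable_on_comparison_test'[OF
      summable_on_cmult_right[OF summable_on_subset_banach[OF summable_on_lattice_weight]] inverse_lattice_square_le(1)]) auto

text \<open>For \<open>z = m \<tau> + n\<close> this is \<open>1 / (z (z + 1))\<close>, which
  differs from \<open>1 / z^2\<close> by a term of cubic decay and has explicit partial sums in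
  \<open>n\<close>.\<close>

definition lattice_telescope :: "int \<Rightarrow> int \<Rightarrow> complex" where
  "lattice_telescope m n = 1 / lattice_pt m n - 1 / lattice_pt m (n + 1)"

lemma lattice_square_minus_telescope:
  assumes "m \<noteq> 0"
  shows "1 / lattice_pt m n ^ 2 - lattice_telescope m n = 1 / (lattice_pt m n ^ 2 * lattice_pt m (n + 1))"
proof -
  have "lattice_pt m n \<noteq> 0" "lattice_pt m (n + 1) \<noteq> 0"
    using lattice_point_nonzero[of \<tau> m n] lattice_point_nonzero[of \<tau> m "n + 1"] assms \<tau> by (auto simp: uhp_def)
  moreover have "lattice_pt m (n + 1) = lattice_pt m n + 1" by simp
  moreover have "1 / z ^ 2 - (1 / z - 1 / w) = 1 / (z ^ 2 * w)" if "z \<noteq> 0" "w \<noteq> 0" "w = z + 1" for z w :: complex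
    using that(1,2) by (simp add: field_simps power2_eq_square) (simp add: that(3) algebra_simps)
  ultimately show ?thesis unfolding lattice_telescope_def by blast
qed

lemma summable_on_lattice_difference:
  "(\<lambda>(m, n). 1 / lattice_pt m n ^ 2 - lattice_telescope m n) summable_on ((UNIV - {0}) \<times> UNIV)"
proof -
  let ?C = "(1 + Im \<tau> + \<bar>Re \<tau>\<bar>) / Im \<tau>"
  have Im: "Im \<tau> > 0" using \<tau> by (simp add: uhp_def)
  have C: "?C \<ge> 0" using Im by simp
  have bound: "norm (1 / lattice_pt m n ^ 2 - lattice_telescope m n) \<le> (2 * ?C ^ 3) * (lattice_weight m * lattice_weight n)"
    if m: "m \<noteq> 0" for m n
  proof -
    let ?s = "real_of_int (\<bar>m\<bar> + \<bar>n\<bar>)"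
    have s: "?s \<ge> 1" using m by linarith
    have nz: "(m, n) \<noteq> (0, 0)" "(m, n + 1) \<noteq> (0, 0)" using m by auto
    have 1: "norm (1 / lattice_pt m n ^ 2) \<le> ?C ^ 2 * (1 / ?s ^ 2)"
      by (rule inverse_lattice_power_le[OF Im order_refl order_refl nz(1)])
    have "norm (1 / lattice_pt m (n + 1)) \<le> ?C * (1 / real_of_int (\<bar>m\<bar> + \<bar>n + 1\<bar>))"
      using inverse_lattice_power_le[OF Im order_refl order_refl nz(2), of 1] by simp
    also have "\<dots> \<le> ?C * (2 / ?s)"
    proof -
      \<comment> \<open>One of the three factors of the cubic term sits at \<open>n + 1\<close>.
        Since \<open>m \<noteq> 0\<close>, the shift costs at most a factor 2.\<close>
      have "\<bar>m\<bar> + \<bar>n\<bar> \<le> 2 * (\<bar>m\<bar> + \<bar>n + 1\<bar>)" using m by arith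
      then have "?s \<le> real_of_int (2 * (\<bar>m\<bar> + \<bar>n + 1\<bar>))" by (rule of_int_le_iff[THEN iffD2])
      then have "?s \<le> 2 * real_of_int (\<bar>m\<bar> + \<bar>n + 1\<bar>)" by simp
      moreover have "real_of_int (\<bar>m\<bar> + \<bar>n + 1\<bar>) > 0" using m by linarith
      ultimately show ?thesis using s C by (intro mult_left_mono) (simp_all add: field_simps)
    qed
    finally have 2: "norm (1 / lattice_pt m (n + 1)) \<le> ?C * (2 / ?s)" .
    have "norm (1 / lattice_pt m n ^ 2 - lattice_telescope m n) = norm (1 / lattice_pt m n ^ 2) * norm (1 / lattice_pt m (n + 1))"
      unfolding lattice_square_minus_telescope[OF m] by (simp add: norm_mult norm_divide)
    also have "\<dots> \<le> (?C ^ 2 * (1 / ?s ^ 2)) * (?C * (2 / ?s))"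
      using 1 2 C s by (intro mult_mono) auto
    also have "\<dots> = (2 * ?C ^ 3) * (1 / ?s ^ 3)"
    proof -
      have "(C\<^sup>2 * (1 / S\<^sup>2)) * (C * (2 / S)) = (2 * C ^ 3) * (1 / S ^ 3)" for C S :: real
        by (simp add: power2_eq_square power3_eq_cube mult_ac)
      then show ?thesis .
    qed
    also have "\<dots> \<le> (2 * ?C ^ 3) * (lattice_weight m * lattice_weight n)"
      using C by (intro mult_left_mono inverse_cube_le_lattice_weight nz) auto
    finally show ?thesis .
  qed
  show ?thesis
    by (rule abs_summable_summable, rule Infinite_Sum.abs_summable_on_comparison_test'[OF summable_on_lattice_bound[of "2 * ?C ^ 3"]])
      (use bound in auto)
qed

text \<open>For a fixed \<open>m\<close> both boundary values of the telescope tend to 0. Summing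
  over \<open>m\<close> before the boundary moves to infinity gives the nonzero limit of
  \<open>tendsto_lattice_boundary\<close> instead; this discrepancy is the anomaly of
  \<open>E_2\<close>.\<close>

lemma infsum_lattice_telescope:
  assumes "m \<noteq> 0"
  shows "lattice_telescope m summable_on UNIV" and "infsum (lattice_telescope m) UNIV = 0"
proof -
  have "(\<lambda>n. 1 / lattice_pt m n ^ 2 - lattice_telescope m n) summable_on UNIV"
    by (rule summable_on_SigmaD1[OF summable_on_lattice_difference]) (use assms in auto)
  from summable_on_diff[OF summable_on_lattice_row[OF assms] this]
  show sm: "lattice_telescope m summable_on UNIV" by simp
  have "(\<lambda>N. \<Sum>n\<in>{- int N..<int N}. lattice_telescope m n) \<longlonglongrightarrow> infsum (lattice_telescope m) UNIV"
    by (rule has_sum_int_symmetric_limit) (rule has_sum_infsum[OF sm])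
  moreover have "(\<lambda>N. \<Sum>n\<in>{- int N..<int N}. lattice_telescope m n) = (\<lambda>N. 1 / (of_int m * \<tau> - of_nat N) - 1 / (of_int m * \<tau> + of_nat N))"
    using sum_int_telescope[of "\<lambda>n. 1 / lattice_pt m n"] by (simp add: lattice_telescope_def)
  moreover have "(\<lambda>N. 1 / (of_int m * \<tau> - of_nat N) - 1 / (of_int m * \<tau> + of_nat N)) \<longlonglongrightarrow> 0 - 0"
  proof (intro tendsto_diff tendsto_divide_0[OF tendsto_const])
    have f: "filterlim (\<lambda>N. of_nat N :: complex) at_infinity sequentially" by (rule tendsto_of_nat)
    show "filterlim (\<lambda>N. of_int m * \<tau> + of_nat N) at_infinity sequentially"
      by (rule tendsto_add_filterlim_at_infinity[OF tendsto_const f])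
    show "filterlim (\<lambda>N. of_int m * \<tau> - of_nat N) at_infinity sequentially"
      using tendsto_add_filterlim_at_infinity[OF tendsto_const, of "\<lambda>N. - of_nat N" sequentially "of_int m * \<tau>"] f
      by (simp add: filterlim_at_infinity_conv_norm_at_top)
  qed
  ultimately show "infsum (lattice_telescope m) UNIV = 0"
    using LIMSEQ_unique by fastforce
qed

lemma infsum_lattice_row:
  assumes "m \<noteq> 0"
  shows "(\<Sum>\<^sub>\<infinity>n. 1 / lattice_pt m n ^ 2) = (\<Sum>\<^sub>\<infinity>n. 1 / lattice_pt m n ^ 2 - lattice_telescope m n)"
  using infsum_diff[OF summable_on_lattice_row infsum_lattice_telescope(1)] infsum_lattice_telescope(2) assms
  by simp

lemma summable_on_lattice_rows:
  "(\<lambda>m. \<Sum>\<^sub>\<infinity>n. 1 / lattice_pt m n ^ 2) summable_on (UNIV - {0})"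
proof -
  have "(\<lambda>m. \<Sum>\<^sub>\<infinity>n. 1 / lattice_pt m n ^ 2 - lattice_telescope m n) summable_on (UNIV - {0})"
    by (rule summable_on_Sigma_banach[OF summable_on_lattice_difference])
  then show ?thesis by (rule summable_on_cong[THEN iffD1, rotated]) (simp add: infsum_lattice_row)
qed

lemma has_sum_lattice_rows:
  "((\<lambda>m. \<Sum>\<^sub>\<infinity>n. 1 / lattice_pt m n ^ 2) has_sum (eisenstein_G 2 \<tau> - of_real (pi\<^sup>2 / 3))) (UNIV - {0})"
  using has_sum_infsum[OF summable_on_lattice_rows] by (simp add: eisenstein_G_def)

text \<open>Pulling out \<open>y = 1 / \<tau>\<close> turns the sum over \<open>m\<close> into the
  partial fractions of the cotangent at \<open>N y\<close>. As \<open>y\<close> lies in the lower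
  half-plane, the cotangent tends to \<open>\<i>\<close> and leaves
  \<open>- 2 pi \<i> y\<close>.\<close>

lemma tendsto_lattice_boundary:
  "(\<lambda>N. \<Sum>\<^sub>\<infinity>m\<in>UNIV - {0}. 1 / (of_int m * \<tau> - of_nat N) - 1 / (of_int m * \<tau> + of_nat N)) \<longlonglongrightarrow> - 2 * of_real pi * \<i> / \<tau>"
proof -
  have \<tau>0: "\<tau> \<noteq> 0" by (rule uhp_nonzero[OF \<tau>])
  define y where "y = 1 / \<tau>"
  have y0: "y \<noteq> 0" and \<tau>y: "\<tau> = 1 / y" using \<tau>0 by (auto simp: y_def)
  have Imy: "Im y < 0"
    using uhp_inversion[OF \<tau>] by (simp add: y_def uhp_def)
  have eq: "(\<Sum>\<^sub>\<infinity>m\<in>UNIV - {0}. 1 / (of_int m * \<tau> - of_nat N) - 1 / (of_int m * \<tau> + of_nat N))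
     = 2 * y * (1 / (of_nat N * y) - of_real pi * cot (of_real pi * (of_nat N * y)))" if N: "N > 0" for N
  proof -
    let ?h = "\<lambda>m::int. 1 / (of_int m * \<tau> - of_nat N) - 1 / (of_int m * \<tau> + of_nat N)"
    let ?x = "of_nat N * y"
    have xI: "?x \<notin> \<int>"
    proof
      assume "?x \<in> \<int>"
      then obtain i where "?x = of_int i" by (rule Ints_cases)
      then have "Im ?x = Im (of_int i)" by (rule arg_cong)
      then show False using N Imy by simp
    qed
    \<comment> \<open>The two reciprocals are not summable over \<open>m\<close> separately. Their
      difference is a finite sum of telescope columns, each of which is the difference of two
      summable columns.\<close>
    have sm: "?h summable_on (UNIV - {0})"
    proof -
      have d: "(\<lambda>m. 1 / lattice_pt m n ^ 2 - lattice_telescope m n) summable_on (UNIV - {0})" for n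
      proof -
        have "(\<lambda>(n, m). 1 / lattice_pt m n ^ 2 - lattice_telescope m n) summable_on (UNIV \<times> (UNIV - {0}))"
          using summable_on_lattice_difference by (subst (asm) summable_on_swap) (simp add: case_prod_unfold)
        from summable_on_SigmaD1[OF this, of n] show ?thesis by simp
      qed
      have "(\<lambda>m. lattice_telescope m n) summable_on (UNIV - {0})" for n
        using summable_on_diff[OF summable_on_lattice_column[of n] d[of n]] by simp
      then have "(\<lambda>m. \<Sum>n\<in>{- int N..<int N}. lattice_telescope m n) summable_on (UNIV - {0})"
        by (intro has_sum_imp_summable[OF has_sum_sum[OF has_sum_infsum]])
      moreover have "(\<Sum>n\<in>{- int N..<int N}. lattice_telescope m n) = ?h m" for m
        using sum_int_telescope[of "\<lambda>n. 1 / lattice_pt m n"] by (simp add: lattice_telescope_def)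
      ultimately show ?thesis by simp
    qed
    have ev: "?h (- m) = ?h m" for m
    proof -
      have "1 / (- a - b) - 1 / (- a + b) = 1 / (a - b) - 1 / (a + b)" for a b :: complex
      proof -
        have "- a - b = - (a + b)" "- a + b = - (a - b)" by simp_all
        then show ?thesis by (simp only: divide_minus_right) simp
      qed
      from this[of "of_int m * \<tau>" "of_nat N"] show ?thesis by simp
    qed
    have "(\<lambda>k. 2 *\<^sub>R ?h (int k + 1)) sums infsum ?h (UNIV - {0})"
      by (rule has_sum_nonzero_int_of_even[OF has_sum_infsum[OF sm] ev])
    moreover have "2 *\<^sub>R ?h (int k + 1) = 2 * y * (1 / (of_nat (Suc k) - ?x) - 1 / (of_nat (Suc k) + ?x))" for k
    proof -
      have "of_int (int k + 1) * \<tau> - of_nat N = (of_nat (Suc k) - ?x) / y"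
        "of_int (int k + 1) * \<tau> + of_nat N = (of_nat (Suc k) + ?x) / y"
        using y0 by (simp_all add: \<tau>y field_simps)
      then show ?thesis by (simp add: scaleR_2 algebra_simps del: of_nat_Suc)
    qed
    ultimately have "(\<lambda>k. 2 * y * (1 / (of_nat (Suc k) - ?x) - 1 / (of_nat (Suc k) + ?x))) sums infsum ?h (UNIV - {0})"
      by simp
    moreover have "(\<lambda>k. 2 * y * (1 / (of_nat (Suc k) - ?x) - 1 / (of_nat (Suc k) + ?x))) sums
       (2 * y * (1 / ?x - of_real pi * cot (of_real pi * ?x)))"
      by (intro sums_mult cot_partial_fractions xI)
    ultimately show ?thesis by (rule sums_unique2)
  qed
  have "(\<lambda>N. 2 * y * (1 / (of_nat N * y) - of_real pi * cot (of_real pi * (of_nat N * y)))) \<longlonglongrightarrow> 2 * y * (0 - of_real pi * \<i>)"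
  proof (intro tendsto_intros tendsto_cot_lower_half_plane Imy)
    have "(\<lambda>N. (1 / y) * (1 / of_nat N)) \<longlonglongrightarrow> (1 / y) * 0"
      by (intro tendsto_intros lim_1_over_n)
    then show "(\<lambda>N. 1 / (of_nat N * y)) \<longlonglongrightarrow> 0" by (simp add: mult.commute)
  qed
  then have "(\<lambda>N. \<Sum>\<^sub>\<infinity>m\<in>UNIV - {0}. 1 / (of_int m * \<tau> - of_nat N) - 1 / (of_int m * \<tau> + of_nat N)) \<longlonglongrightarrow> 2 * y * (0 - of_real pi * \<i>)"
    by (rule Lim_transform_eventually) (use eventually_gt_at_top[of 0] in eventually_elim, simp only: eq)
  then show ?thesis by (simp add: y_def algebra_simps)
qed

end

text \<open>The row \<open>m = 0\<close> of the lattice, the origin of the constant in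
  \<open>eisenstein_G 2\<close>. Under inversion it corresponds to the column
  \<open>n = 0\<close>.\<close>

lemma has_sum_inverse_squares_int:
  "((\<lambda>n. 1 / (of_int n)\<^sup>2 :: complex) has_sum of_real (pi\<^sup>2 / 3)) (UNIV - {0::int})"
proof -
  have "(\<lambda>n::int. 1 / (of_int n :: complex)\<^sup>2) summable_on (UNIV - {0})"
  proof (rule abs_summable_summable, rule Infinite_Sum.abs_summable_on_comparison_test'[of lattice_weight])
    show "norm (1 / (of_int n :: complex)\<^sup>2) \<le> lattice_weight n" if "n \<in> UNIV - {0}" for n
      using inverse_square_le_lattice_weight(1)[of n 0] that by (simp add: norm_divide norm_power)
  qed (rule summable_on_subset_banach[OF summable_on_lattice_weight], simp)
  then have sum: "((\<lambda>n. 1 / (of_int n)\<^sup>2 :: complex) has_sum infsum (\<lambda>n. 1 / (of_int n)\<^sup>2) (UNIV - {0::int})) (UNIV - {0::int})"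
    by (rule has_sum_infsum)
  then have "(\<lambda>k. 2 *\<^sub>R (1 / (of_int (int k + 1))\<^sup>2)) sums infsum (\<lambda>n. 1 / (of_int n)\<^sup>2 :: complex) (UNIV - {0::int})"
    by (rule has_sum_nonzero_int_of_even) simp
  moreover have "(\<lambda>k. 2 *\<^sub>R (1 / (of_int (int k + 1))\<^sup>2)) sums (of_real (2 * (pi\<^sup>2 / 6)) :: complex)"
    using sums_mult[OF inverse_squares_sums, of 2, THEN sums_of_real, where 'a = complex]
    by (simp add: scaleR_conv_of_real add.commute)
  ultimately have "infsum (\<lambda>n. 1 / (of_int n)\<^sup>2 :: complex) (UNIV - {0::int}) = of_real (2 * (pi\<^sup>2 / 6))"
    by (rule sums_unique2)
  with sum show ?thesis by simp
qed

text \<open>The double series is only conditionally convergent.  Subtracting the telescoping series, whose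
  inner sums over \<open>n\<close> vanish, makes it absolutely convergent, so that the order of summation can be
  changed; the telescoping series then leaves the boundary term computed above from the cotangent.\<close>

theorem eisenstein_G2_inversion:
  assumes \<tau>: "\<tau> \<in> uhp"
  shows "eisenstein_G 2 (- 1 / \<tau>) = \<tau>\<^sup>2 * eisenstein_G 2 \<tau> - 2 * of_real pi * \<i> * \<tau>"
proof -
  let ?\<sigma> = "- 1 / \<tau>"
  let ?a = "\<lambda>m n. 1 / (of_int m * \<tau> + of_int n)\<^sup>2"
  let ?d = "\<lambda>m n. ?a m n - lattice_telescope \<tau> m n"
  let ?A = "\<lambda>n. \<Sum>\<^sub>\<infinity>m\<in>UNIV - {0}. ?a m n"
  let ?p = "of_real (pi\<^sup>2 / 3) :: complex"
  have \<tau>0: "\<tau> \<noteq> 0" by (rule uhp_nonzero[OF \<tau>])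
  have \<sigma>: "?\<sigma> \<in> uhp" by (rule uhp_inversion[OF \<tau>])
  have colA: "(\<lambda>m. ?a m n) summable_on (UNIV - {0})" for n
    by (rule summable_on_lattice_column[OF \<tau>])
  have sd: "(\<lambda>(n, m). ?d m n) summable_on (UNIV \<times> (UNIV - {0}))"
    using summable_on_lattice_difference[OF \<tau>] by (subst (asm) summable_on_swap) (simp add: case_prod_unfold)
  have cold: "(\<lambda>m. ?d m n) summable_on (UNIV - {0})" for n
    using summable_on_SigmaD1[OF sd, of n] by simp
  have colt: "(\<lambda>m. lattice_telescope \<tau> m n) summable_on (UNIV - {0})" for n
    using summable_on_diff[OF colA[of n] cold[of n]] by simp
  have "((\<lambda>n. \<Sum>\<^sub>\<infinity>m\<in>UNIV - {0}. ?d m n) has_sum (\<Sum>\<^sub>\<infinity>n. \<Sum>\<^sub>\<infinity>m\<in>UNIV - {0}. ?d m n)) UNIV"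
    by (rule has_sum_infsum) (rule summable_on_Sigma_banach[OF sd])
  also have "(\<Sum>\<^sub>\<infinity>n. \<Sum>\<^sub>\<infinity>m\<in>UNIV - {0}. ?d m n) = (\<Sum>\<^sub>\<infinity>m\<in>UNIV - {0}. \<Sum>\<^sub>\<infinity>n. ?d m n)"
    by (rule infsum_swap_banach[OF sd])
  also have "\<dots> = (\<Sum>\<^sub>\<infinity>m\<in>UNIV - {0}. \<Sum>\<^sub>\<infinity>n. ?a m n)"
    by (rule infsum_cong) (simp add: infsum_lattice_row[OF \<tau>])
  also have "\<dots> = eisenstein_G 2 \<tau> - ?p"
    using has_sum_lattice_rows[OF \<tau>] by (rule infsumI)
  finally have lim1: "(\<lambda>N. \<Sum>n\<in>{- int N..<int N}. \<Sum>\<^sub>\<infinity>m\<in>UNIV - {0}. ?d m n) \<longlonglongrightarrow> eisenstein_G 2 \<tau> - ?p"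
    by (rule has_sum_int_symmetric_limit)
  have "(\<Sum>n\<in>{- int N..<int N}. \<Sum>\<^sub>\<infinity>m\<in>UNIV - {0}. ?d m n) = (\<Sum>n\<in>{- int N..<int N}. ?A n)
      - (\<Sum>\<^sub>\<infinity>m\<in>UNIV - {0}. 1 / (of_int m * \<tau> - of_nat N) - 1 / (of_int m * \<tau> + of_nat N))" for N
  proof -
    have "(\<Sum>n\<in>{- int N..<int N}. \<Sum>\<^sub>\<infinity>m\<in>UNIV - {0}. ?d m n)
       = (\<Sum>n\<in>{- int N..<int N}. ?A n - (\<Sum>\<^sub>\<infinity>m\<in>UNIV - {0}. lattice_telescope \<tau> m n))"
      by (intro sum.cong refl infsum_diff colA colt)
    also have "\<dots> = (\<Sum>n\<in>{- int N..<int N}. ?A n) - (\<Sum>\<^sub>\<infinity>m\<in>UNIV - {0}. \<Sum>n\<in>{- int N..<int N}. lattice_telescope \<tau> m n)"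
      unfolding sum_subtractf by (subst infsumI[OF has_sum_sum[OF has_sum_infsum[OF colt]]]) simp
    also have "(\<lambda>m. \<Sum>n\<in>{- int N..<int N}. lattice_telescope \<tau> m n) = (\<lambda>m. 1 / (of_int m * \<tau> - of_nat N) - 1 / (of_int m * \<tau> + of_nat N))"
      using sum_int_telescope[of "\<lambda>n. 1 / (of_int _ * \<tau> + of_int n)"] by (simp add: lattice_telescope_def[OF \<tau>])
    finally show ?thesis .
  qed
  with lim1 have "(\<lambda>N. (\<Sum>n\<in>{- int N..<int N}. ?A n)
      - (\<Sum>\<^sub>\<infinity>m\<in>UNIV - {0}. 1 / (of_int m * \<tau> - of_nat N) - 1 / (of_int m * \<tau> + of_nat N))) \<longlonglongrightarrow> eisenstein_G 2 \<tau> - ?p"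
    by simp
  from tendsto_add[OF this tendsto_lattice_boundary[OF \<tau>]]
  have limA: "(\<lambda>N. \<Sum>n\<in>{- int N..<int N}. ?A n) \<longlonglongrightarrow> eisenstein_G 2 \<tau> - ?p + - 2 * of_real pi * \<i> / \<tau>"
    by simp
  \<comment> \<open>A column at \<open>\<tau>\<close> is a row at \<open>-1/\<tau>\<close> up to the
    factor \<open>1 / \<tau>^2\<close>; \<open>?A\<close> omits the entry \<open>m = 0\<close>,
    whence the subtracted term.\<close>
  have A: "?A n = (\<Sum>\<^sub>\<infinity>k. 1 / (of_int n * ?\<sigma> + of_int k)\<^sup>2) / \<tau>\<^sup>2 - 1 / (of_int n)\<^sup>2" if n: "n \<noteq> 0" for n
  proof -
    have "(\<Sum>\<^sub>\<infinity>k. 1 / (of_int n * ?\<sigma> + of_int k)\<^sup>2) / \<tau>\<^sup>2 = (\<Sum>\<^sub>\<infinity>k. 1 / (of_int n * ?\<sigma> + of_int k)\<^sup>2 * (1 / \<tau>\<^sup>2))"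
      by (subst infsum_cmult_left') simp
    also have "\<dots> = (\<Sum>\<^sub>\<infinity>m. ?a m n)"
    proof (rule infsum_reindex_bij_witness[of _ uminus uminus])
      fix k :: int
      have "(of_int (- k) * \<tau> + of_int n)\<^sup>2 = (of_int n * ?\<sigma> + of_int k)\<^sup>2 * \<tau>\<^sup>2"
        using \<tau>0 by (simp add: field_simps power2_eq_square)
      then show "?a (- k) n = 1 / (of_int n * ?\<sigma> + of_int k)\<^sup>2 * (1 / \<tau>\<^sup>2)" by simp
    qed auto
    also have "(\<Sum>\<^sub>\<infinity>m. ?a m n) = (\<Sum>\<^sub>\<infinity>m\<in>insert 0 (UNIV - {0}). ?a m n)"
      by (simp add: insert_UNIV)
    also have "\<dots> = 1 / (of_int n)\<^sup>2 + ?A n"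
      using colA by (subst infsum_insert) auto
    finally show ?thesis by simp
  qed
  have "((\<lambda>n. (\<Sum>\<^sub>\<infinity>k. 1 / (of_int n * ?\<sigma> + of_int k)\<^sup>2) / \<tau>\<^sup>2 - 1 / (of_int n)\<^sup>2) has_sum
      ((eisenstein_G 2 ?\<sigma> - ?p) / \<tau>\<^sup>2 - ?p)) (UNIV - {0})"
    by (intro has_sum_diff has_sum_divide_const has_sum_lattice_rows[OF \<sigma>] has_sum_inverse_squares_int)
  then have "(?A has_sum ((eisenstein_G 2 ?\<sigma> - ?p) / \<tau>\<^sup>2 - ?p)) (UNIV - {0})"
    by (rule has_sum_cong[THEN iffD1, rotated]) (simp add: A)
  moreover have "?A 0 = ?p / \<tau>\<^sup>2"
    using has_sum_divide_const[OF has_sum_inverse_squares_int, of "\<tau>\<^sup>2"] by (simp add: power_mult_distrib infsumI)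
  ultimately have "(?A has_sum (?p / \<tau>\<^sup>2 + ((eisenstein_G 2 ?\<sigma> - ?p) / \<tau>\<^sup>2 - ?p))) (insert 0 (UNIV - {0}))"
    using has_sum_insert[of 0 "UNIV - {0}" ?A] by simp
  then have "(\<lambda>N. \<Sum>n\<in>{- int N..<int N}. ?A n) \<longlonglongrightarrow> ?p / \<tau>\<^sup>2 + ((eisenstein_G 2 ?\<sigma> - ?p) / \<tau>\<^sup>2 - ?p)"
    by (intro has_sum_int_symmetric_limit) (simp add: insert_UNIV)
  \<comment> \<open>Two evaluations of the same symmetric limit: by rows of the lattice at
    \<open>-1/\<tau>\<close>, and by interchanging the corrected sum at
    \<open>\<tau>\<close>.\<close>
  from LIMSEQ_unique[OF this limA]
  have "eisenstein_G 2 ?\<sigma> / \<tau>\<^sup>2 = eisenstein_G 2 \<tau> - 2 * of_real pi * \<i> / \<tau>"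
    by (simp add: diff_divide_distrib)
  then show ?thesis using \<tau>0 by (simp add: field_simps power2_eq_square)
qed

lemma eisenstein_E2_inversion:
  assumes "\<tau> \<in> uhp"
  shows "eisenstein_E 2 (- 1 / \<tau>) = \<tau>\<^sup>2 * eisenstein_E 2 \<tau> - \<tau> / (2 * of_real pi * \<i>)"
proof -
  have "(\<tau>\<^sup>2 * G - p * \<i> * \<tau>) / (p * \<i>)\<^sup>2 = \<tau>\<^sup>2 * (G / (p * \<i>)\<^sup>2) - \<tau> / (p * \<i>)" if "p \<noteq> 0" for G p :: complex
    using that by (simp add: field_simps power2_eq_square)
  from this[of "2 * of_real pi"] eisenstein_G2_inversion[OF assms] show ?thesis
    unfolding eisenstein_E_def if_P[OF assms] if_P[OF uhp_inversion[OF assms]] by simp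
qed

section \<open>Gradings\<close>

lemma Sum_any_eq_sum: "finite A \<Longrightarrow> (\<And>i. i \<notin> A \<Longrightarrow> f i = 0) \<Longrightarrow> Sum_any f = (\<Sum>i\<in>A. f i)"
  by (rule Sum_any.expand_superset) auto

locale complex_vector_space = vector_space scale
  for scale :: "complex \<Rightarrow> 'm::ab_group_add \<Rightarrow> 'm"

text \<open>Serves the \<open>L(0)\<close>-grading of \<open>V\<close> and the
  \<open>L[0]\<close>-gradings of \<open>V\<close> and of \<open>U\<close>.\<close>

locale graded_space = complex_vector_space scale
  for scale :: "complex \<Rightarrow> 'm::ab_group_add \<Rightarrow> 'm" +
  fixes N :: "'i \<Rightarrow> 'm set"
  assumes direct_sum: "direct_sum scale UNIV N UNIV"
begin

lemma subspace_piece: "subspace (N i)"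
  and span_pieces: "span (\<Union>i. N i) = UNIV"
  and pieces_independent: "finite J \<Longrightarrow> (\<And>i. i \<in> J \<Longrightarrow> x i \<in> N i) \<Longrightarrow> (\<Sum>i\<in>J. x i) = 0 \<Longrightarrow> i \<in> J \<Longrightarrow> x i = 0"
  using direct_sum unfolding direct_sum_def by (auto, blast)

text \<open>Shaped like the condition inside \<open>voa_component\<close>, so that the two notions
  of component agree by unfolding.\<close>

definition decomposition :: "'m \<Rightarrow> ('i \<Rightarrow> 'm) \<Rightarrow> bool" where
  "decomposition v f \<longleftrightarrow> (\<forall>i. f i \<in> N i) \<and> finite {i. f i \<noteq> 0} \<and> v = Sum_any f"

lemma piece_zero: "0 \<in> N i"
  using subspace_piece by (rule subspace_0)

lemma decomposition_zero: "decomposition 0 (\<lambda>_. 0)"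
  by (simp add: decomposition_def piece_zero)

lemma decomposition_add:
  assumes "decomposition v f" "decomposition w g"
  shows "decomposition (v + w) (\<lambda>i. f i + g i)"
proof -
  have "{i. f i + g i \<noteq> 0} \<subseteq> {i. f i \<noteq> 0} \<union> {i. g i \<noteq> 0}" by auto
  then have "finite {i. f i + g i \<noteq> 0}"
    by (rule finite_subset) (use assms in \<open>simp add: decomposition_def\<close>)
  then show ?thesis
    using assms subspace_add[OF subspace_piece] by (simp add: decomposition_def Sum_any.distrib)
qed

lemma decomposition_scale:
  assumes "decomposition v f"
  shows "decomposition (scale a v) (\<lambda>i. scale a (f i))"
proof -
  have fin: "finite {i. f i \<noteq> 0}" and sub: "{i. scale a (f i) \<noteq> 0} \<subseteq> {i. f i \<noteq> 0}"
    using assms by (auto simp: decomposition_def)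
  have "Sum_any f = (\<Sum>i | f i \<noteq> 0. f i)" by (rule Sum_any_eq_sum[OF fin]) simp
  moreover have "Sum_any (\<lambda>i. scale a (f i)) = (\<Sum>i | f i \<noteq> 0. scale a (f i))" by (rule Sum_any_eq_sum[OF fin]) simp
  ultimately have "scale a (Sum_any f) = Sum_any (\<lambda>i. scale a (f i))" by (simp add: scale_sum_right)
  then show ?thesis
    using assms subspace_scale[OF subspace_piece] finite_subset[OF sub fin] by (simp add: decomposition_def)
qed

lemma decomposition_single:
  assumes "x \<in> N i"
  shows "decomposition x (\<lambda>j. if j = i then x else 0)"
proof -
  have "{j. (if j = i then x else 0) \<noteq> 0} \<subseteq> {i}" by auto
  then have "finite {j. (if j = i then x else 0) \<noteq> 0}" by (rule finite_subset) simp
  moreover have "Sum_any (\<lambda>j. if j = i then x else 0) = x"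
    by (subst Sum_any_eq_sum[of "{i}"]) auto
  ultimately show ?thesis using assms piece_zero by (simp add: decomposition_def)
qed

lemma decomposition_exists: "\<exists>f. decomposition v f"
proof -
  have "v \<in> span (\<Union>i. N i)" by (simp add: span_pieces)
  then show ?thesis
  proof (induction rule: span_induct_alt)
    case base
    show ?case using decomposition_zero by blast
  next
    case (step c x y)
    then obtain i g where "x \<in> N i" "decomposition y g" by auto
    then have "decomposition (scale c x + y) (\<lambda>j. scale c (if j = i then x else 0) + g j)"
      by (intro decomposition_add decomposition_scale decomposition_single)
    then show ?case by blast
  qed
qed

lemma decomposition_unique:
  assumes "decomposition v f" "decomposition v g"
  shows "f = g"
proof
  fix i
  have "decomposition (v + scale (-1) v) (\<lambda>i. f i + scale (-1) (g i))"
    using assms by (intro decomposition_add decomposition_scale)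
  then have d: "\<And>i. f i - g i \<in> N i" "finite {i. f i - g i \<noteq> 0}" "0 = Sum_any (\<lambda>i. f i - g i)"
    by (simp_all add: decomposition_def)
  have "(\<Sum>i | f i - g i \<noteq> 0. f i - g i) = 0"
    using Sum_any_eq_sum[OF d(2), of "\<lambda>i. f i - g i"] d(3) by auto
  from pieces_independent[OF d(2) d(1) this, of i] show "f i = g i" by auto
qed

definition component :: "'i \<Rightarrow> 'm \<Rightarrow> 'm" where
  "component i v = (THE f. decomposition v f) i"

lemma component_eq: "decomposition v f \<Longrightarrow> component i v = f i"
  unfolding component_def using decomposition_unique by (metis the_equality)

lemma decomposition_component: "decomposition v (\<lambda>i. component i v)"
proof -
  obtain f where f: "decomposition v f" using decomposition_exists by blast
  then have "(\<lambda>i. component i v) = f" using component_eq[OF f] by auto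
  then show ?thesis using f by simp
qed

lemma component_in: "component i v \<in> N i"
  and finite_component: "finite {i. component i v \<noteq> 0}"
  and sum_component: "v = Sum_any (\<lambda>i. component i v)"
  using decomposition_component[of v] by (auto simp: decomposition_def)

lemma component_add: "component i (v + w) = component i v + component i w"
  using component_eq[OF decomposition_add[OF decomposition_component decomposition_component]] .

lemma component_scale: "component i (scale a v) = scale a (component i v)"
  using component_eq[OF decomposition_scale[OF decomposition_component]] .

lemma component_single: "x \<in> N i \<Longrightarrow> component j x = (if j = i then x else 0)"
  using component_eq[OF decomposition_single] .

text \<open>Pieces are subspaces, so the scalars of a linear combination are absorbed into its
  homogeneous terms and no case for scaling arises.\<close>

lemma graded_induct [case_names piece add]:
  assumes piece: "\<And>i x. x \<in> N i \<Longrightarrow> P x" and add: "\<And>x y. P x \<Longrightarrow> P y \<Longrightarrow> P (x + y)"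
  shows "P v"
proof -
  have "v \<in> span (\<Union>i. N i)" by (simp add: span_pieces)
  then show ?thesis
  proof (induction rule: span_induct_alt)
    case base
    show ?case using piece[OF piece_zero] .
  next
    case (step c x y)
    then obtain i where "x \<in> N i" by auto
    with step show ?case by (intro add) (auto intro: piece subspace_scale[OF subspace_piece])
  qed
qed

end

section \<open>Eigenspaces of a linear operator\<close>

context complex_vector_space
begin

text \<open>Applying \<open>T - \<mu> j\<close> to the relation removes the vector with index
  \<open>j\<close> and rescales the others by nonzero factors.\<close>

lemma eigenvectors_independent:
  assumes T: "\<And>x y. T (x + y) = T x + T y" "\<And>a x. T (scale a x) = scale a (T x)"
    and "finite J" "inj_on \<mu> J" "\<And>i. i \<in> J \<Longrightarrow> T (x i) = scale (\<mu> i) (x i)" "(\<Sum>i\<in>J. x i) = 0" "i \<in> J"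
  shows "x i = 0"
  using assms(3-)
proof (induction J arbitrary: x i rule: finite_induct)
  case (insert j J)
  have T0: "T 0 = 0" using T(2)[of 0 0] by simp
  have Tsum: "T (\<Sum>i\<in>A. y i) = (\<Sum>i\<in>A. T (y i))" for A y
    by (induction A rule: infinite_finite_induct) (simp_all add: T T0)
  have "0 = T (\<Sum>i\<in>insert j J. x i) - scale (\<mu> j) (\<Sum>i\<in>insert j J. x i)"
    using insert.prems(3) T0 by simp
  also have "\<dots> = (\<Sum>i\<in>insert j J. scale (\<mu> i - \<mu> j) (x i))"
    unfolding Tsum scale_sum_right sum_subtractf[symmetric]
    by (intro sum.cong refl) (simp add: insert.prems(2) scale_left_diff_distrib)
  also have "\<dots> = (\<Sum>i\<in>J. scale (\<mu> i - \<mu> j) (x i))"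
    using insert.hyps by simp
  finally have z: "(\<Sum>i\<in>J. scale (\<mu> i - \<mu> j) (x i)) = 0" ..
  have J: "x i = 0" if "i \<in> J" for i
  proof -
    have "T (scale (\<mu> i - \<mu> j) (x i)) = scale (\<mu> i) (scale (\<mu> i - \<mu> j) (x i))" if "i \<in> J" for i
      using that insert.prems(2)[of i] by (simp add: T mult.commute)
    then have "scale (\<mu> i - \<mu> j) (x i) = 0"
      using insert.IH[of "\<lambda>i. scale (\<mu> i - \<mu> j) (x i)" i] insert.prems(1) z that by (auto simp: inj_on_def)
    moreover have "\<mu> i \<noteq> \<mu> j" using insert.prems(1) insert.hyps that by (auto simp: inj_on_def)
    ultimately show ?thesis by simp
  qed
  moreover have "x j = 0" using insert.prems(3) insert.hyps J by simp
  ultimately show ?case using insert.prems(4) by auto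
qed simp

lemma eigenspaces_direct_sum:
  assumes T: "\<And>x y. T (x + y) = T x + T y" "\<And>a x. T (scale a x) = scale a (T x)"
    and "inj \<mu>" "span (\<Union>i. {x. T x = scale (\<mu> i) x}) = UNIV"
  shows "direct_sum scale UNIV (\<lambda>i. {x. T x = scale (\<mu> i) x}) UNIV"
  unfolding direct_sum_def
proof (intro conjI ballI allI impI)
  fix i
  have "T 0 = 0" using T(2)[of 0 0] by simp
  then show "subspace {x. T x = scale (\<mu> i) x}"
    by (auto simp: subspace_def T scale_right_distrib mult.commute)
next
  fix J x i assume "finite J \<and> J \<subseteq> UNIV \<and> (\<forall>i\<in>J. x i \<in> {x. T x = scale (\<mu> i) x}) \<and> sum x J = 0" "i \<in> J"
  then show "x i = 0"
    using eigenvectors_independent[OF T, of J \<mu> x i] assms(3) by (auto intro: inj_on_subset)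
qed (use assms(4) in simp)

text \<open>On the component with index \<open>i\<close> the operator \<open>T - c\<close> is the
  nonzero scalar \<open>\<mu> i - c\<close>, hence it is injective. This rules out negative weights
  of \<open>V\<close>, weights below the lowest one, and square weights outside
  \<open>t + Z\<close>.\<close>

lemma eigenvector_eq_0:
  assumes T: "\<And>x y. T (x + y) = T x + T y" "\<And>a x. T (scale a x) = scale a (T x)"
    and "inj \<mu>" "span (\<Union>i. {x. T x = scale (\<mu> i) x}) = UNIV"
    and x: "T x = scale c x" "c \<notin> range \<mu>"
  shows "x = 0"
proof -
  let ?N = "\<lambda>i. {x. T x = scale (\<mu> i) x}"
  interpret graded_space scale ?N
    by unfold_locales (rule eigenspaces_direct_sum[OF T assms(3,4)])
  have T0: "T 0 = 0" using T(2)[of 0 0] by simp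
  have Tsum: "T (\<Sum>i\<in>A. y i) = (\<Sum>i\<in>A. T (y i))" for A y
    by (induction A rule: infinite_finite_induct) (simp_all add: T T0)
  let ?J = "{i. component i x \<noteq> 0}"
  have xs: "x = (\<Sum>i\<in>?J. component i x)"
    by (subst sum_component) (rule Sum_any_eq_sum[OF finite_component], simp)
  have Tc: "T (component i x) = scale (\<mu> i) (component i x)" for i
    using component_in[of i x] by simp
  have "(\<Sum>i\<in>?J. scale (\<mu> i - c) (component i x)) = T (\<Sum>i\<in>?J. component i x) - scale c (\<Sum>i\<in>?J. component i x)"
    unfolding Tsum scale_sum_right sum_subtractf[symmetric] by (simp add: Tc scale_left_diff_distrib)
  also have "\<dots> = 0" using x(1) xs by simp
  finally have "scale (\<mu> i - c) (component i x) = 0" if "i \<in> ?J" for i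
    using that by (intro pieces_independent[where J = ?J and x = "\<lambda>i. scale (\<mu> i - c) (component i x)"] finite_component)
      (auto simp: Tc T mult.commute)
  then have "?J = {}" using x(2) by (auto simp: rangeI)
  then show ?thesis using xs by simp
qed

end

section \<open>Square bracket modes on modules\<close>

text \<open>Applies to \<open>U\<close> and, by \<open>voa_rep_adjoint\<close>, to \<open>V\<close>
  over itself. Both are needed at once because the commutator of \<open>L[0]\<close> with a square
  mode involves \<open>L[0]\<close> on \<open>V\<close>.\<close>

locale voa_rep =
  fixes V :: "'v::ab_group_add voa" and M :: "('v, 'm::ab_group_add) vmod"
  assumes voa: "vertex_operator_algebra V" and weak: "weak_module V M UNIV"
begin

sublocale vsp: complex_vector_space "vscale V"
  using weak by (simp add: weak_module_def complex_vector_space_def)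

sublocale msp: complex_vector_space "mscale M"
  using weak by (simp add: weak_module_def complex_vector_space_def)

lemma mode_add: "mmode M v n (x + y) = mmode M v n x + mmode M v n y"
  and mode_scale: "mmode M v n (mscale M a x) = mscale M a (mmode M v n x)"
  and mode_add_left: "mmode M (v + w) n x = mmode M v n x + mmode M w n x"
  and mode_scale_left: "mmode M (vscale V a v) n x = mscale M a (mmode M v n x)"
  and mode_truncation: "\<exists>N. \<forall>n\<ge>N. mmode M v n x = 0"
  and mode_vac: "mmode M (vac V) n x = (if n = -1 then x else 0)"
  and borcherds: "borcherds V M UNIV"
  using weak by (auto simp: weak_module_def)

lemma mode_zero [simp]: "mmode M v n 0 = 0"
  using mode_scale[of v n 0 0] by simp

lemma mode_zero_left [simp]: "mmode M 0 n x = 0"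
  using mode_scale_left[of 0 0 n x] by simp

lemma mode_sum: "mmode M v n (\<Sum>i\<in>A. f i) = (\<Sum>i\<in>A. mmode M v n (f i))"
  by (induction A rule: infinite_finite_induct) (simp_all add: mode_add)

lemma voa_lmode_minus_1: "Lmode V (adjoint_mod V) (-1) v = vmode V v (-2) (vac V)"
proof -
  have "vmode V (Lmode V (adjoint_mod V) (-1) v) (-1) (vac V) = vscale V (- of_int (-1)) (vmode V v (-1 - 1) (vac V))"
    using voa unfolding vertex_operator_algebra_def by blast
  moreover have "vmode V w (-1) (vac V) = w" for w
    using voa by (simp add: vertex_operator_algebra_def)
  ultimately show ?thesis by simp
qed

text \<open>The Borcherds identity at \<open>l = 0\<close>, where only \<open>i = 0\<close> survives
  on the right. A nonnegative index of \<open>a\<close> makes the other side stop at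
  \<open>k\<close>.\<close>

lemma mode_commutator:
  "mmode M a (int k) (mmode M b n x) - mmode M b n (mmode M a (int k) x) =
    (\<Sum>i\<le>k. mscale M (of_nat (k choose i)) (mmode M (vmode V a (int i) b) (int k + n - int i) x))"
proof -
  have "Sum_any (\<lambda>i::nat. mscale M (of_int (int k) gchoose i)
       (mmode M (vmode V a (0 + int i) b) (int k + n - int i) x)) =
     Sum_any (\<lambda>i::nat. mscale M ((-1) ^ i * (of_int 0 gchoose i))
       (mmode M a (0 + int k - int i) (mmode M b (n + int i) x) -
        mscale M ((-1) powi 0) (mmode M b (0 + n - int i) (mmode M a (int k + int i) x))))"
    using borcherds unfolding borcherds_def by blast
  moreover have "Sum_any (\<lambda>i::nat. mscale M (of_int (int k) gchoose i)
       (mmode M (vmode V a (0 + int i) b) (int k + n - int i) x))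
      = (\<Sum>i\<le>k. mscale M (of_nat (k choose i)) (mmode M (vmode V a (int i) b) (int k + n - int i) x))"
    by (subst Sum_any_eq_sum[of "{..k}"]) (auto simp: binomial_gbinomial[symmetric])
  moreover have "Sum_any (\<lambda>i::nat. mscale M ((-1) ^ i * (of_int 0 gchoose i))
       (mmode M a (0 + int k - int i) (mmode M b (n + int i) x) -
        mscale M ((-1) powi 0) (mmode M b (0 + n - int i) (mmode M a (int k + int i) x))))
      = mmode M a (int k) (mmode M b n x) - mmode M b n (mmode M a (int k) x)"
    by (subst Sum_any_eq_sum[of "{0}"]) (auto simp: gbinomial_0_left)
  ultimately show ?thesis by simp
qed

text \<open>The Borcherds identity at \<open>l = -2\<close>, \<open>m = 0\<close> with the vacuum as
  second vector. The only nonzero vacuum mode is the one at \<open>-1\<close>; it selects a term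
  from the first product if \<open>n < 0\<close>, from the second if \<open>n > 0\<close>, and none
  if \<open>n = 0\<close>.\<close>

lemma mode_derivative:
  "mmode M (Lmode V (adjoint_mod V) (-1) v) n x = mscale M (- of_int n) (mmode M v (n - 1) x)"
proof -
  have "Sum_any (\<lambda>i::nat. mscale M (of_int 0 gchoose i)
       (mmode M (vmode V v (-2 + int i) (vac V)) (0 + n - int i) x)) =
     Sum_any (\<lambda>i::nat. mscale M ((-1) ^ i * (of_int (-2) gchoose i))
       (mmode M v (-2 + 0 - int i) (mmode M (vac V) (n + int i) x) -
        mscale M ((-1) powi (-2)) (mmode M (vac V) (-2 + n - int i) (mmode M v (0 + int i) x))))"
    using borcherds unfolding borcherds_def by blast
  also have "Sum_any (\<lambda>i::nat. mscale M (of_int 0 gchoose i)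
       (mmode M (vmode V v (-2 + int i) (vac V)) (0 + n - int i) x)) = mmode M (vmode V v (-2) (vac V)) n x"
    by (subst Sum_any_eq_sum[of "{0}"]) (auto simp: gbinomial_0_left)
  also have "Sum_any (\<lambda>i::nat. mscale M ((-1) ^ i * (of_int (-2) gchoose i))
       (mmode M v (-2 + 0 - int i) (mmode M (vac V) (n + int i) x) -
        mscale M ((-1) powi (-2)) (mmode M (vac V) (-2 + n - int i) (mmode M v (0 + int i) x))))
     = mscale M (- of_int n) (mmode M v (n - 1) x)"
  proof -
    have c: "(-1) ^ i * (of_int (-2) gchoose i) = (of_nat (Suc i) :: complex)" for i :: nat
      using gbinomial_negated_upper[of "- 2 :: complex" i] binomial_gbinomial[of "Suc i" i, where 'a = complex]
        binomial_symmetric[of i "Suc i"]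
      by (simp add: power_mult_distrib[symmetric] mult.assoc[symmetric] add.commute)
    consider "n \<le> -1" | "n = 0" | "n \<ge> 1" by linarith
    then show ?thesis
    proof cases
      case 1
      define k where "k = nat (- 1 - n)"
      have n: "n = - 1 - int k" using 1 by (simp add: k_def)
      show ?thesis unfolding c
        by (subst Sum_any_eq_sum[of "{k}"]) (auto simp: mode_vac n)
    next
      case 2
      then show ?thesis unfolding c
        by (subst Sum_any_eq_sum[of "{}"]) (auto simp: mode_vac)
    next
      case 3
      define k where "k = nat (n - 1)"
      have n: "n = 1 + int k" using 3 by (simp add: k_def)
      show ?thesis unfolding c
        by (subst Sum_any_eq_sum[of "{k}"]) (auto simp: mode_vac n simp flip: msp.scale_minus_left)
    qed
  qed
  finally show ?thesis by (simp add: voa_lmode_minus_1)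
qed

end

lemma adjoint_mod_simps [simp]: "mmode (adjoint_mod V) = vmode V" "mscale (adjoint_mod V) = vscale V"
  by (simp_all add: adjoint_mod_def)

lemma voa_rep_adjoint: "vertex_operator_algebra V \<Longrightarrow> voa_rep V (adjoint_mod V)"
  by (simp add: voa_rep_def vertex_operator_algebra_def)

section \<open>Homogeneous modes and the commutator with \<open>L(j)\<close>\<close>

context voa_rep
begin

sublocale pieces: graded_space "vscale V" "voa_piece V"
  using voa by unfold_locales (simp add: vertex_operator_algebra_def)

lemma voa_component_eq: "voa_component V w a = pieces.component w a"
  by (simp add: voa_component_def pieces.component_def pieces.decomposition_def)

lemma mode_weight:
  assumes "v \<in> voa_piece V k" "x \<in> weight_space V M r"
  shows "mmode M v n x \<in> weight_space V M (r + of_nat k - of_int n - 1)"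
proof -
  have v: "vmode V (conf V) 1 v = vscale V (of_nat k) v"
    using assms(1) by (simp add: weight_space_def Lmode_def)
  have x: "mmode M (conf V) 1 x = mscale M r x"
    using assms(2) by (simp add: weight_space_def Lmode_def)
  have "mmode M (conf V) (int 1) (mmode M v n x) - mmode M v n (mmode M (conf V) (int 1) x)
      = mmode M (vmode V (conf V) 0 v) (1 + n) x + mmode M (vmode V (conf V) 1 v) n x"
    unfolding mode_commutator by simp
  moreover have "mmode M (vmode V (conf V) 0 v) (1 + n) x = mscale M (- of_int (1 + n)) (mmode M v n x)"
    using mode_derivative[of v "1 + n" x] by (simp add: Lmode_def)
  ultimately have "mmode M (conf V) 1 (mmode M v n x) = mscale M r (mmode M v n x)
      + mscale M (- of_int (1 + n)) (mmode M v n x) + mscale M (of_nat k) (mmode M v n x)"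
    by (simp add: v x mode_scale mode_scale_left algebra_simps)
  also have "\<dots> = mscale M (r + of_nat k - of_int n - 1) (mmode M v n x)"
    unfolding msp.scale_left_distrib[symmetric] by (simp add: algebra_simps)
  finally show ?thesis by (simp add: weight_space_def Lmode_def)
qed

lemma conf_weight: "conf V \<in> voa_piece V 2"
  using voa by (simp add: vertex_operator_algebra_def)

lemma Lmode_weight: "x \<in> weight_space V M r \<Longrightarrow> Lmode V M n x \<in> weight_space V M (r - of_int n)"
  using mode_weight[OF conf_weight, of x r "n + 1"] by (simp add: Lmode_def algebra_simps)

lemma Lmode_add: "Lmode V M n (x + y) = Lmode V M n x + Lmode V M n y"
  and Lmode_scale: "Lmode V M n (mscale M a x) = mscale M a (Lmode V M n x)"
  and Lmode_sum: "Lmode V M n (\<Sum>i\<in>A. f i) = (\<Sum>i\<in>A. Lmode V M n (f i))"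
  by (simp_all add: Lmode_def mode_add mode_scale mode_sum)

lemma voa_weight_eq_0:
  assumes "vmode V (conf V) 1 b = vscale V c b" "c \<notin> range of_nat"
  shows "b = 0"
proof -
  interpret adj: voa_rep V "adjoint_mod V" by (rule voa_rep_adjoint[OF voa])
  have "vsp.span (\<Union>n::nat. {x. Lmode V (adjoint_mod V) 0 x = vscale V (of_nat n) x}) = UNIV"
    using pieces.span_pieces by (simp add: weight_space_def)
  moreover have "Lmode V (adjoint_mod V) 0 (vscale V a x) = vscale V a (Lmode V (adjoint_mod V) 0 x)" for a x
    using adj.Lmode_scale[of 0 a x] by simp
  moreover have "Lmode V (adjoint_mod V) 0 b = vscale V c b" using assms(1) by (simp add: Lmode_def)
  ultimately show ?thesis
    using vsp.eigenvector_eq_0[of "Lmode V (adjoint_mod V) 0" of_nat b c] adj.Lmode_add assms(2)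
    by (auto simp: inj_of_nat)
qed

lemma voa_Lmode_weight:
  assumes "b \<in> voa_piece V h"
  shows "q \<le> h \<Longrightarrow> Lmode V (adjoint_mod V) (int q) b \<in> voa_piece V (h - q)"
    and "h < q \<Longrightarrow> Lmode V (adjoint_mod V) (int q) b = 0"
proof -
  interpret adj: voa_rep V "adjoint_mod V" by (rule voa_rep_adjoint[OF voa])
  have *: "Lmode V (adjoint_mod V) (int q) b \<in> weight_space V (adjoint_mod V) (of_nat h - of_nat q)"
    using adj.Lmode_weight[OF assms, of "int q"] by simp
  then show "q \<le> h \<Longrightarrow> Lmode V (adjoint_mod V) (int q) b \<in> voa_piece V (h - q)"
    by (simp add: of_nat_diff)
  assume "h < q"
  have "(of_nat h - of_nat q :: complex) \<notin> range of_nat"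
  proof
    assume "(of_nat h - of_nat q :: complex) \<in> range of_nat"
    then obtain j where "(of_nat h :: complex) = of_nat (q + j)" by (auto simp: algebra_simps)
    then have "h = q + j" by (rule of_nat_eq_iff[THEN iffD1])
    then show False using \<open>h < q\<close> by simp
  qed
  with * show "Lmode V (adjoint_mod V) (int q) b = 0"
    by (intro voa_weight_eq_0) (auto simp: weight_space_def Lmode_def)
qed

text \<open>\<open>L(j)\<close> is the mode \<open>j + 1\<close> of the conformal vector, so the
  commutator formula involves \<open>L(i - 1) b\<close>. The terms with \<open>L(-1) b\<close> and
  \<open>L(0) b\<close> combine to the scalar; the sum over \<open>q\<close> measures how far
  \<open>b\<close> is from being primary.\<close>

lemma Lmode_mode_commutator:
  assumes b: "b \<in> voa_piece V h"
  shows "Lmode V M (int j) (mmode M b m x) - mmode M b m (Lmode V M (int j) x) =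
     mscale M ((of_nat j + 1) * of_nat h - (of_int (m + int j) + 1)) (mmode M b (m + int j) x) +
     (\<Sum>q=1..h. mscale M (of_nat (Suc j choose Suc q)) (mmode M (Lmode V (adjoint_mod V) (int q) b) (m + int j - int q) x))"
proof -
  let ?F = "\<lambda>i. mscale M (of_nat (Suc j choose i)) (mmode M (vmode V (conf V) (int i) b) (int (Suc j) + m - int i) x)"
  have b0: "vmode V (conf V) 1 b = vscale V (of_nat h) b"
    using b by (simp add: weight_space_def Lmode_def)
  have high: "vmode V (conf V) (int i) b = 0" if "Suc h < i" for i
    using voa_Lmode_weight(2)[OF b, of "i - 1"] that by (simp add: Lmode_def)
  have "Lmode V M (int j) (mmode M b m x) - mmode M b m (Lmode V M (int j) x) = (\<Sum>i\<le>Suc j. ?F i)"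
    using mode_commutator[of "conf V" "Suc j" b m x] by (simp add: Lmode_def add.commute)
  \<comment> \<open>Enlarging the range adds vanishing binomial coefficients, cutting it at
    \<open>h + 1\<close> drops vectors of negative weight. The new range no longer depends on
    \<open>j\<close>.\<close>
  also have "\<dots> = (\<Sum>i\<in>{..Suc (Suc j + h)}. ?F i)"
    by (rule sum.mono_neutral_left) auto
  also have "\<dots> = (\<Sum>i\<in>{..Suc h}. ?F i)"
    by (rule sum.mono_neutral_right) (auto simp: high)
  also have "\<dots> = ?F 0 + ?F 1 + (\<Sum>i=2..Suc h. ?F i)"
  proof -
    have "(\<Sum>i\<le>Suc h. F i) = F 0 + F 1 + (\<Sum>i=2..Suc h. F i)" for F :: "nat \<Rightarrow> 'm"
    proof -
      have "{..Suc h} = insert 0 (insert 1 {2..Suc h})" by auto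
      then show ?thesis by (simp add: add.assoc)
    qed
    then show ?thesis .
  qed
  also have "?F 0 = mscale M (- (of_int (m + int j) + 1)) (mmode M b (m + int j) x)"
    using mode_derivative[of b "int (Suc j) + m" x] by (simp add: Lmode_def algebra_simps)
  also have "?F 1 = mscale M ((of_nat j + 1) * of_nat h) (mmode M b (m + int j) x)"
    by (simp add: b0 mode_scale_left algebra_simps)
  also have "(\<Sum>i=2..Suc h. ?F i) = (\<Sum>q=1..h. mscale M (of_nat (Suc j choose Suc q)) (mmode M (Lmode V (adjoint_mod V) (int q) b) (m + int j - int q) x))"
    by (rule sum.reindex_bij_witness[of _ Suc "\<lambda>i. i - 1"]) (auto simp: Lmode_def algebra_simps simp del: binomial_Suc_Suc)
  finally show ?thesis
    unfolding add.commute[of "mscale M (- _) _"] msp.scale_left_distrib[symmetric] by simp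
qed

text \<open>The weight \<open>h\<close> is a parameter instead of being read off from
  \<open>b\<close>, which makes this linear in an arbitrary \<open>b\<close>.\<close>

definition hom_square_mode :: "nat \<Rightarrow> 'v \<Rightarrow> int \<Rightarrow> 'm \<Rightarrow> 'm" where
  "hom_square_mode h b n u = Sum_any (\<lambda>m. mscale M (square_coeff h m n) (mmode M b m u))"

lemma hom_square_mode_eq:
  assumes "\<And>m. m > B \<Longrightarrow> mmode M b m u = 0"
  shows "hom_square_mode h b n u = (\<Sum>m=n..B. mscale M (square_coeff h m n) (mmode M b m u))"
  unfolding hom_square_mode_def
proof (rule Sum_any_eq_sum)
  fix m assume "m \<notin> {n..B}"
  then show "mscale M (square_coeff h m n) (mmode M b m u) = 0"
    using assms[of m] square_coeff_eq_0[of m n h] by (cases "m < n") auto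
qed simp

lemma mode_truncation_finite:
  assumes "finite I"
  shows "\<exists>B. \<forall>i\<in>I. \<forall>n>B. mmode M (a i) n (x i) = 0"
  using assms
proof (induction I rule: finite_induct)
  case (insert i I)
  obtain B where B: "\<forall>i\<in>I. \<forall>n>B. mmode M (a i) n (x i) = 0" using insert.IH by blast
  obtain C where C: "\<forall>n\<ge>C. mmode M (a i) n (x i) = 0" using mode_truncation by blast
  show ?case by (rule exI[of _ "max B C"]) (use B C in auto)
qed simp

lemma hom_square_mode_add: "hom_square_mode h b n (u + w) = hom_square_mode h b n u + hom_square_mode h b n w"
proof -
  obtain B where "\<forall>i\<in>{True, False}. \<forall>m>B. mmode M b m (if i then u else w) = 0"
    using mode_truncation_finite[of "{True, False}" "\<lambda>_. b" "\<lambda>i. if i then u else w"] by auto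
  then have B: "mmode M b m u = 0" "mmode M b m w = 0" if "m > B" for m using that by auto
  show ?thesis
    by (subst (1 2 3) hom_square_mode_eq[of B])
      (auto simp: B mode_add msp.scale_right_distrib sum.distrib)
qed

lemma hom_square_mode_scale: "hom_square_mode h b n (mscale M c u) = mscale M c (hom_square_mode h b n u)"
proof -
  obtain B where B: "\<forall>m\<ge>B. mmode M b m u = 0" using mode_truncation by blast
  show ?thesis
    by (subst (1 2) hom_square_mode_eq[of B])
      (use B in \<open>auto simp: mode_scale msp.scale_sum_right mult.commute\<close>)
qed

lemma hom_square_mode_add_left: "hom_square_mode h (a + b) n u = hom_square_mode h a n u + hom_square_mode h b n u"
proof -
  obtain B where "\<forall>i\<in>{True, False}. \<forall>m>B. mmode M (if i then a else b) m u = 0"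
    using mode_truncation_finite[of "{True, False}" "\<lambda>i. if i then a else b" "\<lambda>_. u"] by auto
  then have B: "mmode M a m u = 0" "mmode M b m u = 0" if "m > B" for m using that by auto
  show ?thesis
    by (subst (1 2 3) hom_square_mode_eq[of B])
      (auto simp: B mode_add_left msp.scale_right_distrib sum.distrib)
qed

lemma hom_square_mode_scale_left: "hom_square_mode h (vscale V c b) n u = mscale M c (hom_square_mode h b n u)"
proof -
  obtain B where B: "\<forall>m\<ge>B. mmode M b m u = 0" using mode_truncation by blast
  show ?thesis
    by (subst (1 2) hom_square_mode_eq[of B])
      (use B in \<open>auto simp: mode_scale_left msp.scale_sum_right mult.commute\<close>)
qed

lemma hom_square_mode_zero_left [simp]: "hom_square_mode h 0 n u = 0"
  using hom_square_mode_scale_left[of h 0 0 n u] by simp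

lemma hom_square_mode_truncation: "\<exists>N. \<forall>n\<ge>N. hom_square_mode h b n u = 0"
proof -
  obtain B where B: "\<forall>m\<ge>B. mmode M b m u = 0" using mode_truncation by blast
  have "hom_square_mode h b n u = 0" if "n \<ge> B + 1" for n
    by (subst hom_square_mode_eq[of B]) (use B that in auto)
  then show ?thesis by blast
qed

lemma square_mode_eq_Sum_any: "square_mode V M a n u = Sum_any (\<lambda>w. hom_square_mode w (pieces.component w a) n u)"
  by (simp add: square_mode_def hom_square_mode_def voa_component_eq)

lemma square_mode_eq_sum: "square_mode V M a n u = (\<Sum>w | pieces.component w a \<noteq> 0. hom_square_mode w (pieces.component w a) n u)"
  unfolding square_mode_eq_Sum_any by (rule Sum_any_eq_sum[OF pieces.finite_component]) simp

lemma square_mode_homogeneous: "b \<in> voa_piece V h \<Longrightarrow> square_mode V M b n u = hom_square_mode h b n u"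
  unfolding square_mode_eq_Sum_any
  by (subst Sum_any_eq_sum[of "{h}"]) (auto simp: pieces.component_single)

lemma square_mode_add: "square_mode V M a n (u + w) = square_mode V M a n u + square_mode V M a n w"
  by (simp add: square_mode_eq_sum hom_square_mode_add sum.distrib)

lemma square_mode_scale: "square_mode V M a n (mscale M c u) = mscale M c (square_mode V M a n u)"
  by (simp add: square_mode_eq_sum hom_square_mode_scale msp.scale_sum_right)

lemma square_mode_add_left: "square_mode V M (a + b) n u = square_mode V M a n u + square_mode V M b n u"
proof -
  have fin: "finite {w. hom_square_mode w (pieces.component w a) n u \<noteq> 0}" for a
    by (rule finite_subset[OF _ pieces.finite_component[of a]]) auto
  show ?thesis
    unfolding square_mode_eq_Sum_any pieces.component_add hom_square_mode_add_left
    by (rule Sum_any.distrib[OF fin fin])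
qed

lemma square_mode_scale_left: "square_mode V M (vscale V c a) n u = mscale M c (square_mode V M a n u)"
proof -
  have "square_mode V M (vscale V c a) n u = (\<Sum>w | pieces.component w a \<noteq> 0. hom_square_mode w (pieces.component w (vscale V c a)) n u)"
    unfolding square_mode_eq_Sum_any
    by (rule Sum_any_eq_sum[OF pieces.finite_component]) (simp add: pieces.component_scale)
  then show ?thesis
    by (simp add: pieces.component_scale hom_square_mode_scale_left square_mode_eq_sum msp.scale_sum_right)
qed

lemma square_mode_zero_left: "square_mode V M 0 n u = 0"
  using square_mode_scale_left[of 0 0 n u] by simp

lemma square_mode_sum_left: "square_mode V M (\<Sum>i\<in>A. f i) n u = (\<Sum>i\<in>A. square_mode V M (f i) n u)"
  by (induction A rule: infinite_finite_induct) (simp_all add: square_mode_add_left square_mode_zero_left)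

lemma square_mode_truncation: "\<exists>N. \<forall>n\<ge>N. square_mode V M a n u = 0"
proof -
  have "\<exists>N. \<forall>n\<ge>N. (\<Sum>w\<in>I. hom_square_mode w (pieces.component w a) n u) = 0" if "finite I" for I
    using that
  proof (induction I rule: finite_induct)
    case (insert i I)
    obtain B where B: "\<forall>n\<ge>B. (\<Sum>w\<in>I. hom_square_mode w (pieces.component w a) n u) = 0" using insert.IH by blast
    obtain C where C: "\<forall>n\<ge>C. hom_square_mode i (pieces.component i a) n u = 0" using hom_square_mode_truncation by blast
    show ?case by (rule exI[of _ "max B C"]) (use B C insert.hyps in auto)
  qed simp
  from this[OF pieces.finite_component[of a]] show ?thesis by (simp only: square_mode_eq_sum)
qed

section \<open>The operator \<open>L[0]\<close> and its commutator with square modes\<close>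

lemma Lmode_truncation: "\<exists>J::nat. \<forall>j>J. Lmode V M (int j) u = 0"
proof -
  obtain B where B: "\<forall>m\<ge>B. mmode M (conf V) m u = 0" using mode_truncation by blast
  show ?thesis by (rule exI[of _ "nat B"]) (use B in \<open>auto simp: Lmode_def\<close>)
qed

text \<open>Only modes of index at least 1 occur in a square mode of index 1. This removes the
  vacuum part of the shifted conformal vector and all \<open>L(j)\<close> with
  \<open>j < 0\<close>.\<close>

lemma square_L_0_eq:
  assumes "\<And>j. j > J \<Longrightarrow> Lmode V M (int j) u = 0"
  shows "square_L V M 0 u = (\<Sum>j\<le>J. mscale M (log_coeffs $ j) (Lmode V M (int j) u))"
proof -
  have vac: "vac V \<in> voa_piece V 0" using voa by (simp add: vertex_operator_algebra_def)
  have "square_L V M 0 u = square_mode V M (conf V + vscale V (- (charge V / 24)) (vac V)) 1 u"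
    by (simp add: square_L_def)
  also have "\<dots> = hom_square_mode 2 (conf V) 1 u + mscale M (- (charge V / 24)) (hom_square_mode 0 (vac V) 1 u)"
    using conf_weight vac by (simp only: square_mode_add_left square_mode_scale_left square_mode_homogeneous)
  also have "hom_square_mode 0 (vac V) 1 u = 0"
    by (subst hom_square_mode_eq[of 0]) (auto simp: mode_vac)
  also have "hom_square_mode 2 (conf V) 1 u = (\<Sum>m=1..int J + 1. mscale M (square_coeff 2 m 1) (mmode M (conf V) m u))"
  proof (rule hom_square_mode_eq)
    fix m assume "m > int J + 1"
    then show "mmode M (conf V) m u = 0" using assms[of "nat (m - 1)"] by (simp add: Lmode_def)
  qed
  also have "\<dots> = (\<Sum>j\<le>J. mscale M (log_coeffs $ j) (Lmode V M (int j) u))"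
    by (rule sum.reindex_bij_witness[of _ "\<lambda>j. int j + 1" "\<lambda>m. nat (m - 1)"]) (auto simp: Lmode_def log_coeffs_def)
  finally show ?thesis by simp
qed

lemma square_L_add: "square_L V M n (u + w) = square_L V M n u + square_L V M n w"
  and square_L_scale: "square_L V M n (mscale M c u) = mscale M c (square_L V M n u)"
  by (simp_all add: square_L_def square_mode_add square_mode_scale)

text \<open>The shifted summation interval may be moved back: at its lower end the coefficients
  vanish by triangularity, at its upper end the modes do.\<close>

lemma sum_square_coeff_shift:
  assumes "\<And>p. p > B \<Longrightarrow> \<phi> p = 0"
  shows "(\<Sum>m=n..B. mscale M (square_coeff h m n) (\<phi> (m + int d))) = (\<Sum>p=n..B. mscale M (square_coeff h (p - int d) n) (\<phi> p))"
proof -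
  have "(\<Sum>m=n..B. mscale M (square_coeff h m n) (\<phi> (m + int d)))
      = (\<Sum>p=n+int d..B+int d. mscale M (square_coeff h (p - int d) n) (\<phi> p))"
    by (rule sum.reindex_bij_witness[of _ "\<lambda>p. p - int d" "\<lambda>m. m + int d"]) auto
  also have "\<dots> = (\<Sum>p=n..B+int d. mscale M (square_coeff h (p - int d) n) (\<phi> p))"
    by (rule sum.mono_neutral_left) (auto simp: square_coeff_eq_0)
  also have "\<dots> = (\<Sum>p=n..B. mscale M (square_coeff h (p - int d) n) (\<phi> p))"
    by (rule sum.mono_neutral_right) (auto simp: assms)
  finally show ?thesis .
qed

lemma log_coeffs_0: "log_coeffs $ 0 = 1"
  using square_coeff_2_1[of 0] by (simp add: log_coeffs_def fps_ln_nth)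

text \<open>\<open>L[0] b\<close> is not homogeneous: its part from \<open>L(q) b\<close> has weight
  \<open>h - q\<close> and enters with the square coefficients of that weight.\<close>

lemma square_L_0_homogeneous:
  assumes "b \<in> voa_piece V h"
  shows "square_mode V M (square_L V (adjoint_mod V) 0 b) n u
    = mscale M (of_nat h) (hom_square_mode h b n u) +
      (\<Sum>q=1..h. mscale M (log_coeffs $ q) (hom_square_mode (h - q) (Lmode V (adjoint_mod V) (int q) b) n u))"
proof -
  interpret adj: voa_rep V "adjoint_mod V" by (rule voa_rep_adjoint[OF voa])
  have "square_L V (adjoint_mod V) 0 b = (\<Sum>q\<le>h. vscale V (log_coeffs $ q) (Lmode V (adjoint_mod V) (int q) b))"
    using adj.square_L_0_eq[of h b] voa_Lmode_weight(2)[OF assms] by simp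
  then have "square_mode V M (square_L V (adjoint_mod V) 0 b) n u
     = (\<Sum>q\<le>h. mscale M (log_coeffs $ q) (square_mode V M (Lmode V (adjoint_mod V) (int q) b) n u))"
    by (simp add: square_mode_sum_left square_mode_scale_left)
  also have "\<dots> = (\<Sum>q\<le>h. mscale M (log_coeffs $ q) (hom_square_mode (h - q) (Lmode V (adjoint_mod V) (int q) b) n u))"
    by (intro sum.cong refl) (simp add: square_mode_homogeneous[OF voa_Lmode_weight(1)[OF assms]])
  also have "{..h} = insert 0 {1..h}" by auto
  finally show ?thesis
    using assms by (simp add: log_coeffs_0 weight_space_def hom_square_mode_scale_left)
qed

text \<open>The commutator is a double sum over the terms \<open>L(j)\<close> of \<open>L[0]\<close>
  and the modes \<open>m\<close> of \<open>b\<close>. Collected by the index of the resulting mode,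
  the terms with \<open>b\<close> form the first convolution identity and those with
  \<open>L(q) b\<close> the second.\<close>

lemma hom_square_mode_commutator:
  assumes b: "b \<in> voa_piece V h"
  shows "square_L V M 0 (hom_square_mode h b n u) - hom_square_mode h b n (square_L V M 0 u)
    = square_mode V M (square_L V (adjoint_mod V) 0 b) n u - mscale M (of_int n + 1) (hom_square_mode h b n u)"
proof -
  let ?Lb = "\<lambda>q. Lmode V (adjoint_mod V) (int q) b"
  obtain J0 :: nat where J0: "\<And>j. j > J0 \<Longrightarrow> Lmode V M (int j) u = 0"
    using Lmode_truncation[of u] by blast
  obtain B1 where B1: "\<And>m. m \<ge> B1 \<Longrightarrow> mmode M b m u = 0" using mode_truncation by blast
  obtain B2 where B2: "\<forall>j\<in>{..J0}. \<forall>m>B2. mmode M b m (Lmode V M (int j) u) = 0"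
    using mode_truncation_finite[of "{..J0}" "\<lambda>_. b" "\<lambda>j. Lmode V M (int j) u"] by auto
  obtain B3 where B3: "\<forall>q\<in>{..h}. \<forall>m>B3. mmode M (?Lb q) m u = 0"
    using mode_truncation_finite[of "{..h}" ?Lb "\<lambda>_. u"] by auto
  define B where "B = max B1 (max B2 B3)"
  have Bu: "mmode M b m u = 0" if "m > B" for m using B1 that by (simp add: B_def)
  have BL: "mmode M b m (Lmode V M (int j) u) = 0" if "m > B" for m j
    using B2 J0[of j] that by (cases "j \<le> J0") (auto simp: B_def)
  have Bq: "mmode M (?Lb q) m u = 0" if "m > B" "q \<le> h" for m q
    using B3 that by (auto simp: B_def)
  have "\<exists>J. \<forall>m\<in>{n..B}. \<forall>j>J. mmode M (conf V) j (mmode M b m u) = 0"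
    using mode_truncation_finite[of "{n..B}" "\<lambda>_. conf V" "\<lambda>m. mmode M b m u"] by auto
  then obtain J1 where J1: "\<forall>m\<in>{n..B}. \<forall>j>J1. mmode M (conf V) j (mmode M b m u) = 0" by blast
  \<comment> \<open>Beyond \<open>J\<close> the operators \<open>L(j)\<close> kill \<open>u\<close>
    and every mode of \<open>b\<close> on \<open>u\<close> in the range. The last entry supplies the
    bound \<open>p - n + q \<le> J\<close> required by the convolution identities.\<close>
  define J where "J = max J0 (max (nat J1) (nat (B - n) + h))"
  have Ju: "Lmode V M (int j) u = 0" if "j > J" for j using J0 that by (simp add: J_def)
  have Jb: "Lmode V M (int j) (mmode M b m u) = 0" if "j > J" "m \<in> {n..B}" for j m
    using J1 that by (auto simp: J_def Lmode_def)
  have JK: "p - n + int q \<le> int J" if "p \<le> B" "q \<le> h" for p q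
    using that unfolding J_def by linarith
  let ?s = "\<lambda>m. square_coeff h m n"
  let ?c = "\<lambda>j. log_coeffs $ j"
  have hu: "hom_square_mode h b n u = (\<Sum>m=n..B. mscale M (?s m) (mmode M b m u))"
    by (rule hom_square_mode_eq) (rule Bu)
  have L1: "square_L V M 0 (hom_square_mode h b n u)
     = (\<Sum>j\<le>J. mscale M (?c j) (\<Sum>m=n..B. mscale M (?s m) (Lmode V M (int j) (mmode M b m u))))"
  proof -
    have "Lmode V M (int j) (hom_square_mode h b n u) = (\<Sum>m=n..B. mscale M (?s m) (Lmode V M (int j) (mmode M b m u)))" for j
      unfolding hu by (simp add: Lmode_sum Lmode_scale)
    then show ?thesis
      by (subst square_L_0_eq[of J]) (auto simp: Jb)
  qed
  have L2: "hom_square_mode h b n (square_L V M 0 u)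
     = (\<Sum>j\<le>J. mscale M (?c j) (\<Sum>m=n..B. mscale M (?s m) (mmode M b m (Lmode V M (int j) u))))"
  proof -
    have e: "mmode M b m (square_L V M 0 u) = (\<Sum>j\<le>J. mscale M (?c j) (mmode M b m (Lmode V M (int j) u)))" for m
      by (subst square_L_0_eq[of J]) (auto simp: Ju mode_sum mode_scale)
    have "hom_square_mode h b n (square_L V M 0 u) = (\<Sum>m=n..B. mscale M (?s m) (mmode M b m (square_L V M 0 u)))"
      by (rule hom_square_mode_eq) (simp add: e BL)
    also have "\<dots> = (\<Sum>m=n..B. \<Sum>j\<le>J. mscale M (?c j) (mscale M (?s m) (mmode M b m (Lmode V M (int j) u))))"
      by (simp add: e msp.scale_sum_right mult.commute)
    also have "\<dots> = (\<Sum>j\<le>J. \<Sum>m=n..B. mscale M (?c j) (mscale M (?s m) (mmode M b m (Lmode V M (int j) u))))"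
      by (rule sum.swap)
    finally show ?thesis by (simp only: msp.scale_sum_right)
  qed
  define f where "f j p = mscale M ((of_nat j + 1) * of_nat h - (of_int p + 1)) (mmode M b p u)" for j p
  define g where "g q j p = mscale M (of_nat (Suc j choose Suc q)) (mmode M (?Lb q) (p - int q) u)" for q j p
  have comm: "Lmode V M (int j) (mmode M b m u) - mmode M b m (Lmode V M (int j) u) = f j (m + int j) + (\<Sum>q=1..h. g q j (m + int j))" for j m
    unfolding f_def g_def by (rule Lmode_mode_commutator[OF b])
  have "square_L V M 0 (hom_square_mode h b n u) - hom_square_mode h b n (square_L V M 0 u)
     = (\<Sum>j\<le>J. mscale M (?c j) (\<Sum>m=n..B. mscale M (?s m) (f j (m + int j) + (\<Sum>q=1..h. g q j (m + int j)))))"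
    unfolding L1 L2 sum_subtractf[symmetric] msp.scale_right_diff_distrib[symmetric] comm ..
  also have "\<dots> = (\<Sum>j\<le>J. mscale M (?c j) (\<Sum>m=n..B. mscale M (?s m) (f j (m + int j))))
     + (\<Sum>j\<le>J. mscale M (?c j) (\<Sum>m=n..B. \<Sum>q=1..h. mscale M (?s m) (g q j (m + int j))))"
    by (simp only: msp.scale_right_distrib sum.distrib msp.scale_sum_right)
  also have "(\<Sum>j\<le>J. mscale M (?c j) (\<Sum>m=n..B. mscale M (?s m) (f j (m + int j))))
     = mscale M (of_nat h - of_int n - 1) (hom_square_mode h b n u)"
  proof -
    have "(\<Sum>j\<le>J. mscale M (?c j) (\<Sum>m=n..B. mscale M (?s m) (f j (m + int j))))
       = (\<Sum>j\<le>J. mscale M (?c j) (\<Sum>p=n..B. mscale M (?s (p - int j)) (f j p)))"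
      by (intro sum.cong refl arg_cong[where f = "mscale M _"] sum_square_coeff_shift) (simp add: f_def Bu)
    also have "\<dots> = (\<Sum>p=n..B. mscale M (\<Sum>j\<le>J. ?c j * ?s (p - int j) * ((of_nat j + 1) * of_nat h - (of_int p + 1))) (mmode M b p u))"
      unfolding msp.scale_sum_right f_def msp.scale_scale msp.scale_sum_left mult.assoc[symmetric] by (rule sum.swap)
    also have "\<dots> = (\<Sum>p=n..B. mscale M ((of_nat h - of_int n - 1) * ?s p) (mmode M b p u))"
    proof (intro sum.cong refl arg_cong2[where f = "mscale M"] square_coeff_convolution_deriv)
      fix p assume "p \<in> {n..B}" then show "p - n \<le> int J" using JK[of p 0] by simp
    qed
    finally show ?thesis unfolding hu by (simp only: msp.scale_sum_right msp.scale_scale)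
  qed
  also have "(\<Sum>j\<le>J. mscale M (?c j) (\<Sum>m=n..B. \<Sum>q=1..h. mscale M (?s m) (g q j (m + int j))))
     = (\<Sum>q=1..h. mscale M (?c q) (hom_square_mode (h - q) (?Lb q) n u))"
  proof -
    have gz: "g q j p = 0" if "p - int q > B" "q \<le> h" for q j p using Bq[OF that] by (simp add: g_def)
    have shift: "(\<Sum>m=n..B. mscale M (?s m) (g q j (m + int j))) =
        (\<Sum>p=n..B. mscale M (?s (p - int j + int q)) (g q j (p + int q)))" if "q \<in> {1..h}" for q j
    proof (cases "q \<le> j")
      case True
      have "(\<Sum>m=n..B. mscale M (?s m) (g q j (m + int j))) = (\<Sum>m=n..B. mscale M (?s m) ((\<lambda>p. g q j (p + int q)) (m + int (j - q))))"
        using True by (simp add: of_nat_diff)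
      also have "\<dots> = (\<Sum>p=n..B. mscale M (?s (p - int (j - q))) (g q j (p + int q)))"
        by (rule sum_square_coeff_shift) (use gz that in auto)
      finally show ?thesis using True by (simp add: of_nat_diff algebra_simps)
    next
      case False
      then have "g q j p = 0" for p by (simp add: g_def del: binomial_Suc_Suc)
      then show ?thesis by simp
    qed
    have "(\<Sum>j\<le>J. mscale M (?c j) (\<Sum>m=n..B. \<Sum>q=1..h. mscale M (?s m) (g q j (m + int j))))
      = (\<Sum>j\<le>J. \<Sum>q=1..h. mscale M (?c j) (\<Sum>m=n..B. mscale M (?s m) (g q j (m + int j))))"
      by (subst sum.swap) (simp only: msp.scale_sum_right)
    also have "\<dots> = (\<Sum>q=1..h. \<Sum>j\<le>J. mscale M (?c j) (\<Sum>p=n..B. mscale M (?s (p - int j + int q)) (g q j (p + int q))))"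
      by (subst sum.swap) (intro sum.cong refl, simp add: shift)
    also have "\<dots> = (\<Sum>q=1..h. mscale M (?c q) (hom_square_mode (h - q) (?Lb q) n u))"
    proof (rule sum.cong[OF refl])
      fix q assume q: "q \<in> {1..h}"
      have "(\<Sum>j\<le>J. mscale M (?c j) (\<Sum>p=n..B. mscale M (?s (p - int j + int q)) (g q j (p + int q))))
        = (\<Sum>p=n..B. mscale M (\<Sum>j\<le>J. ?c j * (of_nat (Suc j) gchoose Suc q) * ?s (p - int j + int q)) (mmode M (?Lb q) p u))"
        unfolding msp.scale_sum_right g_def msp.scale_scale msp.scale_sum_left
        by (subst sum.swap) (intro sum.cong refl, simp add: binomial_gbinomial[symmetric] mult_ac del: binomial_Suc_Suc of_nat_Suc)
      also have "\<dots> = (\<Sum>p=n..B. mscale M (?c q * square_coeff (h - q) p n) (mmode M (?Lb q) p u))"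
      proof (intro sum.cong refl arg_cong2[where f = "mscale M"] square_coeff_convolution_binomial)
        fix p assume "p \<in> {n..B}" then show "p - n + int q \<le> int J" using JK[of p q] q by simp
      qed (use q in auto)
      also have "\<dots> = mscale M (?c q) (\<Sum>p=n..B. mscale M (square_coeff (h - q) p n) (mmode M (?Lb q) p u))"
        by (simp only: msp.scale_sum_right msp.scale_scale)
      also have "\<dots> = mscale M (?c q) (hom_square_mode (h - q) (?Lb q) n u)"
        by (subst hom_square_mode_eq[of B]) (use Bq q in auto)
      finally show "(\<Sum>j\<le>J. mscale M (?c j) (\<Sum>p=n..B. mscale M (?s (p - int j + int q)) (g q j (p + int q))))
        = mscale M (?c q) (hom_square_mode (h - q) (?Lb q) n u)" .
    qed
    finally show ?thesis .
  qed
  \<comment> \<open>The factor \<open>h - n - 1\<close> is split: \<open>h\<close> joins the sum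
    over \<open>q\<close> to form \<open>L[0] b\<close>, leaving \<open>- (n + 1)\<close>.\<close>
  finally show ?thesis
    unfolding square_L_0_homogeneous[OF b] by (simp add: msp.scale_left_diff_distrib msp.scale_left_distrib)
qed

lemma square_L_0_mode:
  "square_L V M 0 (square_mode V M a n u) = square_mode V M (square_L V (adjoint_mod V) 0 a) n u
     + square_mode V M a n (square_L V M 0 u) - mscale M (of_int n + 1) (square_mode V M a n u)"
proof (induction a rule: pieces.graded_induct)
  case (piece h b)
  show ?case
    using hom_square_mode_commutator[OF piece, of n u] by (simp add: square_mode_homogeneous[OF piece] algebra_simps)
next
  case (add a b)
  interpret adj: voa_rep V "adjoint_mod V" by (rule voa_rep_adjoint[OF voa])
  show ?case
    by (simp add: square_mode_add_left adj.square_L_add square_L_add msp.scale_right_distrib add)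
qed

lemma square_mode_weight:
  assumes "a \<in> square_weight_space V (adjoint_mod V) \<alpha>" "u \<in> square_weight_space V M \<beta>"
  shows "square_mode V M a n u \<in> square_weight_space V M (\<beta> + \<alpha> - of_int n - 1)"
  using assms square_L_0_mode[of a n u]
  by (simp add: square_weight_space_def square_mode_scale square_mode_scale_left algebra_simps
      flip: msp.scale_left_distrib msp.scale_left_diff_distrib)

text \<open>The shift by \<open>c/24\<close> is forced. \<open>L(2)\<close> sends the conformal
  vector to \<open>c/2\<close> times the vacuum and enters \<open>L[0]\<close> with coefficient
  \<open>-1/6\<close>, which gives the defect \<open>- c/12\<close>; the vacuum has square weight 0,
  so subtracting \<open>c/24\<close> times it restores the eigenvalue 2.\<close>

lemma square_conf_weight:
  "conf V - vscale V (charge V / 24) (vac V) \<in> square_weight_space V (adjoint_mod V) 2"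
proof -
  interpret adj: voa_rep V "adjoint_mod V" by (rule voa_rep_adjoint[OF voa])
  let ?L = "Lmode V (adjoint_mod V)"
  have vir: "?L m (?L n x) - ?L n (?L m x) = vscale V (of_int (m - n)) (?L (m + n) x) +
        (if m + n = 0 then vscale V (of_int (m ^ 3 - m) / 12 * charge V) x else 0)" for m n x
    using voa unfolding vertex_operator_algebra_def Let_def by blast
  have vac: "vmode V v (-1) (vac V) = v" "n \<ge> 0 \<Longrightarrow> vmode V v n (vac V) = 0" for v n
    using voa by (simp_all add: vertex_operator_algebra_def)
  have Lvac: "?L n (vac V) = 0" if "n \<ge> -1" for n using that vac(2) by (simp add: Lmode_def)
  have L0: "?L 0 (conf V) = vscale V 2 (conf V)"
    using vir[of 0 "-2" "vac V"] Lvac[of 0] adj.Lmode_scale[of "-2" 0 0] by (simp add: vac(1) Lmode_def)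
  have L1: "?L 1 (conf V) = 0"
    using vir[of 1 "-2" "vac V"] Lvac[of 1] Lvac[of "-1"] adj.Lmode_scale[of "-2" 0 0] by (simp add: vac(1) Lmode_def)
  have L2: "?L 2 (conf V) = vscale V (charge V / 2) (vac V)"
    using vir[of 2 "-2" "vac V"] Lvac[of 2] Lvac[of 0] adj.Lmode_scale[of "-2" 0 0] by (simp add: vac(1) Lmode_def)
  have "square_L V (adjoint_mod V) 0 (conf V) = (\<Sum>j\<le>2. vscale V (log_coeffs $ j) (?L (int j) (conf V)))"
    using adj.square_L_0_eq[of 2 "conf V"] voa_Lmode_weight(2)[of "conf V" 2] conf_weight by simp
  also have "\<dots> = vscale V 2 (conf V) - vscale V (charge V / 12) (vac V)"
    by (simp add: numeral_2_eq_2 log_coeffs_0 L0 L1[simplified] L2[unfolded numeral_2_eq_2, simplified] log_coeffs_nth[of 2, unfolded numeral_2_eq_2])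
  finally have c: "square_L V (adjoint_mod V) 0 (conf V) = vscale V 2 (conf V) - vscale V (charge V / 12) (vac V)" .
  have v: "square_L V (adjoint_mod V) 0 (vac V) = 0"
    using adj.square_L_0_eq[of 0 "vac V"] Lvac by simp
  have "square_L V (adjoint_mod V) 0 (conf V + vscale V (- (charge V / 24)) (vac V)) = vscale V 2 (conf V - vscale V (charge V / 24) (vac V))"
    using adj.square_L_scale[of 0 "- (charge V / 24)" "vac V"]
    by (simp only: adj.square_L_add c v) (simp add: vsp.scale_right_diff_distrib)
  then show ?thesis by (simp add: square_weight_space_def)
qed

lemma square_L_weight:
  "u \<in> square_weight_space V M \<beta> \<Longrightarrow> square_L V M n u \<in> square_weight_space V M (\<beta> - of_int n)"
  using square_mode_weight[OF square_conf_weight, of u \<beta> "n + 1"] by (simp add: square_L_def algebra_simps)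

text \<open>\<open>L[0] - L(0)\<close> strictly lowers the weight. By induction, a vector of weight
  \<open>\<rho> + j\<close> becomes an \<open>L[0]\<close>-eigenvector after subtracting a vector
  from the earlier eigenspaces, on whose span \<open>L[0] - (\<rho> + j)\<close> is
  invertible.\<close>

lemma square_weight_spaces_span:
  assumes span: "msp.span (\<Union>j::nat. weight_space V M (\<rho> + of_nat j)) = UNIV"
  shows "msp.span (\<Union>j::nat. square_weight_space V M (\<rho> + of_nat j)) = UNIV"
proof -
  let ?E = "\<lambda>i. square_weight_space V M (\<rho> + of_nat i)"
  \<comment> \<open>No weights lie below \<open>\<rho>\<close>, so on weight
    \<open>\<rho> + j\<close> the sum for \<open>L[0]\<close> ends with \<open>L(j)\<close>.\<close>
  have low: "x = 0" if x: "x \<in> weight_space V M (\<rho> + of_nat j - of_nat q)" and "j < q" for x j q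
  proof (rule msp.eigenvector_eq_0[of "Lmode V M 0" "\<lambda>j. \<rho> + of_nat j"])
    show "msp.span (\<Union>i. {x. Lmode V M 0 x = mscale M (\<rho> + of_nat i) x}) = UNIV"
      using span by (simp add: weight_space_def)
    show "\<rho> + of_nat j - of_nat q \<notin> range (\<lambda>j. \<rho> + of_nat j)"
    proof
      assume "\<rho> + of_nat j - of_nat q \<in> range (\<lambda>j. \<rho> + of_nat j)"
      then obtain i where "(of_nat j :: complex) = of_nat (i + q)" by (auto simp: algebra_simps)
      then have "j = i + q" by (rule of_nat_eq_iff[THEN iffD1])
      with \<open>j < q\<close> show False by simp
    qed
  qed (use x in \<open>auto simp: Lmode_add Lmode_scale weight_space_def inj_on_def\<close>)
  have solve: "\<exists>z\<in>msp.span (\<Union>i<j. ?E i). square_L V M 0 z - mscale M (\<rho> + of_nat j) z = y"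
    if "y \<in> msp.span (\<Union>i<j. ?E i)" for y j
    using that
  proof (induction rule: msp.span_induct_alt)
    case base
    show ?case
      by (rule bexI[of _ 0]) (use square_L_scale[of 0 0 0] msp.span_zero in auto)
  next
    case (step c x y)
    then obtain i z where i: "i < j" "x \<in> ?E i" and z: "z \<in> msp.span (\<Union>i<j. ?E i)"
      "square_L V M 0 z - mscale M (\<rho> + of_nat j) z = y" by auto
    have ij: "(of_nat i - of_nat j :: complex) \<noteq> 0" using i by simp
    let ?w = "mscale M (c / (of_nat i - of_nat j)) x"
    have "square_L V M 0 ?w - mscale M (\<rho> + of_nat j) ?w = mscale M (c / (of_nat i - of_nat j) * (\<rho> + of_nat i)) x - mscale M ((\<rho> + of_nat j) * (c / (of_nat i - of_nat j))) x"
      using i by (simp add: square_L_scale square_weight_space_def)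
    also have "\<dots> = mscale M (c / (of_nat i - of_nat j) * (of_nat i - of_nat j)) x"
    proof -
      have "a * (\<rho> + of_nat i) - (\<rho> + of_nat j) * a = a * (of_nat i - of_nat j)" for a
        by (simp add: algebra_simps)
      then show ?thesis unfolding msp.scale_left_diff_distrib[symmetric] by (rule arg_cong)
    qed
    also have "\<dots> = mscale M c x" using ij by simp
    finally have w: "square_L V M 0 ?w - mscale M (\<rho> + of_nat j) ?w = mscale M c x" .
    have "?w \<in> msp.span (\<Union>i<j. ?E i)" using i by (intro msp.span_scale msp.span_base) auto
    then show ?case
      using z w by (intro bexI[of _ "?w + z"]) (auto simp: square_L_add msp.scale_right_distrib intro: msp.span_add)
  qed
  have mono: "msp.span (\<Union>i<j. ?E i) \<subseteq> msp.span (\<Union>i<k. ?E i)" if "j \<le> k" for j k :: nat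
    using that by (intro msp.span_mono UN_mono) auto
  have main: "x \<in> msp.span (\<Union>i<Suc j. ?E i)" if "x \<in> weight_space V M (\<rho> + of_nat j)" for x j
    using that
  proof (induction j arbitrary: x rule: less_induct)
    case (less j)
    have Lw: "Lmode V M (int q) x \<in> weight_space V M (\<rho> + of_nat j - of_nat q)" for q
      using Lmode_weight[OF less.prems, of "int q"] by simp
    have L0: "square_L V M 0 x = (\<Sum>q\<le>j. mscale M (log_coeffs $ q) (Lmode V M (int q) x))"
      by (rule square_L_0_eq) (rule low[OF Lw])
    also have "{..j} = insert 0 {1..j}" by auto
    finally have L0: "square_L V M 0 x = mscale M (\<rho> + of_nat j) x + (\<Sum>q=1..j. mscale M (log_coeffs $ q) (Lmode V M (int q) x))"
      using less.prems by (simp add: log_coeffs_0 weight_space_def)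
    have "(\<Sum>q=1..j. mscale M (log_coeffs $ q) (Lmode V M (int q) x)) \<in> msp.span (\<Union>i<j. ?E i)"
    proof (intro msp.span_sum msp.span_scale)
      fix q assume q: "q \<in> {1..j}"
      then have e: "\<rho> + of_nat j - of_nat q = \<rho> + of_nat (j - q)" by (simp add: of_nat_diff)
      have "Lmode V M (int q) x \<in> msp.span (\<Union>i<Suc (j - q). ?E i)"
        using Lw[of q] q unfolding e by (intro less.IH) auto
      then show "Lmode V M (int q) x \<in> msp.span (\<Union>i<j. ?E i)"
        using mono[of "Suc (j - q)" j] q by (metis Suc_diff_le Suc_le_D atLeastAtMost_iff diff_Suc_Suc diff_le_self subsetD One_nat_def)
    qed
    from solve[OF this] obtain z where z: "z \<in> msp.span (\<Union>i<j. ?E i)"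
      "square_L V M 0 z - mscale M (\<rho> + of_nat j) z = (\<Sum>q=1..j. mscale M (log_coeffs $ q) (Lmode V M (int q) x))" by blast
    have "square_L V M 0 (x - z) = mscale M (\<rho> + of_nat j) (x - z)"
    proof -
      have "square_L V M 0 x = square_L V M 0 (x - z) + square_L V M 0 z"
        using square_L_add[of 0 "x - z" z] by simp
      then show ?thesis using L0 z(2) by (simp add: msp.scale_right_diff_distrib algebra_simps)
    qed
    then have "x - z \<in> msp.span (\<Union>i<Suc j. ?E i)"
      by (intro msp.span_base) (auto simp: square_weight_space_def)
    moreover have "z \<in> msp.span (\<Union>i<Suc j. ?E i)" using z(1) mono[of j "Suc j"] by auto
    ultimately show ?case using msp.span_add[of "x - z" _ z] by simp
  qed
  have "(\<Union>j. weight_space V M (\<rho> + of_nat j)) \<subseteq> msp.span (\<Union>j. ?E j)"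
  proof
    fix x assume "x \<in> (\<Union>j. weight_space V M (\<rho> + of_nat j))"
    then obtain j where "x \<in> msp.span (\<Union>i<Suc j. ?E i)" using main by blast
    moreover have "msp.span (\<Union>i<Suc j. ?E i) \<subseteq> msp.span (\<Union>j. ?E j)" by (intro msp.span_mono) auto
    ultimately show "x \<in> msp.span (\<Union>j. ?E j)" by blast
  qed
  then have "msp.span (\<Union>j. weight_space V M (\<rho> + of_nat j)) \<subseteq> msp.span (\<Union>j. ?E j)"
    by (intro msp.span_minimal msp.subspace_span)
  then show ?thesis using span by auto
qed

end

section \<open>One point functions\<close>

context voa_rep
begin

text \<open>The pieces in \<open>voa_module\<close> carry unspecified \<open>L(0)\<close>-scalars,
  so the coset of weights comes from irreducibility: homogeneous modes shift weights by integers,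
  and the spaces in one coset span a nonzero submodule.\<close>

lemma irreducible_weights:
  assumes irr: "irreducible_module V M UNIV" and r: "is_weight V M r"
  shows "msp.span (\<Union>n::int. weight_space V M (r + of_int n)) = UNIV"
proof -
  let ?W = "\<Union>n::int. weight_space V M (r + of_int n)"
  let ?N = "msp.span ?W"
  have "mmode M v n x \<in> ?N" if "x \<in> ?N" for v n x
  proof (induction v rule: pieces.graded_induct)
    case (piece k v)
    from \<open>x \<in> ?N\<close> show ?case
    proof (induction rule: msp.span_induct_alt)
      case base
      show ?case using msp.span_zero by simp
    next
      case (step c x y)
      then obtain i :: int where "x \<in> weight_space V M (r + of_int i)" by auto
      from mode_weight[OF piece this, of n]
      have "mmode M v n x \<in> weight_space V M (r + of_int (i + int k - n - 1))" by (simp add: algebra_simps)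
      then have "mmode M v n x \<in> ?N" by (intro msp.span_base) blast
      with step show ?case by (simp add: mode_add mode_scale msp.span_add msp.span_scale)
    qed
  next
    case (add v w)
    then show ?case by (simp add: mode_add_left msp.span_add)
  qed
  then have "submodule M ?N UNIV" by (simp add: submodule_def msp.subspace_span)
  then have "?N = {0} \<or> ?N = UNIV" using irr by (simp add: irreducible_module_def)
  moreover obtain x where "x \<noteq> 0" "x \<in> weight_space V M r" using r by (auto simp: is_weight_def)
  then have "x \<in> weight_space V M (r + of_int 0)" by simp
  then have "x \<in> ?N" by (intro msp.span_base) blast
  ultimately show ?thesis using \<open>x \<noteq> 0\<close> by blast
qed

lemma irreducible_weights_above:
  assumes irr: "irreducible_module V M UNIV" and r: "is_weight V M r"
    and low: "\<And>r'. is_weight V M r' \<Longrightarrow> Re r \<le> Re r'"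
  shows "msp.span (\<Union>j::nat. weight_space V M (r + of_nat j)) = UNIV"
proof -
  let ?N = "msp.span (\<Union>j::nat. weight_space V M (r + of_nat j))"
  have "(\<Union>n::int. weight_space V M (r + of_int n)) \<subseteq> ?N"
  proof
    fix x assume "x \<in> (\<Union>n::int. weight_space V M (r + of_int n))"
    then obtain n :: int where x: "x \<in> weight_space V M (r + of_int n)" by blast
    show "x \<in> ?N"
    proof (cases "x = 0")
      case False
      then have "is_weight V M (r + of_int n)" using x by (auto simp: is_weight_def)
      from low[OF this] have "r + of_int n = r + of_nat (nat n)" by simp
      with x show ?thesis by (metis UN_I UNIV_I msp.span_base)
    qed (simp add: msp.span_zero)
  qed
  then have "msp.span (\<Union>n::int. weight_space V M (r + of_int n)) \<subseteq> ?N"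
    by (intro msp.span_minimal msp.subspace_span)
  then show ?thesis using irreducible_weights[OF irr r] by auto
qed

section \<open>The tensor space and the ring of modular forms\<close>

lemma pure_tensor_in_tensor_space: "f \<in> modular_ring \<Longrightarrow> pure_tensor M f u \<in> tensor_space M"
  unfolding tensor_space_def by (intro CollectI exI[of _ "1::nat"] exI[of _ "\<lambda>_. f"] exI[of _ "\<lambda>_. u"]) simp

lemma tensor_spaceI:
  fixes n :: nat
  assumes "\<forall>i<n. f i \<in> modular_ring" "\<And>\<tau>. x \<tau> = (\<Sum>i<n. pure_tensor M (f i) (u i) \<tau>)"
  shows "x \<in> tensor_space M"
  unfolding tensor_space_def
  by (intro CollectI exI[of _ n] exI[of _ f] exI[of _ u] conjI ext) (fact assms)+

lemma tensor_spaceE: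
  assumes "x \<in> tensor_space M"
  obtains n :: nat and f u where "\<forall>i<n. f i \<in> modular_ring" "x = (\<lambda>\<tau>. \<Sum>i<n. pure_tensor M (f i) (u i) \<tau>)"
  using assms unfolding tensor_space_def by (elim CollectE exE conjE) (rule that)

lemma tensor_space_add:
  assumes "x \<in> tensor_space M" "y \<in> tensor_space M"
  shows "(\<lambda>\<tau>. x \<tau> + y \<tau>) \<in> tensor_space M"
proof -
  obtain n :: nat and f u where x: "\<forall>i<n. f i \<in> modular_ring" "x = (\<lambda>\<tau>. \<Sum>i<n. pure_tensor M (f i) (u i) \<tau>)"
    by (rule tensor_spaceE[OF assms(1)])
  obtain m :: nat and g w where y: "\<forall>i<m. g i \<in> modular_ring" "y = (\<lambda>\<tau>. \<Sum>i<m. pure_tensor M (g i) (w i) \<tau>)"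
    by (rule tensor_spaceE[OF assms(2)])
  let ?h = "\<lambda>i. if i < n then f i else g (i - n)" and ?z = "\<lambda>i. if i < n then u i else w (i - n)"
  have "x \<tau> + y \<tau> = (\<Sum>i<n + m. pure_tensor M (?h i) (?z i) \<tau>)" for \<tau>
  proof -
    have e: "{..<n + m} = {..<n} \<union> {n..<n + m}" by auto
    have split: "(\<Sum>i<n + m. F i) = (\<Sum>i<n. F i) + (\<Sum>i=n..<n + m. F i)" for F :: "nat \<Rightarrow> 'm"
      unfolding e by (rule sum.union_disjoint) auto
    have "(\<Sum>i<n + m. pure_tensor M (?h i) (?z i) \<tau>) = (\<Sum>i<n. pure_tensor M (?h i) (?z i) \<tau>) + (\<Sum>i=n..<n + m. pure_tensor M (?h i) (?z i) \<tau>)"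
      by (subst split) simp
    also have "(\<Sum>i=n..<n + m. pure_tensor M (?h i) (?z i) \<tau>) = (\<Sum>i<m. pure_tensor M (g i) (w i) \<tau>)"
      by (rule sum.reindex_bij_witness[of _ "\<lambda>i. i + n" "\<lambda>i. i - n"]) auto
    finally show ?thesis by (simp add: x(2) y(2))
  qed
  moreover have "\<forall>i<n + m. ?h i \<in> modular_ring" using x(1) y(1) by auto
  ultimately show ?thesis by (intro tensor_spaceI[of "n + m" ?h _ ?z])
qed

lemma tensor_space_scale:
  assumes "x \<in> tensor_space M"
  shows "(\<lambda>\<tau>. mscale M a (x \<tau>)) \<in> tensor_space M"
proof -
  obtain n :: nat and f u where x: "\<forall>i<n. f i \<in> modular_ring" "x = (\<lambda>\<tau>. \<Sum>i<n. pure_tensor M (f i) (u i) \<tau>)"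
    by (rule tensor_spaceE[OF assms])
  have "mscale M a (x \<tau>) = (\<Sum>i<n. pure_tensor M (f i) (mscale M a (u i)) \<tau>)" for \<tau>
    by (simp add: x(2) pure_tensor_def msp.scale_sum_right mult.commute)
  with x(1) show ?thesis by (rule tensor_spaceI)
qed

lemma tensor_space_zero: "(\<lambda>\<tau>. 0) \<in> tensor_space M"
  unfolding tensor_space_def by (intro CollectI exI[of _ "0::nat"]) simp

lemma tensor_space_sum:
  "(\<And>i. i \<in> I \<Longrightarrow> x i \<in> tensor_space M) \<Longrightarrow> (\<lambda>\<tau>. \<Sum>i\<in>I. x i \<tau>) \<in> tensor_space M"
  by (induction I rule: infinite_finite_induct) (simp_all add: tensor_space_zero tensor_space_add)

end

lemma modular_form_in_ring: "f \<in> modular_forms k \<Longrightarrow> f \<in> modular_ring"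
  unfolding modular_ring_def by (intro CollectI exI[of _ "{k}"] exI[of _ "\<lambda>_. f"]) simp

lemma one_form_in_ring: "one_form \<in> modular_ring"
proof (rule modular_form_in_ring[of _ 0])
  have "one_form holomorphic_on uhp"
    by (rule holomorphic_transform[of "\<lambda>_. 1"]) (auto simp: one_form_def)
  then show "one_form \<in> modular_forms 0"
    using uhp_moebius by (auto simp: modular_forms_def one_form_def intro!: exI[of _ 1])
qed

lemma modular_ring_holomorphic: "f \<in> modular_ring \<Longrightarrow> f holomorphic_on uhp"
  unfolding modular_ring_def by (auto simp: modular_forms_def intro!: holomorphic_on_sum)

lemma eisenstein_E_in_ring: "2 \<le> k \<Longrightarrow> eisenstein_E (2 * k) \<in> modular_ring"
  by (rule modular_form_in_ring[OF eisenstein_E_modular_form]) simp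

section \<open>Gluing functionals along a grading\<close>

context graded_space
begin

definition extension :: "('i \<Rightarrow> 'm \<Rightarrow> complex) \<Rightarrow> 'm \<Rightarrow> complex" where
  "extension F v = Sum_any (\<lambda>i. F i (component i v))"

context
  fixes F :: "'i \<Rightarrow> 'm \<Rightarrow> complex"
  assumes F_add: "\<And>i x y. F i (x + y) = F i x + F i y" and F_scale: "\<And>i a x. F i (scale a x) = a * F i x"
begin

lemma extension_eq_sum: "extension F v = (\<Sum>i | component i v \<noteq> 0. F i (component i v))"
  unfolding extension_def using F_scale[of _ 0 0] by (intro Sum_any_eq_sum finite_component) auto

lemma extension_add: "extension F (x + y) = extension F x + extension F y"
proof -
  have fin: "finite {i. F i (component i x) \<noteq> 0}" for x
    using F_scale[of _ 0 0] by (intro finite_subset[OF _ finite_component[of x]]) auto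
  show ?thesis unfolding extension_def component_add F_add by (rule Sum_any.distrib[OF fin fin])
qed

lemma extension_scale: "extension F (scale a x) = a * extension F x"
proof -
  have "extension F (scale a x) = (\<Sum>i | component i x \<noteq> 0. F i (component i (scale a x)))"
    unfolding extension_def using F_scale[of _ 0 0] by (intro Sum_any_eq_sum finite_component) (auto simp: component_scale)
  then show ?thesis by (simp add: component_scale F_scale extension_eq_sum sum_distrib_left)
qed

lemma extension_piece: "x \<in> N i \<Longrightarrow> extension F x = F i x"
  unfolding extension_def using F_scale[of _ 0 0]
  by (subst Sum_any_eq_sum[of "{i}"]) (auto simp: component_single)

end

end

text \<open>Irreducibility and the lowest weight enter this locale through
  \<open>square_span\<close>.\<close>

locale one_point = voa_rep V U
  for V :: "'v::ab_group_add voa" and U :: "('v, 'u::ab_group_add) vmod" +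
  fixes t :: real and S :: "(complex \<Rightarrow> 'u) \<Rightarrow> complex \<Rightarrow> complex"
  assumes square_span: "msp.span (\<Union>n::int. square_weight_space V U (of_real t + of_int n)) = UNIV"
    and S: "S \<in> one_point_functions V U"
begin

sublocale usq: graded_space "mscale U" "\<lambda>n::int. square_weight_space V U (of_real t + of_int n)"
  unfolding square_weight_space_def
  by unfold_locales (rule msp.eigenspaces_direct_sum,
    use square_span in \<open>auto simp: square_L_add square_L_scale square_weight_space_def inj_on_def\<close>)

sublocale vsq: graded_space "vscale V" "\<lambda>n::nat. square_weight_space V (adjoint_mod V) (of_nat n)"
proof -
  interpret adj: voa_rep V "adjoint_mod V" by (rule voa_rep_adjoint[OF voa])
  have "vsp.span (\<Union>j::nat. square_weight_space V (adjoint_mod V) (0 + of_nat j)) = UNIV"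
    using adj.square_weight_spaces_span[of 0] pieces.span_pieces by simp
  then have "direct_sum (vscale V) UNIV (\<lambda>i::nat. {x. square_L V (adjoint_mod V) 0 x = vscale V (of_nat i) x}) UNIV"
    using adj.square_L_add adj.square_L_scale
    by (intro vsp.eigenspaces_direct_sum) (auto simp: square_weight_space_def inj_of_nat)
  then show "graded_space (vscale V) (\<lambda>n::nat. square_weight_space V (adjoint_mod V) (of_nat n))"
    by unfold_locales (simp add: square_weight_space_def)
qed

lemma S_linear: "modular_linear U S"
  and S_holomorphic: "x \<in> tensor_space U \<Longrightarrow> S x holomorphic_on uhp"
  and S_Oq: "x \<in> Oq V U \<Longrightarrow> \<tau> \<in> uhp \<Longrightarrow> S x \<tau> = 0"
  using S by (auto simp: one_point_functions_def)

definition fiber :: "complex \<Rightarrow> 'u \<Rightarrow> complex" where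
  "fiber \<tau> u = S (tensor_one U u) \<tau>"

lemma tensor_one_add: "tensor_one U (u + w) = (\<lambda>\<sigma>. tensor_one U u \<sigma> + tensor_one U w \<sigma>)"
  and tensor_one_scale: "tensor_one U (mscale U a u) = (\<lambda>\<sigma>. mscale U a (tensor_one U u \<sigma>))"
  by (simp_all add: pure_tensor_def msp.scale_right_distrib mult.commute)

lemma modular_linear_tensor_one:
  assumes "modular_linear U S'" "\<tau> \<in> uhp"
  shows "S' (tensor_one U (u + w)) \<tau> = S' (tensor_one U u) \<tau> + S' (tensor_one U w) \<tau>"
    and "S' (tensor_one U (mscale U a u)) \<tau> = a * S' (tensor_one U u) \<tau>"
  using assms pure_tensor_in_tensor_space[OF one_form_in_ring] unfolding tensor_one_add tensor_one_scale modular_linear_def by blast+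

lemma fiber_linear:
  assumes "\<tau> \<in> uhp"
  shows "fiber \<tau> (u + w) = fiber \<tau> u + fiber \<tau> w" and "fiber \<tau> (mscale U a u) = a * fiber \<tau> u"
  unfolding fiber_def by (rule modular_linear_tensor_one[OF S_linear assms])+

text \<open>Linearity over the ring of modular forms makes \<open>S\<close> local in \<open>\<tau>\<close>: at each point it only
  depends on the value of the tensor there.\<close>

lemma modular_linear_eq_fiber:
  assumes L: "modular_linear U S'" and "x \<in> tensor_space U" and \<tau>: "\<tau> \<in> uhp"
  shows "S' x \<tau> = S' (tensor_one U (x \<tau>)) \<tau>"
proof -
  obtain n :: nat and f u where f: "\<forall>i<n. f i \<in> modular_ring" and x: "x = (\<lambda>\<tau>. \<Sum>i<n. pure_tensor U (f i) (u i) \<tau>)"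
    by (rule tensor_spaceE[OF assms(2)])
  have L': "\<And>x y. x \<in> tensor_space U \<Longrightarrow> y \<in> tensor_space U \<Longrightarrow> S' (\<lambda>\<sigma>. x \<sigma> + y \<sigma>) \<tau> = S' x \<tau> + S' y \<tau>"
    "\<And>x a. x \<in> tensor_space U \<Longrightarrow> S' (\<lambda>\<sigma>. mscale U a (x \<sigma>)) \<tau> = a * S' x \<tau>"
    "\<And>f u. f \<in> modular_ring \<Longrightarrow> S' (pure_tensor U f u) \<tau> = f \<tau> * S' (tensor_one U u) \<tau>"
    using L \<tau> unfolding modular_linear_def by blast+
  note one = modular_linear_tensor_one[OF L \<tau>]
  have z: "S' (\<lambda>\<sigma>. 0) \<tau> = 0" using L'(2)[OF tensor_space_zero, of 0] by simp
  have z1: "S' (tensor_one U 0) \<tau> = 0" using one(2)[of 0 0] by simp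
  have "S' (\<lambda>\<sigma>. \<Sum>i<m. pure_tensor U (f i) (u i) \<sigma>) \<tau> = S' (tensor_one U (\<Sum>i<m. pure_tensor U (f i) (u i) \<tau>)) \<tau>" if "m \<le> n" for m
    using that
  proof (induction m)
    case (Suc m)
    have mem: "(\<lambda>\<sigma>. \<Sum>i<m. pure_tensor U (f i) (u i) \<sigma>) \<in> tensor_space U"
      using f Suc.prems by (intro tensor_space_sum pure_tensor_in_tensor_space) auto
    have mem2: "pure_tensor U (f m) (u m) \<in> tensor_space U"
      using f Suc.prems by (intro pure_tensor_in_tensor_space) auto
    have "S' (pure_tensor U (f m) (u m)) \<tau> = S' (tensor_one U (pure_tensor U (f m) (u m) \<tau>)) \<tau>"
      using L'(3)[of "f m" "u m"] f Suc.prems unfolding pure_tensor_def[of U "f m"] one(2) by (simp add: pure_tensor_def)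
    then show ?case using Suc L'(1)[OF mem mem2] by (simp add: one(1))
  qed (simp add: z z1)
  then show ?thesis unfolding x by blast
qed

section \<open>The transform as an explicit function\<close>

definition slash_factor :: "complex \<Rightarrow> complex" where
  "slash_factor \<tau> = (- \<i> * \<tau>) powr (- of_real t)"

definition slash_fiber :: "complex \<Rightarrow> 'u \<Rightarrow> complex" where
  "slash_fiber \<tau> = usq.extension (\<lambda>n u. slash_factor \<tau> * \<tau> powi (- n) * fiber (- 1 / \<tau>) u)"

lemma slash_fiber_linear:
  assumes "\<tau> \<in> uhp"
  shows "slash_fiber \<tau> (u + w) = slash_fiber \<tau> u + slash_fiber \<tau> w"
    and "slash_fiber \<tau> (mscale U a u) = a * slash_fiber \<tau> u"
    and "u \<in> square_weight_space V U (of_real t + of_int n) \<Longrightarrow>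
      slash_fiber \<tau> u = slash_factor \<tau> * \<tau> powi (- n) * fiber (- 1 / \<tau>) u"
proof -
  let ?F = "\<lambda>n u. slash_factor \<tau> * \<tau> powi (- n) * fiber (- 1 / \<tau>) u"
  have F: "?F i (x + y) = ?F i x + ?F i y" "?F i (mscale U a x) = a * ?F i x" for i x y a
    unfolding fiber_linear[OF uhp_inversion[OF assms]] by (simp_all add: distrib_left)
  show "slash_fiber \<tau> (u + w) = slash_fiber \<tau> u + slash_fiber \<tau> w"
    unfolding slash_fiber_def by (rule usq.extension_add) (rule F)+
  show "slash_fiber \<tau> (mscale U a u) = a * slash_fiber \<tau> u"
    unfolding slash_fiber_def by (rule usq.extension_scale) (rule F)+
  show "u \<in> square_weight_space V U (of_real t + of_int n) \<Longrightarrow> slash_fiber \<tau> u = ?F n u"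
    unfolding slash_fiber_def by (rule usq.extension_piece) (rule F)+
qed

lemma slash_fiber_zero: "\<tau> \<in> uhp \<Longrightarrow> slash_fiber \<tau> 0 = 0"
  using slash_fiber_linear(2)[of \<tau> 0 0] by simp

lemma slash_fiber_sum: "\<tau> \<in> uhp \<Longrightarrow> slash_fiber \<tau> (\<Sum>i\<in>I. f i) = (\<Sum>i\<in>I. slash_fiber \<tau> (f i))"
  by (induction I rule: infinite_finite_induct) (simp_all add: slash_fiber_zero slash_fiber_linear)

lemma fiber_zero: "\<tau> \<in> uhp \<Longrightarrow> fiber \<tau> 0 = 0"
  using fiber_linear(2)[of \<tau> 0 0] by simp

lemma fiber_sum: "\<tau> \<in> uhp \<Longrightarrow> fiber \<tau> (\<Sum>i\<in>I. f i) = (\<Sum>i\<in>I. fiber \<tau> (f i))"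
  by (induction I rule: infinite_finite_induct) (simp_all add: fiber_zero fiber_linear)

text \<open>An explicit candidate for the definite description in \<open>slash_gamma\<close>; the
  value 0 off the domain follows the convention in \<open>modular_linear\<close>.\<close>

definition slash :: "(complex \<Rightarrow> 'u) \<Rightarrow> complex \<Rightarrow> complex" where
  "slash x \<tau> = (if x \<in> tensor_space U \<and> \<tau> \<in> uhp then slash_fiber \<tau> (x \<tau>) else 0)"

lemma tensor_one_at: "\<tau> \<in> uhp \<Longrightarrow> tensor_one U u \<tau> = u"
  by (simp add: pure_tensor_def one_form_def)

lemma slash_tensor_one: "\<tau> \<in> uhp \<Longrightarrow> slash (tensor_one U u) \<tau> = slash_fiber \<tau> u"
  by (simp add: slash_def pure_tensor_in_tensor_space one_form_in_ring tensor_one_at)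

lemma slash_linear: "modular_linear U slash"
  unfolding modular_linear_def
proof (intro conjI allI ballI impI)
  fix f u \<tau> assume "f \<in> modular_ring" and \<tau>: "\<tau> \<in> uhp"
  then have "slash (pure_tensor U f u) \<tau> = slash_fiber \<tau> (pure_tensor U f u \<tau>)"
    by (simp add: slash_def pure_tensor_in_tensor_space)
  also have "\<dots> = f \<tau> * slash_fiber \<tau> u"
    using \<tau> by (simp add: slash_fiber_linear pure_tensor_def)
  finally show "slash (pure_tensor U f u) \<tau> = f \<tau> * slash (tensor_one U u) \<tau>"
    using \<tau> by (simp only: slash_tensor_one)
qed (auto simp: slash_def tensor_space_add tensor_space_scale slash_fiber_linear)

text \<open>For uniqueness, a competitor agrees with \<open>slash\<close> on square weight vectors,
  by additivity on all tensors with \<open>one_form\<close>, by locality on the whole tensor space,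
  and elsewhere both are 0.\<close>

lemma slash_gamma_eq: "slash_gamma V U t S = slash"
  unfolding slash_gamma_def
proof (rule the_equality, intro conjI slash_linear allI ballI)
  fix n u \<tau> assume "u \<in> square_weight_space V U (of_real t + of_int n)" "\<tau> \<in> uhp"
  then show "slash (tensor_one U u) \<tau> = (- \<i> * \<tau>) powr (- of_real t) * \<tau> powi (- n) * S (tensor_one U u) (- 1 / \<tau>)"
    by (simp add: slash_tensor_one slash_fiber_linear slash_factor_def fiber_def)
next
  fix S' assume S': "modular_linear U S' \<and>
     (\<forall>n::int. \<forall>u\<in>square_weight_space V U (of_real t + of_int n). \<forall>\<tau>\<in>uhp.
        S' (tensor_one U u) \<tau> = (- \<i> * \<tau>) powr (- of_real t) * \<tau> powi (- n) * S (tensor_one U u) (- 1 / \<tau>))"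
  have one: "S' (tensor_one U u) \<tau> = slash_fiber \<tau> u" if \<tau>: "\<tau> \<in> uhp" for u \<tau>
  proof (induction u rule: usq.graded_induct)
    case (piece n u)
    then show ?case using S' \<tau> by (simp add: slash_fiber_linear slash_factor_def fiber_def)
  next
    case (add x y)
    then show ?case using S' \<tau> by (simp add: modular_linear_tensor_one slash_fiber_linear)
  qed
  show "S' = slash"
  proof (intro ext)
    fix x \<tau>
    show "S' x \<tau> = slash x \<tau>"
    proof (cases "x \<in> tensor_space U \<and> \<tau> \<in> uhp")
      case True
      then show ?thesis using modular_linear_eq_fiber[of S' x \<tau>] S' one by (simp add: slash_def)
    next
      case False
      then show ?thesis using S' unfolding modular_linear_def slash_def by auto
    qed
  qed
qed

lemma fiber_holomorphic: "(\<lambda>\<tau>. fiber \<tau> u) holomorphic_on uhp"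
  unfolding fiber_def by (rule S_holomorphic) (rule pure_tensor_in_tensor_space[OF one_form_in_ring])

lemma inversion_holomorphic: "(\<lambda>\<tau>. - 1 / \<tau>) holomorphic_on uhp"
  by (intro holomorphic_intros) (use uhp_nonzero in auto)

text \<open>On the upper half-plane \<open>- \<i> \<tau>\<close> has positive real part and so
  avoids the branch cut of the principal power.\<close>

lemma slash_factor_holomorphic: "slash_factor holomorphic_on uhp"
  unfolding slash_factor_def
  by (intro holomorphic_intros) (auto simp: uhp_def complex_nonpos_Reals_iff)

lemma slash_fiber_holomorphic: "(\<lambda>\<tau>. slash_fiber \<tau> u) holomorphic_on uhp"
proof (induction u rule: usq.graded_induct)
  case (piece n u)
  have "(\<lambda>\<tau>. fiber (- 1 / \<tau>) u) holomorphic_on uhp"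
    using holomorphic_on_compose_gen[OF inversion_holomorphic fiber_holomorphic[of u]] uhp_inversion
    by (auto simp: o_def)
  then have "(\<lambda>\<tau>. slash_factor \<tau> * \<tau> powi (- n) * fiber (- 1 / \<tau>) u) holomorphic_on uhp"
    using uhp_nonzero by (intro holomorphic_intros slash_factor_holomorphic) auto
  then show ?case
    by (rule holomorphic_transform) (simp add: slash_fiber_linear(3)[OF _ piece])
next
  case (add x y)
  have "(\<lambda>\<tau>. slash_fiber \<tau> x + slash_fiber \<tau> y) holomorphic_on uhp"
    by (intro holomorphic_intros add)
  then show ?case by (rule holomorphic_transform) (simp add: slash_fiber_linear)
qed

lemma slash_holomorphic:
  assumes "x \<in> tensor_space U"
  shows "slash x holomorphic_on uhp"
proof -
  obtain n :: nat and f u where f: "\<forall>i<n. f i \<in> modular_ring" and x: "x = (\<lambda>\<tau>. \<Sum>i<n. pure_tensor U (f i) (u i) \<tau>)"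
    by (rule tensor_spaceE[OF assms])
  have "(\<lambda>\<tau>. \<Sum>i<n. f i \<tau> * slash_fiber \<tau> (u i)) holomorphic_on uhp"
    using f by (intro holomorphic_intros slash_fiber_holomorphic modular_ring_holomorphic) auto
  moreover have "slash x \<tau> = (\<Sum>i<n. f i \<tau> * slash_fiber \<tau> (u i))" if "\<tau> \<in> uhp" for \<tau>
    using that assms unfolding slash_def by (simp add: x slash_fiber_sum slash_fiber_linear pure_tensor_def)
  ultimately show ?thesis by (simp cong: holomorphic_cong)
qed

text \<open>One form for both kinds of Eisenstein sums: \<open>e = -2\<close> gives the generators
  of \<open>Oq\<close>, and \<open>e = -1\<close> the sum in (C4), since \<open>L[n]\<close> is the
  square mode \<open>n + 1\<close> of the shifted conformal vector.\<close>

definition mode_series :: "int \<Rightarrow> (nat \<Rightarrow> complex) \<Rightarrow> 'v \<Rightarrow> 'u \<Rightarrow> 'u" where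
  "mode_series e \<phi> v u = Sum_any (\<lambda>k::nat. if 2 \<le> k then mscale U (\<phi> k) (square_mode V U v (2 * int k + e) u) else 0)"

lemma mode_series_bound: "\<exists>K::nat. \<forall>k>K. square_mode V U v (2 * int k + e) u = 0"
proof -
  obtain N where N: "\<forall>n\<ge>N. square_mode V U v n u = 0" using square_mode_truncation by blast
  show ?thesis by (rule exI[of _ "nat (\<bar>N\<bar> + \<bar>e\<bar>)"]) (use N in auto)
qed

lemma mode_series_eq_sum:
  assumes "\<And>k. k > K \<Longrightarrow> square_mode V U v (2 * int k + e) u = 0"
  shows "mode_series e \<phi> v u = (\<Sum>k=2..K. mscale U (\<phi> k) (square_mode V U v (2 * int k + e) u))"
proof -
  have "mode_series e \<phi> v u = (\<Sum>k=2..K. if 2 \<le> k then mscale U (\<phi> k) (square_mode V U v (2 * int k + e) u) else 0)"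
    unfolding mode_series_def
  proof (rule Sum_any_eq_sum)
    fix k assume "k \<notin> {2..K}"
    then show "(if 2 \<le> k then mscale U (\<phi> k) (square_mode V U v (2 * int k + e) u) else 0) = 0"
      using assms[of k] by (cases "k < 2") auto
  qed simp
  then show ?thesis by simp
qed

text \<open>Modes of large index vanish on \<open>u\<close>, so the sum is finite and commutes with
  \<open>\<theta>\<close>; it is applied with \<open>fiber \<tau>\<close> and with
  \<open>slash_fiber \<tau>\<close>.\<close>

lemma mode_series_functional:
  assumes \<theta>: "\<And>x y. \<theta> (x + y) = \<theta> x + \<theta> y" "\<And>a x. \<theta> (mscale U a x) = a * \<theta> x"
  shows "Sum_any (\<lambda>k::nat. if 2 \<le> k then \<phi> k * \<theta> (square_L V U (2 * int k - 2) u) else 0)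
    = (\<theta> (mode_series (-1) \<phi> (conf V - vscale V (charge V / 24) (vac V)) u) :: complex)"
proof -
  let ?\<omega> = "conf V - vscale V (charge V / 24) (vac V)"
  have L: "square_L V U (2 * int k - 2) u = square_mode V U ?\<omega> (2 * int k + -1) u" for k
    by (simp add: square_L_def)
  have \<theta>0: "\<theta> 0 = 0" using \<theta>(2)[of 0 0] by simp
  have \<theta>sum: "\<theta> (\<Sum>i\<in>I. f i) = (\<Sum>i\<in>I. \<theta> (f i))" for f and I :: "nat set"
    by (induction I rule: infinite_finite_induct) (simp_all add: \<theta> \<theta>0)
  obtain K where K: "\<And>k. k > K \<Longrightarrow> square_mode V U ?\<omega> (2 * int k + -1) u = 0"
    using mode_series_bound by meson
  have "Sum_any (\<lambda>k::nat. if 2 \<le> k then \<phi> k * \<theta> (square_L V U (2 * int k - 2) u) else 0)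
     = (\<Sum>k=2..K. if 2 \<le> k then \<phi> k * \<theta> (square_L V U (2 * int k - 2) u) else 0)"
  proof (rule Sum_any_eq_sum)
    fix k assume "k \<notin> {2..K}"
    then show "(if 2 \<le> k then \<phi> k * \<theta> (square_L V U (2 * int k - 2) u) else 0) = 0"
      using K[of k] unfolding L by (cases "k < 2") (auto simp: \<theta>0)
  qed simp
  also have "\<dots> = (\<Sum>k=2..K. \<phi> k * \<theta> (square_mode V U ?\<omega> (2 * int k + -1) u))"
    by (intro sum.cong refl) (simp add: L)
  also have "\<dots> = \<theta> (\<Sum>k=2..K. mscale U (\<phi> k) (square_mode V U ?\<omega> (2 * int k + -1) u))"
    by (simp only: \<theta>sum \<theta>(2))
  also have "(\<Sum>k=2..K. mscale U (\<phi> k) (square_mode V U ?\<omega> (2 * int k + -1) u)) = mode_series (-1) \<phi> ?\<omega> u"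
    by (rule mode_series_eq_sum[symmetric]) (rule K)
  finally show ?thesis .
qed

lemma mode_series_add: "mode_series e \<phi> v (u + w) = mode_series e \<phi> v u + mode_series e \<phi> v w"
proof -
  obtain K L where "\<And>k. k > K \<Longrightarrow> square_mode V U v (2 * int k + e) u = 0"
    "\<And>k. k > L \<Longrightarrow> square_mode V U v (2 * int k + e) w = 0"
    using mode_series_bound by meson
  then show ?thesis
    by (subst (1 2 3) mode_series_eq_sum[of "max K L"])
      (auto simp: square_mode_add msp.scale_right_distrib sum.distrib)
qed

lemma mode_series_add_left: "mode_series e \<phi> (v + w) u = mode_series e \<phi> v u + mode_series e \<phi> w u"
proof -
  obtain K L where "\<And>k. k > K \<Longrightarrow> square_mode V U v (2 * int k + e) u = 0"
    "\<And>k. k > L \<Longrightarrow> square_mode V U w (2 * int k + e) u = 0"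
    using mode_series_bound by meson
  then show ?thesis
    by (subst (1 2 3) mode_series_eq_sum[of "max K L"])
      (auto simp: square_mode_add_left msp.scale_right_distrib sum.distrib)
qed

text \<open>All Eisenstein sums are homogeneous: the weight \<open>2k\<close> of the \<open>k\<close>-th coefficient is exactly
  compensated by the weight of the \<open>k\<close>-th mode.\<close>

lemma slash_fiber_mode_series:
  assumes \<tau>: "\<tau> \<in> uhp"
    and v: "v \<in> square_weight_space V (adjoint_mod V) (of_nat a)"
    and u: "u \<in> square_weight_space V U (of_real t + of_int n)"
    and \<psi>: "\<And>k. 2 \<le> k \<Longrightarrow> \<psi> k = \<tau> ^ (2 * k) * \<phi> k"
  shows "slash_fiber \<tau> (mode_series e \<phi> v u) =
    slash_factor \<tau> * \<tau> powi (- (n + int a - e - 1)) * fiber (- 1 / \<tau>) (mode_series e \<psi> v u)"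
proof -
  obtain K where K: "\<And>k. k > K \<Longrightarrow> square_mode V U v (2 * int k + e) u = 0"
    using mode_series_bound by meson
  have \<tau>0: "\<tau> \<noteq> 0" by (rule uhp_nonzero[OF \<tau>])
  have "slash_fiber \<tau> (mscale U (\<phi> k) (square_mode V U v (2 * int k + e) u)) =
     slash_factor \<tau> * \<tau> powi (- (n + int a - e - 1)) * (\<psi> k * fiber (- 1 / \<tau>) (square_mode V U v (2 * int k + e) u))"
    if k: "2 \<le> k" for k
  proof -
    have "square_mode V U v (2 * int k + e) u \<in> square_weight_space V U (of_real t + of_int (n + int a - (2 * int k + e) - 1))"
      using square_mode_weight[OF v u, of "2 * int k + e"] by (simp add: algebra_simps)
    then have "slash_fiber \<tau> (square_mode V U v (2 * int k + e) u) = slash_factor \<tau> * \<tau> powi (- (n + int a - (2 * int k + e) - 1)) * fiber (- 1 / \<tau>) (square_mode V U v (2 * int k + e) u)"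
      by (rule slash_fiber_linear(3)[OF \<tau>])
    moreover have "\<tau> powi (- (n + int a - (2 * int k + e) - 1)) = \<tau> powi (- (n + int a - e - 1)) * \<tau> ^ (2 * k)"
    proof -
      have e: "- (n + int a - (2 * int k + e) - 1) = - (n + int a - e - 1) + int (2 * k)" by simp
      show ?thesis unfolding e power_int_add[OF disjI1[OF \<tau>0]] power_int_of_nat ..
    qed
    ultimately show ?thesis
      unfolding slash_fiber_linear(2)[OF \<tau>] \<psi>[OF k] by (simp only: mult_ac)
  qed
  moreover have "mode_series e \<theta> v u = (\<Sum>k=2..K. mscale U (\<theta> k) (square_mode V U v (2 * int k + e) u))" for \<theta>
    by (rule mode_series_eq_sum) (rule K)
  ultimately show ?thesis
    unfolding slash_fiber_sum[OF \<tau>] fiber_sum[OF uhp_inversion[OF \<tau>]]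
      fiber_linear(2)[OF uhp_inversion[OF \<tau>]] sum_distrib_left
    by (simp only: slash_fiber_sum[OF \<tau>] fiber_sum[OF uhp_inversion[OF \<tau>]]
      fiber_linear(2)[OF uhp_inversion[OF \<tau>]] sum_distrib_left) (intro sum.cong refl, simp)
qed

definition Oq_series :: "'v \<Rightarrow> 'u \<Rightarrow> complex \<Rightarrow> 'u" where
  "Oq_series v u = (\<lambda>\<tau>. tensor_one U (square_mode V U v (-2) u) \<tau> +
        Sum_any (\<lambda>k::nat. if 2 \<le> k then
          mscale U (of_nat (2 * k - 1))
            (pure_tensor U (eisenstein_E (2 * k)) (square_mode V U v (2 * int k - 2) u) \<tau>)
          else 0))"

lemma Oq_generators_eq:
  "Oq_generators V U = {tensor_one U (square_mode V U v 0 u) | v u. True} \<union> {Oq_series v u | v u. True}"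
  by (simp add: Oq_generators_def Oq_series_def)

lemma Oq_series_at:
  assumes "\<tau> \<in> uhp"
  shows "Oq_series v u \<tau> = square_mode V U v (-2) u + mode_series (-2) (\<lambda>k. of_nat (2 * k - 1) * eisenstein_E (2 * k) \<tau>) v u"
  unfolding Oq_series_def mode_series_def tensor_one_at[OF assms]
  by (simp add: pure_tensor_def cong: if_cong)

lemma Oq_series_in_tensor_space: "Oq_series v u \<in> tensor_space U"
proof -
  obtain K where K: "\<And>k. k > K \<Longrightarrow> square_mode V U v (2 * int k - 2) u = 0"
    using mode_series_bound[of v "-2" u] by auto
  have "Oq_series v u \<tau> = tensor_one U (square_mode V U v (-2) u) \<tau> +
        (\<Sum>k=2..K. mscale U (of_nat (2 * k - 1))
            (pure_tensor U (eisenstein_E (2 * k)) (square_mode V U v (2 * int k - 2) u) \<tau>))" for \<tau>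
  proof -
    have "Sum_any (\<lambda>k::nat. if 2 \<le> k then mscale U (of_nat (2 * k - 1))
            (pure_tensor U (eisenstein_E (2 * k)) (square_mode V U v (2 * int k - 2) u) \<tau>) else 0)
       = (\<Sum>k=2..K. if 2 \<le> k then mscale U (of_nat (2 * k - 1))
            (pure_tensor U (eisenstein_E (2 * k)) (square_mode V U v (2 * int k - 2) u) \<tau>) else 0)"
    proof (rule Sum_any_eq_sum)
      fix k assume "k \<notin> {2..K}"
      then show "(if 2 \<le> k then mscale U (of_nat (2 * k - 1))
            (pure_tensor U (eisenstein_E (2 * k)) (square_mode V U v (2 * int k - 2) u) \<tau>) else 0) = 0"
        using K[of k] by (cases "k < 2") (auto simp: pure_tensor_def)
    qed simp
    then show ?thesis by (simp add: Oq_series_def)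
  qed
  then have "Oq_series v u = (\<lambda>\<tau>. tensor_one U (square_mode V U v (-2) u) \<tau> +
        (\<Sum>k=2..K. mscale U (of_nat (2 * k - 1))
            (pure_tensor U (eisenstein_E (2 * k)) (square_mode V U v (2 * int k - 2) u) \<tau>)))" by (rule ext)
  then show ?thesis
    by (simp only:) (intro tensor_space_add tensor_space_sum tensor_space_scale pure_tensor_in_tensor_space
      one_form_in_ring eisenstein_E_in_ring, simp)
qed

lemma fiber_Oq:
  assumes "\<tau> \<in> uhp"
  shows "fiber \<tau> (square_mode V U v 0 u) = 0" and "fiber \<tau> (Oq_series v u \<tau>) = 0"
proof -
  have gen: "x \<in> Oq V U" if "x \<in> Oq_generators V U" for x
    unfolding Oq_def using that hull_subset[of "Oq_generators V U" "modular_submodule U"] by blast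
  show "fiber \<tau> (square_mode V U v 0 u) = 0"
    unfolding fiber_def by (rule S_Oq[OF gen assms]) (auto simp: Oq_generators_eq)
  have "S (Oq_series v u) \<tau> = 0"
    by (rule S_Oq[OF gen assms]) (auto simp: Oq_generators_eq)
  then show "fiber \<tau> (Oq_series v u \<tau>) = 0"
    unfolding fiber_def modular_linear_eq_fiber[OF S_linear Oq_series_in_tensor_space assms] .
qed

text \<open>Both kinds of generators are additive in \<open>v\<close> and in \<open>u\<close>, so a
  nested induction over the square gradings of \<open>V\<close> and \<open>U\<close> reduces the
  claim to homogeneous vectors.\<close>

lemma slash_fiber_Oq:
  assumes \<tau>: "\<tau> \<in> uhp"
  shows "slash_fiber \<tau> (square_mode V U v 0 u) = 0" and "slash_fiber \<tau> (Oq_series v u \<tau>) = 0"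
proof -
  note \<sigma> = uhp_inversion[OF \<tau>]
  have sum4: "a + b = 0 \<Longrightarrow> a' + b' = 0 \<Longrightarrow> a + a' + (b + b') = 0" for a b a' b' :: complex
    by algebra
  have "slash_fiber \<tau> (square_mode V U v 0 u) = 0 \<and> slash_fiber \<tau> (Oq_series v u \<tau>) = 0"
    unfolding Oq_series_at[OF \<tau>]
  proof (induction v rule: vsq.graded_induct)
    case v: (piece a v)
    show ?case
    proof (induction u rule: usq.graded_induct)
      case u: (piece n u)
      have "square_mode V U v 0 u \<in> square_weight_space V U (of_real t + of_int (n + int a - 1))"
        using square_mode_weight[OF v u, of 0] by (simp add: algebra_simps)
      then have "slash_fiber \<tau> (square_mode V U v 0 u) = slash_factor \<tau> * \<tau> powi (- (n + int a - 1)) * fiber (- 1 / \<tau>) (square_mode V U v 0 u)"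
        by (rule slash_fiber_linear(3)[OF \<tau>])
      then have 0: "slash_fiber \<tau> (square_mode V U v 0 u) = 0"
        unfolding fiber_Oq(1)[OF \<sigma>] by simp
      have "square_mode V U v (-2) u \<in> square_weight_space V U (of_real t + of_int (n + int a - (-2) - 1))"
        using square_mode_weight[OF v u, of "-2"] by (simp add: algebra_simps)
      then have 1: "slash_fiber \<tau> (square_mode V U v (-2) u) = slash_factor \<tau> * \<tau> powi (- (n + int a - (-2) - 1)) * fiber (- 1 / \<tau>) (square_mode V U v (-2) u)"
        by (rule slash_fiber_linear(3)[OF \<tau>])
      have 2: "slash_fiber \<tau> (mode_series (-2) (\<lambda>k. of_nat (2 * k - 1) * eisenstein_E (2 * k) \<tau>) v u) =
          slash_factor \<tau> * \<tau> powi (- (n + int a - (-2) - 1)) * fiber (- 1 / \<tau>) (mode_series (-2) (\<lambda>k. of_nat (2 * k - 1) * eisenstein_E (2 * k) (- 1 / \<tau>)) v u)"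
      proof (rule slash_fiber_mode_series[OF \<tau> v u])
        fix k :: nat assume "2 \<le> k"
        then have "eisenstein_E (2 * k) (- 1 / \<tau>) = \<tau> ^ (2 * k) * eisenstein_E (2 * k) \<tau>"
          by (intro eisenstein_E_inversion \<tau>) simp
        then show "of_nat (2 * k - 1) * eisenstein_E (2 * k) (- 1 / \<tau>) = \<tau> ^ (2 * k) * (of_nat (2 * k - 1) * eisenstein_E (2 * k) \<tau>)"
          by (simp only: mult.left_commute)
      qed
      have "fiber (- 1 / \<tau>) (square_mode V U v (-2) u) + fiber (- 1 / \<tau>) (mode_series (-2) (\<lambda>k. of_nat (2 * k - 1) * eisenstein_E (2 * k) (- 1 / \<tau>)) v u) = 0"
        using fiber_Oq(2)[OF \<sigma>, of v u] unfolding Oq_series_at[OF \<sigma>] fiber_linear(1)[OF \<sigma>] .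
      then have "slash_fiber \<tau> (square_mode V U v (-2) u) + slash_fiber \<tau> (mode_series (-2) (\<lambda>k. of_nat (2 * k - 1) * eisenstein_E (2 * k) \<tau>) v u) = 0"
        unfolding 1 2 distrib_left[symmetric] by simp
      with 0 show ?case by (simp add: slash_fiber_linear(1)[OF \<tau>])
    next
      case (add x y)
      then show ?case by (simp add: square_mode_add mode_series_add slash_fiber_linear(1)[OF \<tau>] sum4)
    qed
  next
    case (add x y)
    then show ?case by (simp add: square_mode_add_left mode_series_add_left slash_fiber_linear(1)[OF \<tau>] sum4)
  qed
  then show "slash_fiber \<tau> (square_mode V U v 0 u) = 0" "slash_fiber \<tau> (Oq_series v u \<tau>) = 0" by auto
qed

lemma slash_Oq:
  assumes "x \<in> Oq V U" and \<tau>: "\<tau> \<in> uhp"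
  shows "slash x \<tau> = 0"
proof -
  \<comment> \<open>At a fixed \<open>\<tau>\<close> modular forms act by scalars, so this kernel is
    a modular submodule and contains the hull as soon as it contains the generators.\<close>
  let ?N = "{x. slash_fiber \<tau> (x \<tau>) = 0}"
  have "modular_submodule U ?N"
    using \<tau> by (simp add: modular_submodule_def slash_fiber_linear slash_fiber_zero)
  moreover have "Oq_generators V U \<subseteq> ?N"
    unfolding Oq_generators_eq using \<tau> by (auto simp: slash_fiber_Oq tensor_one_at)
  ultimately have "Oq V U \<subseteq> ?N" unfolding Oq_def by (rule hull_minimal[rotated])
  with assms show ?thesis by (auto simp: slash_def)
qed

section \<open>The differential equation (C4) for the transform\<close>

lemma fiber_derivation:
  obtains D :: "'u \<Rightarrow> complex \<Rightarrow> complex" where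
    "\<forall>u w. \<forall>\<tau>\<in>uhp. D (u + w) \<tau> = D u \<tau> + D w \<tau>"
    "\<forall>a u. \<forall>\<tau>\<in>uhp. D (mscale U a u) \<tau> = a * D u \<tau>"
    "\<forall>k u. \<forall>\<tau>\<in>uhp. u \<in> square_weight_space V U k \<longrightarrow>
       D u \<tau> = 1 / (2 * of_real pi * \<i>) * deriv (\<lambda>\<tau>. fiber \<tau> u) \<tau> + k * eisenstein_E 2 \<tau> * fiber \<tau> u"
    "\<forall>u. \<forall>\<tau>\<in>uhp. fiber \<tau> (square_L V U (-2) u) = D u \<tau> + fiber \<tau>
       (mode_series (-1) (\<lambda>k. eisenstein_E (2 * k) \<tau>) (conf V - vscale V (charge V / 24) (vac V)) u)"
proof -
  obtain D :: "'u \<Rightarrow> complex \<Rightarrow> complex" where D: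
    "\<forall>u u'. \<forall>\<tau>\<in>uhp. D (u + u') \<tau> = D u \<tau> + D u' \<tau>"
    "\<forall>a u. \<forall>\<tau>\<in>uhp. D (mscale U a u) \<tau> = a * D u \<tau>"
    "\<forall>k. \<forall>u\<in>square_weight_space V U k. \<forall>\<tau>\<in>uhp.
           D u \<tau> = 1 / (2 * of_real pi * \<i>) * deriv (S (tensor_one U u)) \<tau> +
             k * eisenstein_E 2 \<tau> * S (tensor_one U u) \<tau>"
    "\<forall>u. \<forall>\<tau>\<in>uhp. S (tensor_one U (square_L V U (-2) u)) \<tau> = D u \<tau> +
           Sum_any (\<lambda>k::nat. if 2 \<le> k then
             eisenstein_E (2 * k) \<tau> * S (tensor_one U (square_L V U (2 * int k - 2) u)) \<tau>
             else 0)"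
    using S unfolding one_point_functions_def by blast
  have series: "Sum_any (\<lambda>k::nat. if 2 \<le> k then eisenstein_E (2 * k) \<tau> * S (tensor_one U (square_L V U (2 * int k - 2) u)) \<tau> else 0)
     = fiber \<tau> (mode_series (-1) (\<lambda>k. eisenstein_E (2 * k) \<tau>) (conf V - vscale V (charge V / 24) (vac V)) u)" if "\<tau> \<in> uhp" for u \<tau>
    unfolding fiber_def[symmetric] by (rule mode_series_functional) (rule fiber_linear[OF that])+
  show thesis
    by (rule that[of D]) (use D series in \<open>auto simp: fiber_def[abs_def]\<close>)
qed

lemma slash_factor_deriv:
  assumes "\<tau> \<in> uhp"
  shows "(slash_factor has_field_derivative (- of_real t * slash_factor \<tau> / \<tau>)) (at \<tau>)"
proof -
  have nr: "- \<i> * \<tau> \<notin> \<real>\<^sub>\<le>\<^sub>0" using assms by (auto simp: uhp_def complex_nonpos_Reals_iff)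
  have \<tau>0: "\<tau> \<noteq> 0" by (rule uhp_nonzero[OF assms])
  have "((\<lambda>\<tau>. (- \<i> * \<tau>) powr (- of_real t)) has_field_derivative
      (- of_real t * (- \<i> * \<tau>) powr (- of_real t - 1) * (- \<i>))) (at \<tau>)"
    by (rule DERIV_chain2[where f = "\<lambda>z. z powr (- of_real t)" and g = "\<lambda>\<tau>. - \<i> * \<tau>",
          OF has_field_derivative_powr[OF nr]]) (auto intro!: derivative_eq_intros)
  moreover have "(- \<i> * \<tau>) powr (- of_real t - 1) = slash_factor \<tau> / (- \<i> * \<tau>)"
    using \<tau>0 by (simp add: slash_factor_def powr_diff)
  moreover have "- T * (c / (- \<i> * \<tau>)) * (- \<i>) = - T * c / \<tau>" for T c :: complex
    using \<tau>0 by (simp add: field_simps)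
  ultimately show ?thesis by (simp only: slash_factor_def[abs_def])
qed

text \<open>The inner map \<open>-1/\<tau>\<close> contributes \<open>1 / \<tau>^2\<close>. The
  logarithmic derivatives \<open>- t / \<tau>\<close> of \<open>slash_factor\<close> and
  \<open>- n / \<tau>\<close> of the integral power add up to the full weight
  \<open>t + n\<close>.\<close>

lemma slash_fiber_deriv:
  assumes \<tau>: "\<tau> \<in> uhp" and u: "u \<in> square_weight_space V U (of_real t + of_int n)"
  shows "deriv (\<lambda>\<tau>. slash_fiber \<tau> u) \<tau> = slash_factor \<tau> * \<tau> powi (- n - 2) *
    (deriv (\<lambda>\<tau>. fiber \<tau> u) (- 1 / \<tau>) - (of_real t + of_int n) * \<tau> * fiber (- 1 / \<tau>) u)"
proof -
  have \<tau>0: "\<tau> \<noteq> 0" by (rule uhp_nonzero[OF \<tau>])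
  have op: "open uhp" unfolding uhp_def by (rule open_halfspace_Im_gt)
  have F: "((\<lambda>\<tau>. fiber \<tau> u) has_field_derivative deriv (\<lambda>\<tau>. fiber \<tau> u) (- 1 / \<tau>)) (at (- 1 / \<tau>))"
    by (rule holomorphic_derivI[OF fiber_holomorphic op uhp_inversion[OF \<tau>]])
  have I: "((\<lambda>\<tau>. - 1 / \<tau>) has_field_derivative 1 / \<tau>\<^sup>2) (at \<tau>)"
    using \<tau>0 by (auto intro!: derivative_eq_intros simp: power2_eq_square)
  have P: "((\<lambda>\<tau>. \<tau> powi (- n)) has_field_derivative of_int (- n) * \<tau> powi (- n - 1)) (at \<tau>)"
    using \<tau>0 by (auto intro!: derivative_eq_intros)
  have "((\<lambda>\<tau>. slash_factor \<tau> * \<tau> powi (- n) * fiber (- 1 / \<tau>) u) has_field_derivative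
      (- of_real t * slash_factor \<tau> / \<tau> * \<tau> powi (- n) + of_int (- n) * \<tau> powi (- n - 1) * slash_factor \<tau>) * fiber (- 1 / \<tau>) u
       + deriv (\<lambda>\<tau>. fiber \<tau> u) (- 1 / \<tau>) * (1 / \<tau>\<^sup>2) * (slash_factor \<tau> * \<tau> powi (- n))) (at \<tau>)"
    by (rule DERIV_mult[OF DERIV_mult[OF slash_factor_deriv[OF \<tau>] P] DERIV_chain2[OF F I]])
  then have "((\<lambda>\<tau>. slash_fiber \<tau> u) has_field_derivative
      (- of_real t * slash_factor \<tau> / \<tau> * \<tau> powi (- n) + of_int (- n) * \<tau> powi (- n - 1) * slash_factor \<tau>) * fiber (- 1 / \<tau>) u
       + deriv (\<lambda>\<tau>. fiber \<tau> u) (- 1 / \<tau>) * (1 / \<tau>\<^sup>2) * (slash_factor \<tau> * \<tau> powi (- n))) (at \<tau>)"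
    by (rule has_field_derivative_transform_within_open[OF _ op \<tau>]) (simp add: slash_fiber_linear(3)[OF _ u])
  then have "deriv (\<lambda>\<tau>. slash_fiber \<tau> u) \<tau> =
      (- of_real t * slash_factor \<tau> / \<tau> * \<tau> powi (- n) + of_int (- n) * \<tau> powi (- n - 1) * slash_factor \<tau>) * fiber (- 1 / \<tau>) u
       + deriv (\<lambda>\<tau>. fiber \<tau> u) (- 1 / \<tau>) * (1 / \<tau>\<^sup>2) * (slash_factor \<tau> * \<tau> powi (- n))"
    by (rule DERIV_imp_deriv)
  also have "\<tau> powi (- n) = \<tau> powi (- n - 2) * \<tau>\<^sup>2"
    using power_int_add[of \<tau> "- n - 2" 2] \<tau>0 by simp
  also have "\<tau> powi (- n - 1) = \<tau> powi (- n - 2) * \<tau>"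
  proof -
    have e: "- n - 1 = - n - 2 + 1" by simp
    show ?thesis unfolding e using \<tau>0 by (subst power_int_add) auto
  qed
  also have "(- of_real t * slash_factor \<tau> / \<tau> * (P * \<tau>\<^sup>2) + of_int (- n) * (P * \<tau>) * slash_factor \<tau>) * X + Y * (1 / \<tau>\<^sup>2) * (slash_factor \<tau> * (P * \<tau>\<^sup>2))
     = slash_factor \<tau> * P * (Y - (of_real t + of_int n) * \<tau> * X)" for P X Y
    using \<tau>0 by (simp add: field_simps power2_eq_square)
  finally show ?thesis .
qed

theorem slash_one_point: "slash \<in> one_point_functions V U"
proof -
  let ?\<omega> = "conf V - vscale V (charge V / 24) (vac V)"
  let ?c = "1 / (2 * of_real pi * \<i>) :: complex"
  obtain D :: "'u \<Rightarrow> complex \<Rightarrow> complex" where D_all: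
    "\<forall>u w. \<forall>\<tau>\<in>uhp. D (u + w) \<tau> = D u \<tau> + D w \<tau>"
    "\<forall>a u. \<forall>\<tau>\<in>uhp. D (mscale U a u) \<tau> = a * D u \<tau>"
    "\<forall>k u. \<forall>\<tau>\<in>uhp. u \<in> square_weight_space V U k \<longrightarrow>
       D u \<tau> = ?c * deriv (\<lambda>\<tau>. fiber \<tau> u) \<tau> + k * eisenstein_E 2 \<tau> * fiber \<tau> u"
    "\<forall>u. \<forall>\<tau>\<in>uhp. fiber \<tau> (square_L V U (-2) u) = D u \<tau> + fiber \<tau>
       (mode_series (-1) (\<lambda>k. eisenstein_E (2 * k) \<tau>) ?\<omega> u)"
    by (rule fiber_derivation)
  note D = D_all(1)[rule_format] D_all(2)[rule_format] D_all(3)[rule_format] D_all(4)[rule_format]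
  \<comment> \<open>The operator \<open>\<partial>\<close> raises the weight by 2, so on vectors of
    weight \<open>t + n\<close> the transform of \<open>D\<close> carries the exponent
    \<open>- n - 2\<close>.\<close>
  define D' where "D' u \<tau> = usq.extension (\<lambda>n u. slash_factor \<tau> * \<tau> powi (- n - 2) * D u (- 1 / \<tau>)) u" for u \<tau>
  have D'_add: "D' (u + w) \<tau> = D' u \<tau> + D' w \<tau>"
    and D'_scale: "D' (mscale U a u) \<tau> = a * D' u \<tau>"
    and D'_piece: "u \<in> square_weight_space V U (of_real t + of_int n) \<Longrightarrow> D' u \<tau> = slash_factor \<tau> * \<tau> powi (- n - 2) * D u (- 1 / \<tau>)"
    if \<tau>: "\<tau> \<in> uhp" for u w a n \<tau>
  proof -
    let ?F = "\<lambda>n u. slash_factor \<tau> * \<tau> powi (- n - 2) * D u (- 1 / \<tau>)"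
    have F: "?F i (x + y) = ?F i x + ?F i y" "?F i (mscale U a x) = a * ?F i x" for i x y a
      unfolding D(1)[OF uhp_inversion[OF \<tau>]] D(2)[OF uhp_inversion[OF \<tau>]] by (simp_all add: distrib_left)
    show "D' (u + w) \<tau> = D' u \<tau> + D' w \<tau>"
      unfolding D'_def by (rule usq.extension_add) (rule F)+
    show "D' (mscale U a u) \<tau> = a * D' u \<tau>"
      unfolding D'_def by (rule usq.extension_scale) (rule F)+
    show "u \<in> square_weight_space V U (of_real t + of_int n) \<Longrightarrow> D' u \<tau> = ?F n u"
      unfolding D'_def by (rule usq.extension_piece) (rule F)+
  qed
  have one: "deriv (slash (tensor_one U u)) \<tau> = deriv (\<lambda>\<tau>. slash_fiber \<tau> u) \<tau>" if \<tau>: "\<tau> \<in> uhp" for u \<tau>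
  proof (rule deriv_cong_ev[OF _ refl])
    have "eventually (\<lambda>\<tau>. \<tau> \<in> uhp) (nhds \<tau>)"
      using \<tau> unfolding uhp_def by (intro eventually_nhds_in_open open_halfspace_Im_gt)
    then show "\<forall>\<^sub>F \<tau> in nhds \<tau>. slash (tensor_one U u) \<tau> = slash_fiber \<tau> u"
      by eventually_elim (rule slash_tensor_one)
  qed
  have D'_weight: "D' u \<tau> = ?c * deriv (slash (tensor_one U u)) \<tau> + k * eisenstein_E 2 \<tau> * slash (tensor_one U u) \<tau>"
    if u: "u \<in> square_weight_space V U k" and \<tau>: "\<tau> \<in> uhp" for k u \<tau>
  proof -
    \<comment> \<open>(C4) allows an arbitrary complex \<open>k\<close>. A nonzero \<open>u\<close>
      forces \<open>k\<close> into \<open>t + Z\<close>, while \<open>u = 0\<close> lies in every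
      weight space and makes both sides 0.\<close>
    have "\<exists>n::int. u \<in> square_weight_space V U (of_real t + of_int n) \<and> k * eisenstein_E 2 \<tau> * slash_fiber \<tau> u = (of_real t + of_int n) * eisenstein_E 2 \<tau> * slash_fiber \<tau> u"
    proof (cases "u = 0")
      case True
      then show ?thesis using usq.piece_zero[of 0] slash_fiber_zero[OF \<tau>] by (intro exI[of _ 0]) auto
    next
      case False
      have "k \<in> range (\<lambda>n::int. of_real t + of_int n)"
      proof (rule ccontr)
        assume "k \<notin> range (\<lambda>n::int. of_real t + of_int n)"
        then have "u = 0"
          using u square_span
          by (intro msp.eigenvector_eq_0[of "square_L V U 0" "\<lambda>n::int. of_real t + of_int n" u k])
            (auto simp: square_L_add square_L_scale square_weight_space_def inj_on_def)
        with False show False by simp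
      qed
      with u show ?thesis by auto
    qed
    then obtain n :: int where n: "u \<in> square_weight_space V U (of_real t + of_int n)"
      and k: "k * eisenstein_E 2 \<tau> * slash_fiber \<tau> u = (of_real t + of_int n) * eisenstein_E 2 \<tau> * slash_fiber \<tau> u" by blast
    have \<tau>0: "\<tau> \<noteq> 0" by (rule uhp_nonzero[OF \<tau>])
    have p: "\<tau> powi (- n) = \<tau> powi (- n - 2) * \<tau>\<^sup>2"
      using power_int_add[of \<tau> "- n - 2" 2] \<tau>0 by simp
    have E2: "eisenstein_E 2 (- 1 / \<tau>) = \<tau>\<^sup>2 * eisenstein_E 2 \<tau> - ?c * \<tau>"
      using eisenstein_E2_inversion[OF \<tau>] by simp
    have "D' u \<tau> = slash_factor \<tau> * \<tau> powi (- n - 2) *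
        (?c * deriv (\<lambda>\<tau>. fiber \<tau> u) (- 1 / \<tau>) + (of_real t + of_int n) * eisenstein_E 2 (- 1 / \<tau>) * fiber (- 1 / \<tau>) u)"
      by (subst D'_piece[OF \<tau> n], subst D(3)[OF uhp_inversion[OF \<tau>] n]) (rule refl)
    \<comment> \<open>The term \<open>- ?c * \<tau>\<close> in \<open>E2\<close> on the left equals
      the weight term of \<open>slash_fiber_deriv\<close> on the right.\<close>
    also have "\<dots> = ?c * deriv (\<lambda>\<tau>. slash_fiber \<tau> u) \<tau> + (of_real t + of_int n) * eisenstein_E 2 \<tau> * slash_fiber \<tau> u"
      unfolding slash_fiber_deriv[OF \<tau> n] slash_fiber_linear(3)[OF \<tau> n] p E2 by (simp only: algebra_simps)
    finally show ?thesis unfolding one[OF \<tau>] slash_tensor_one[OF \<tau>] k .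
  qed
  have main: "slash_fiber \<tau> (square_L V U (-2) u) = D' u \<tau> + slash_fiber \<tau> (mode_series (-1) (\<lambda>k. eisenstein_E (2 * k) \<tau>) ?\<omega> u)"
    if \<tau>: "\<tau> \<in> uhp" for u \<tau>
  proof (induction u rule: usq.graded_induct)
    case u: (piece n u)
    have "square_L V U (-2) u \<in> square_weight_space V U (of_real t + of_int (n + 2))"
      using square_L_weight[OF u, of "-2"] by (simp add: algebra_simps)
    then have "slash_fiber \<tau> (square_L V U (-2) u) = slash_factor \<tau> * \<tau> powi (- (n + 2)) * fiber (- 1 / \<tau>) (square_L V U (-2) u)"
      by (rule slash_fiber_linear(3)[OF \<tau>])
    moreover have "slash_fiber \<tau> (mode_series (-1) (\<lambda>k. eisenstein_E (2 * k) \<tau>) ?\<omega> u) =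
       slash_factor \<tau> * \<tau> powi (- (n + int 2 - (-1) - 1)) * fiber (- 1 / \<tau>) (mode_series (-1) (\<lambda>k. eisenstein_E (2 * k) (- 1 / \<tau>)) ?\<omega> u)"
      by (rule slash_fiber_mode_series[OF \<tau> _ u]) (use square_conf_weight eisenstein_E_inversion[OF _ \<tau>] in auto)
    \<comment> \<open>All three terms of the equation acquire the same factor, so it reduces to the
      equation for \<open>S\<close> at \<open>-1/\<tau>\<close>.\<close>
    moreover have "- (n + int 2 - (-1) - 1) = - n - 2" "- (n + 2) = - n - 2" by simp_all
    ultimately show ?case
      unfolding D(4)[OF uhp_inversion[OF \<tau>]] D'_piece[OF \<tau> u] by (simp only: distrib_left)
  next
    case (add x y)
    then show ?case
      by (simp add: square_L_add mode_series_add slash_fiber_linear(1)[OF \<tau>] D'_add[OF \<tau>])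
  qed
  have series: "Sum_any (\<lambda>k::nat. if 2 \<le> k then eisenstein_E (2 * k) \<tau> * slash (tensor_one U (square_L V U (2 * int k - 2) u)) \<tau> else 0)
     = slash_fiber \<tau> (mode_series (-1) (\<lambda>k. eisenstein_E (2 * k) \<tau>) ?\<omega> u)" if "\<tau> \<in> uhp" for u \<tau>
    unfolding slash_tensor_one[OF that] by (rule mode_series_functional) (rule slash_fiber_linear[OF that])+
  have "\<forall>\<tau>\<in>uhp. slash (tensor_one U (square_L V U (-2) u)) \<tau> = D' u \<tau> +
           Sum_any (\<lambda>k::nat. if 2 \<le> k then
             eisenstein_E (2 * k) \<tau> * slash (tensor_one U (square_L V U (2 * int k - 2) u)) \<tau>
             else 0)" for u
  proof
    fix \<tau> assume \<tau>: "\<tau> \<in> uhp"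
    show "slash (tensor_one U (square_L V U (-2) u)) \<tau> = D' u \<tau> +
           Sum_any (\<lambda>k::nat. if 2 \<le> k then
             eisenstein_E (2 * k) \<tau> * slash (tensor_one U (square_L V U (2 * int k - 2) u)) \<tau>
             else 0)"
      by (subst series[OF \<tau>], subst slash_tensor_one[OF \<tau>]) (rule main[OF \<tau>])
  qed
  then show ?thesis
    unfolding one_point_functions_def using slash_holomorphic slash_linear slash_Oq D'_add D'_scale D'_weight
    by (intro CollectI conjI exI[of _ D']) auto
qed

end

theorem theorem5p1:
  fixes V :: "'v::ab_group_add voa"
    and U :: "('v, 'u::ab_group_add) vmod"
    and t :: real and m :: int
    and S :: "(complex \<Rightarrow> 'u) \<Rightarrow> complex \<Rightarrow> complex"
  assumes "vertex_operator_algebra V"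
    and "rational_voa V"
    and "irreducible_module V U UNIV"
    and "spanned_by_primaries V U"
    and "\<And>r. is_weight V U r \<Longrightarrow> r \<in> \<real>"
    and "- 1 < t" and "t \<le> 1"
    and "is_weight V U (of_real (t + 2 * of_int m))"
    and "\<And>r. is_weight V U r \<Longrightarrow> t + 2 * of_int m \<le> Re r"
    and "S \<in> one_point_functions V U"
  shows "slash_gamma V U t S \<in> one_point_functions V U"
proof -
  interpret voa_rep V U
    using assms(1,3) by (simp add: voa_rep_def irreducible_module_def voa_module_def)
  let ?r = "of_real (t + 2 * of_int m) :: complex"
  have "msp.span (\<Union>j::nat. weight_space V U (?r + of_nat j)) = UNIV"
    using assms(9) by (intro irreducible_weights_above[OF assms(3,8)]) simp
  from square_weight_spaces_span[OF this]
  have "msp.span (\<Union>j::nat. square_weight_space V U (?r + of_nat j)) = UNIV" .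
  \<comment> \<open>The lowest weight differs from \<open>t\<close> by the integer
    \<open>2m\<close>, so both families lie in the same coset.\<close>
  moreover have "(\<Union>j::nat. square_weight_space V U (?r + of_nat j)) \<subseteq> (\<Union>n::int. square_weight_space V U (of_real t + of_int n))"
  proof (intro UN_least)
    fix j :: nat
    have "?r + of_nat j = of_real t + of_int (2 * m + int j)" by simp
    then show "square_weight_space V U (?r + of_nat j) \<subseteq> (\<Union>n::int. square_weight_space V U (of_real t + of_int n))"
      by (metis UN_upper UNIV_I)
  qed
  ultimately have "msp.span (\<Union>n::int. square_weight_space V U (of_real t + of_int n)) = UNIV"
    using msp.span_mono by blast
  then interpret one_point V U t S
    using assms(10) by unfold_locales
  show ?thesis using slash_one_point by (simp add: slash_gamma_eq)
qed

end
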